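(* Let $n\ge1$ and $G=SL_{n+1}(\mathbb{C})$. For each partition $\Pi_A\setminus\Pi_A^\ast=\mathcal{C}\sqcup\mathcal{O}$ and each dominant integral weight $\lambda\in P_+$, the set $$\{v_\lambda^{(\mathcal{C},\mathcal{O})}({\bm a})\mid{\bm a}\in\widehat{\Delta}_{\mathcal{C},\mathcal{O}}(\lambda)\cap\mathbb{Z}^N\}$$ forms a $\mathbb{C}$-basis of $V(\lambda)$ (parametrized by the lattice points ${\bm a}$).
   Context: **Group data.** $I=\{1,\dots,n\}$, $N=n(n+1)/2$; $e_i=E_{i,i+1}$, $f_i=E_{i+1,i}$, $h_i=E_{i,i}-E_{i+1,i+1}$ in $\mathfrak{sl}_{n+1}(\mathbb{C})$; $\varpi_1,\dots,\varpi_n$ are the fundamental weights and $P_+$ is the set of dominant integral weights. $W=N_G(H)/H$ ($H$ the diagonal torus) has simple reflections $s_i$ and identity $e$; the lifts are $\overline{s}_i=\exp(f_i)\exp(-e_i)\exp(f_i)$, and $\overline{e}$ is the identity matrix. $V(\lambda)$ is the irreducible $G$-module with highest weight $\lambda$ (with respect to upper triangular matrices) and highest weight vector $v_\lambda$. **Gelfand--Tsetlin poset.** Set $\lambda_{\geq k}=\sum_{\ell=k}^n\langle\lambda,h_\ell\rangle$. The finite poset $\Pi_A$ has elements $\Pi_A^\ast=\{p_0,\dots,p_n\}$ and $\Pi_A\setminus\Pi_A^\ast=\{q_j^{(i)}\mid1\le i\le n,\ 1\le j\le n+1-i\}$, with partial order $\preceq$ generated by $p_{j-1}\prec q_j^{(1)}\prec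 p_j$ ($1\le j\le n$) and $q_j^{(i)}\prec q_j^{(i+1)}\prec q_{j+1}^{(i)}$ ($1\le i\le n-1$, $1\le j\le n-i$). The marking is $\lambda_{p_0}=0$, $\lambda_{p_j}=\lambda_{\geq n+1-j}$. Arrange $\Pi_A\setminus\Pi_A^\ast$ as $(q_1,\dots,q_N)=(q_1^{(1)},q_1^{(2)},q_2^{(1)},q_1^{(3)},q_2^{(2)},q_3^{(1)},\dots,q_1^{(n)},q_2^{(n-1)},\dots,q_n^{(1)})$; this identifies $\mathbb{R}^{\Pi_A\setminus\Pi_A^\ast}$ with $\mathbb{R}^N$. **Marked chain-order polytope.** $\Delta_{\mathcal{C},\mathcal{O}}(\Pi_A,\Pi_A^\ast,\lambda)$ is the set of $(x_p)_p\in\mathbb{R}^{\Pi_A\setminus\Pi_A^\ast}$ such that $x_p\ge0$ for all $p\in\mathcal{C}$, and $\sum_{i=1}^\ell x_{p_i}\le y_b-y_a$ for all chains $a\prec p_1\prec\cdots\prec p_\ell\prec b$ with $\ell\ge0$, all $p_i\in\mathcal{C}$, and $a,b\in\Pi_A^\ast\sqcup\mathcal{O}$; here $y_c=\lambda_c$ if $c\in\Pi_A^\ast$ and $y_c=x_c$ if $c\in\mathcal{O}$. **Translation.** For $1\le k\le n$, ${\bm d}_{\varpi_k}\in\{0,1\}^N$ is the vector whose coordinate at $q_\ell^{(m)}$ is $1$ if $\ell\ge n-k+2$ and $q_\ell^{(m)}\in\mathcal{O}$, and $0$ otherwise. For $\lambda=\lambda_1\varpi_1+\cdots+\lambda_n\varpi_n$,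 put ${\bm d}_\lambda=\lambda_1{\bm d}_{\varpi_1}+\cdots+\lambda_n{\bm d}_{\varpi_n}$ and $\widehat{\Delta}_{\mathcal{C},\mathcal{O}}(\lambda)=\Delta_{\mathcal{C},\mathcal{O}}(\Pi_A,\Pi_A^\ast,\lambda)-{\bm d}_\lambda$, which is contained in $\mathbb{R}_{\ge0}^N$. **Vectors.** Let $(i_1,\dots,i_N)=(1,2,1,3,2,1,\dots,n,n-1,\dots,1)$; put $u_k=s_{i_k}$ if $q_k\in\mathcal{C}$ and $u_k=e$ if $q_k\in\mathcal{O}$. For ${\bm a}=(a_1,\dots,a_N)\in\mathbb{Z}_{\ge0}^N$, $v_\lambda^{(\mathcal{C},\mathcal{O})}({\bm a})=\overline{u_1}f_{i_1}^{(a_1)}\cdots\overline{u_N}f_{i_N}^{(a_N)}v_\lambda$, where $f_i^{(a)}=f_i^a/a!$. *)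

theory Defs
  imports Complex_Main "Jordan_Normal_Form.Determinant"
begin

section \<open>The group \<open>SL_{n+1}(\<complex>)\<close> and its rational modules\<close>

definition SL :: "nat \<Rightarrow> complex mat set" where
  "SL n = {g \<in> carrier_mat (n + 1) (n + 1). det g = 1}"

text \<open>Rows and columns of \<open>complex mat\<close> are numbered from 0; the indices of \<open>E\<close>, \<open>e\<close>, \<open>f\<close>
  below are numbered from 1.\<close>

definition matrix_unit :: "nat \<Rightarrow> nat \<Rightarrow> nat \<Rightarrow> complex mat" where
  "matrix_unit n i j =
     mat (n + 1) (n + 1) (\<lambda>(r, c). if r + 1 = i \<and> c + 1 = j then 1 else 0)"

definition e_mat :: "nat \<Rightarrow> nat \<Rightarrow> complex mat" where
  "e_mat n i = matrix_unit n i (i + 1)"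

definition f_mat :: "nat \<Rightarrow> nat \<Rightarrow> complex mat" where
  "f_mat n i = matrix_unit n (i + 1) i"

definition mat_exp :: "complex mat \<Rightarrow> complex mat" where
  "mat_exp A =
     mat (dim_row A) (dim_row A) (\<lambda>(r, c). \<Sum>k. (A ^\<^sub>m k) $$ (r, c) / fact k)"

definition s_lift :: "nat \<Rightarrow> nat \<Rightarrow> complex mat" where
  "s_lift n i = mat_exp (f_mat n i) * mat_exp (- e_mat n i) * mat_exp (f_mat n i)"

text \<open>The polynomial functions of the entries of an \<open>m \<times> m\<close> matrix.\<close>

inductive polynomial_fn :: "nat \<Rightarrow> (complex mat \<Rightarrow> complex) \<Rightarrow> bool" for m :: nat where
  const: "polynomial_fn m (\<lambda>_. a)"
| entry: "r < m \<Longrightarrow> c < m \<Longrightarrow> polynomial_fn m (\<lambda>g. g $$ (r, c))"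
| add: "polynomial_fn m p \<Longrightarrow> polynomial_fn m q \<Longrightarrow> polynomial_fn m (\<lambda>g. p g + q g)"
| mult: "polynomial_fn m p \<Longrightarrow> polynomial_fn m q \<Longrightarrow> polynomial_fn m (\<lambda>g. p g * q g)"

text \<open>\<open>SL n\<close> is closed in the space of all matrices, so its regular functions are the
  restrictions of polynomial functions.\<close>

definition regular_on_SL :: "nat \<Rightarrow> (complex mat \<Rightarrow> complex) \<Rightarrow> bool" where
  "regular_on_SL n F \<longleftrightarrow> (\<exists>p. polynomial_fn (n + 1) p \<and> (\<forall>g\<in>SL n. F g = p g))"

text \<open>Finite-dimensional modules over the algebraic group \<open>SL n\<close>, on the complex vector space
  with scalar multiplication \<open>scale\<close> whose underlying additive group is the whole type \<open>'v\<close>.\<close>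

locale SL_module = vector_space scale
  for scale :: "complex \<Rightarrow> 'v::ab_group_add \<Rightarrow> 'v" +
  fixes n :: nat and \<rho> :: "complex mat \<Rightarrow> 'v \<Rightarrow> 'v"
  assumes finite_dim: "\<exists>B. finite B \<and> span B = UNIV"
    and linear_action: "g \<in> SL n \<Longrightarrow> Vector_Spaces.linear scale scale (\<rho> g)"
    and action_one: "\<rho> (1\<^sub>m (n + 1)) v = v"
    and action_mult: "g \<in> SL n \<Longrightarrow> h \<in> SL n \<Longrightarrow> \<rho> (g * h) v = \<rho> g (\<rho> h v)"
    and rational_action:
      "Vector_Spaces.linear scale (*) \<phi> \<Longrightarrow> regular_on_SL n (\<lambda>g. \<phi> (\<rho> g v))"

locale irreducible_SL_module = SL_module scale n \<rho>
  for scale :: "complex \<Rightarrow> 'v::ab_group_add \<Rightarrow> 'v" and n \<rho> +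
  assumes nonzero: "\<exists>v::'v. v \<noteq> 0"
    and irreducible:
      "subspace U \<Longrightarrow> (\<And>g v. g \<in> SL n \<Longrightarrow> v \<in> U \<Longrightarrow> \<rho> g v \<in> U) \<Longrightarrow> U = {0} \<or> U = UNIV"

text \<open>A dominant integral weight \<open>lam = \<Sum>k. lam k \<cdot> \<varpi>\<^sub>k\<close> is given by its coefficients
  \<open>lam k = \<langle>lam, h\<^sub>k\<rangle>\<close> for \<open>1 \<le> k \<le> n\<close>; other values of \<open>lam\<close> play no role. The weight is viewed as
  a character of the upper triangular Borel subgroup, on which \<open>\<varpi>\<^sub>k\<close> is the product of the first
  \<open>k\<close> diagonal entries.\<close>

definition fund_character :: "nat \<Rightarrow> complex mat \<Rightarrow> complex" where
  "fund_character k b = (\<Prod>r<k. b $$ (r, r))"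

definition weight_character :: "nat \<Rightarrow> (nat \<Rightarrow> nat) \<Rightarrow> complex mat \<Rightarrow> complex" where
  "weight_character n lam b = (\<Prod>k=1..n. fund_character k b ^ lam k)"

definition highest_weight_vector ::
  "(complex \<Rightarrow> 'v::ab_group_add \<Rightarrow> 'v) \<Rightarrow> nat \<Rightarrow> (complex mat \<Rightarrow> 'v \<Rightarrow> 'v) \<Rightarrow> (nat \<Rightarrow> nat) \<Rightarrow> 'v \<Rightarrow> bool"
where
  "highest_weight_vector scale n \<rho> lam v \<longleftrightarrow>
     v \<noteq> 0 \<and>
     (\<forall>b\<in>SL n. upper_triangular b \<longrightarrow> \<rho> b v = scale (weight_character n lam b) v)"

text \<open>The differential of \<open>\<rho>\<close>: the derivative of \<open>t \<mapsto> \<rho> (exp (t X)) v\<close> at \<open>t = 0\<close>, taken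
  weakly because \<open>'v\<close> carries no topology. On a finite-dimensional module the vector \<open>w\<close> is unique
  since linear functionals separate points.\<close>

definition lie_action ::
  "(complex \<Rightarrow> 'v::ab_group_add \<Rightarrow> 'v) \<Rightarrow> (complex mat \<Rightarrow> 'v \<Rightarrow> 'v) \<Rightarrow> complex mat \<Rightarrow> 'v \<Rightarrow> 'v"
where
  "lie_action scale \<rho> X v =
     (THE w. \<forall>\<phi>. Vector_Spaces.linear scale (*) \<phi> \<longrightarrow>
        ((\<lambda>t. \<phi> (\<rho> (mat_exp (t \<cdot>\<^sub>m X)) v)) has_field_derivative \<phi> w) (at 0))"

definition f_divpow ::
  "(complex \<Rightarrow> 'v::ab_group_add \<Rightarrow> 'v) \<Rightarrow> nat \<Rightarrow> (complex mat \<Rightarrow> 'v \<Rightarrow> 'v) \<Rightarrow> nat \<Rightarrow> nat \<Rightarrow> 'v \<Rightarrow> 'v"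
where
  "f_divpow scale n \<rho> i a v =
     scale (1 / fact a) ((lie_action scale \<rho> (f_mat n i) ^^ a) v)"

section \<open>The Gelfand--Tsetlin poset\<close>

text \<open>\<open>P j\<close> stands for \<open>p\<^sub>j\<close> and \<open>Q i j\<close> for \<open>q\<^sub>j\<^sup>(\<^sup>i\<^sup>)\<close>.\<close>

datatype gt = P nat | Q nat nat

definition gt_marked :: "nat \<Rightarrow> gt set" where
  "gt_marked n = {P j |j. j \<le> n}"

definition gt_unmarked :: "nat \<Rightarrow> gt set" where
  "gt_unmarked n = {Q i j |i j. 1 \<le> i \<and> i \<le> n \<and> 1 \<le> j \<and> j \<le> n + 1 - i}"

inductive gt_gen :: "nat \<Rightarrow> gt \<Rightarrow> gt \<Rightarrow> bool" for n :: nat where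
  "1 \<le> j \<Longrightarrow> j \<le> n \<Longrightarrow> gt_gen n (P (j - 1)) (Q 1 j)"
| "1 \<le> j \<Longrightarrow> j \<le> n \<Longrightarrow> gt_gen n (Q 1 j) (P j)"
| "1 \<le> i \<Longrightarrow> i \<le> n - 1 \<Longrightarrow> 1 \<le> j \<Longrightarrow> j \<le> n - i \<Longrightarrow> gt_gen n (Q i j) (Q (i + 1) j)"
| "1 \<le> i \<Longrightarrow> i \<le> n - 1 \<Longrightarrow> 1 \<le> j \<Longrightarrow> j \<le> n - i \<Longrightarrow> gt_gen n (Q (i + 1) j) (Q i (j + 1))"

text \<open>The strict part of the partial order generated by \<open>gt_gen\<close>.\<close>

abbreviation gt_less :: "nat \<Rightarrow> gt \<Rightarrow> gt \<Rightarrow> bool" where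
  "gt_less n \<equiv> (gt_gen n)\<^sup>+\<^sup>+"

definition marking :: "nat \<Rightarrow> (nat \<Rightarrow> nat) \<Rightarrow> nat \<Rightarrow> real" where
  "marking n lam j = (\<Sum>l = n + 1 - j..n. real (lam l))"

text \<open>The enumeration \<open>q\<^sub>1, \<dots>, q\<^sub>N\<close> and the word \<open>i\<^sub>1, \<dots>, i\<^sub>N\<close>.\<close>

definition gt_list :: "nat \<Rightarrow> gt list" where
  "gt_list n = concat (map (\<lambda>m. map (\<lambda>j. Q (m + 1 - j) j) [1..<m + 1]) [1..<n + 1])"

definition i_list :: "nat \<Rightarrow> nat list" where
  "i_list n = concat (map (\<lambda>m. rev [1..<m + 1]) [1..<n + 1])"

section \<open>Marked chain-order polytopes\<close>

text \<open>A point of the coordinate space indexed by \<open>gt_unmarked n\<close> is a function \<open>gt \<Rightarrow> real\<close>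
  vanishing outside \<open>gt_unmarked n\<close>.\<close>

definition gt_value :: "nat \<Rightarrow> (nat \<Rightarrow> nat) \<Rightarrow> (gt \<Rightarrow> real) \<Rightarrow> gt \<Rightarrow> real" where
  "gt_value n lam x c = (case c of P j \<Rightarrow> marking n lam j | Q i j \<Rightarrow> x (Q i j))"

definition chain_order_polytope ::
  "nat \<Rightarrow> (nat \<Rightarrow> nat) \<Rightarrow> gt set \<Rightarrow> gt set \<Rightarrow> (gt \<Rightarrow> real) set"
where
  "chain_order_polytope n lam C Or =
     {x. (\<forall>p. p \<notin> gt_unmarked n \<longrightarrow> x p = 0) \<and>
         (\<forall>p\<in>C. 0 \<le> x p) \<and>
         (\<forall>a\<in>gt_marked n \<union> Or. \<forall>b\<in>gt_marked n \<union> Or. \<forall>ps.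
            set ps \<subseteq> C \<and> sorted_wrt (gt_less n) (a # ps @ [b]) \<longrightarrow>
            sum_list (map x ps) \<le> gt_value n lam x b - gt_value n lam x a)}"

definition d_fund :: "nat \<Rightarrow> gt set \<Rightarrow> nat \<Rightarrow> gt \<Rightarrow> real" where
  "d_fund n Or k p =
     (case p of P _ \<Rightarrow> 0 | Q m l \<Rightarrow> if l \<ge> n - k + 2 \<and> Q m l \<in> Or then 1 else 0)"

definition d_vec :: "nat \<Rightarrow> (nat \<Rightarrow> nat) \<Rightarrow> gt set \<Rightarrow> gt \<Rightarrow> real" where
  "d_vec n lam Or p = (\<Sum>k=1..n. real (lam k) * d_fund n Or k p)"

definition translated_polytope ::
  "nat \<Rightarrow> (nat \<Rightarrow> nat) \<Rightarrow> gt set \<Rightarrow> gt set \<Rightarrow> (gt \<Rightarrow> real) set"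
where
  "translated_polytope n lam C Or =
     (\<lambda>x p. x p - d_vec n lam Or p) ` chain_order_polytope n lam C Or"

definition lattice_points ::
  "nat \<Rightarrow> (nat \<Rightarrow> nat) \<Rightarrow> gt set \<Rightarrow> gt set \<Rightarrow> (gt \<Rightarrow> int) set"
where
  "lattice_points n lam C Or =
     {a. (\<lambda>p. real_of_int (a p)) \<in> translated_polytope n lam C Or}"

section \<open>The vectors\<close>

definition u_lift :: "nat \<Rightarrow> gt set \<Rightarrow> gt \<Rightarrow> nat \<Rightarrow> complex mat" where
  "u_lift n C q i = (if q \<in> C then s_lift n i else 1\<^sub>m (n + 1))"

text \<open>The translated polytope lies in the nonnegative orthant, so \<open>nat\<close> truncates no coordinate
  of a lattice point. The rightmost factor acts first.\<close>

definition basis_vector ::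
  "(complex \<Rightarrow> 'v::ab_group_add \<Rightarrow> 'v) \<Rightarrow> nat \<Rightarrow> (complex mat \<Rightarrow> 'v \<Rightarrow> 'v) \<Rightarrow> gt set \<Rightarrow> 'v \<Rightarrow>
   (gt \<Rightarrow> int) \<Rightarrow> 'v"
where
  "basis_vector scale n \<rho> C vlam a =
     foldr (\<lambda>(q, i) w. \<rho> (u_lift n C q i) (f_divpow scale n \<rho> i (nat (a q)) w))
       (zip (gt_list n) (i_list n)) vlam"

end

theory Submission
  imports Defs "HOL-Library.List_Lexorder"
begin

text \<open>The matrix coefficients \<open>g \<mapsto> \<phi> (\<rho> g v)\<close> of the highest weight vector are exactly the
  linear combinations of products of minors on the first columns, with \<open>lam k\<close> factors of size
  \<open>k\<close>. Straightening reduces these products to those indexed by semistandard tableaux, which bounds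
  the dimension of the module by the number of tableaux. The transfer map of Gelfand--Tsetlin patterns,
  applied to a tableau viewed as a sum of 0/1 patterns (its columns), identifies the tableaux with the
  lattice points.

  Along the curve \<open>u\<^sub>1 exp (t\<^sub>1 f) \<cdots> u\<^sub>N exp (t\<^sub>N f)\<close> the coefficient of \<open>t\<^sup>a\<close> of a matrix coefficient
  is its functional at the vector attached to \<open>a\<close>. Each column of a tableau moves through the word along
  a path of subsets, and the minor at the end of the path has the lattice point of the column as its
  lexicographically lowest exponent: whenever a smaller exponent would be possible, the
  competing minor vanishes because a letter can move only one element per antidiagonal. Lowest exponents
  add up under products, so the functionals are triangular with respect to the vectors, which are therefore
  linearly independent, and a basis by the dimension bound.\<close>

section \<open>Minors\<close>

text \<open>The module is abstract and no model of it is built, so every functional in use must be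
  shown to exist. Three facts serve this: density of the big cell and contraction of the lower
  unipotent group by a torus yield the functional with coefficient \<open>base_minor\<close>;
  positivity of a Cauchy-Binet kernel then yields one for every product of minors of the right
  shape. Straightening is used dually. A vector is a combination of orbit vectors with weights
  \<open>c g\<close>, and it is only shown that \<open>c\<close> annihilates all products of minors
  once it annihilates the standard ones; no straightening coefficients appear. The transfer map
  takes maxima and is not additive. On the columns of a tableau it becomes additive because they are
  nested, and this is why the exponents of the columns add up to a lattice point of the polytope.
  Two families of functionals are needed: the row sets at which the paths of the columns arrive need
  not form a tableau, so the triangular functionals, which give independence, differ from those that
  bound the dimension.\<close>

definition row_minor :: "nat \<Rightarrow> (nat \<Rightarrow> nat) \<Rightarrow> complex mat \<Rightarrow> complex" where
  "row_minor k r g = det (mat k k (\<lambda>(i, j). g $$ (r i, j)))"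

lemma row_minor_leibniz:
  "row_minor k r g = (\<Sum>p | p permutes {0..<k}. signof p * (\<Prod>i=0..<k. g $$ (r i, p i)))"
proof -
  have "row_minor k r g = (\<Sum>p | p permutes {0..<k}. signof p *
      (\<Prod>i=0..<k. mat k k (\<lambda>(i, j). g $$ (r i, j)) $$ (i, p i)))"
    unfolding row_minor_def by (rule det_def') auto
  also have "\<dots> = (\<Sum>p | p permutes {0..<k}. signof p * (\<Prod>i=0..<k. g $$ (r i, p i)))"
  proof (intro sum.cong refl arg_cong2[where f = "(*)"] prod.cong)
    fix p i assume "p \<in> {p. p permutes {0..<k}}" "i \<in> {0..<k}"
    then have "p i < k" "i < k" using permutes_in_image[of p "{0..<k}" i] by auto
    then show "mat k k (\<lambda>(i, j). g $$ (r i, j)) $$ (i, p i) = g $$ (r i, p i)" by simp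
  qed
  finally show ?thesis .
qed

text \<open>Renaming and scaling of rows are treated together to cover both the signed row exchange
  of a reflection lift and the rescaling of a single row.\<close>

lemma row_minor_row_scale:
  assumes "\<And>i j. i < k \<Longrightarrow> j < k \<Longrightarrow> g' $$ (r i, j) = c i * g $$ (s i, j)"
  shows "row_minor k r g' = (\<Prod>i=0..<k. c i) * row_minor k s g"
proof -
  have "(\<Prod>i=0..<k. g' $$ (r i, p i)) = (\<Prod>i=0..<k. c i) * (\<Prod>i=0..<k. g $$ (s i, p i))"
    if "p permutes {0..<k}" for p
    unfolding prod.distrib[symmetric]
    using that permutes_in_image[OF that] by (intro prod.cong refl assms) auto
  then show ?thesis
    unfolding row_minor_leibniz sum_distrib_left
    by (intro sum.cong refl) (simp add: mult_ac)
qed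

lemma row_minor_cong:
  assumes "\<And>i j. i < k \<Longrightarrow> j < k \<Longrightarrow> g' $$ (r i, j) = g $$ (s i, j)"
  shows "row_minor k r g' = row_minor k s g"
  using row_minor_row_scale[of k g' r "\<lambda>_. 1" g s] assms by simp

lemma row_minor_permute:
  assumes "p permutes {0..<k}"
  shows "row_minor k (\<lambda>i. r (p i)) g = signof p * row_minor k r g"
proof -
  have "row_minor k (\<lambda>i. r (p i)) g =
      det (mat k k (\<lambda>(i, j). mat k k (\<lambda>(i, j). g $$ (r i, j)) $$ (p i, j)))"
    unfolding row_minor_def
    using permutes_in_image[OF assms] by (intro arg_cong[where f = det] eq_matI) auto
  then show ?thesis
    unfolding row_minor_def
    using det_permute_rows[OF mat_carrier assms, of "\<lambda>(i, j). g $$ (r i, j)"] by (rule trans)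
qed

lemma row_minor_repeated:
  assumes "i < k" "j < k" "i \<noteq> j" "r i = r j"
  shows "row_minor k r g = 0"
  unfolding row_minor_def
  by (rule det_identical_rows[of _ k i j]) (use assms in \<open>auto intro!: eq_vecI\<close>)

lemma row_minor_row_linear:
  assumes "i0 < k"
    and same: "\<And>i j. i < k \<Longrightarrow> i \<noteq> i0 \<Longrightarrow> j < k \<Longrightarrow> g' $$ (r i, j) = g $$ (r i, j)"
    and comb: "\<And>j. j < k \<Longrightarrow> g' $$ (r i0, j) = g $$ (r i0, j) + c * g $$ (b, j)"
  shows "row_minor k r g' = row_minor k r g + c * row_minor k (r(i0 := b)) g"
proof -
  have "(\<Prod>i=0..<k. g' $$ (r i, p i)) =
      (\<Prod>i=0..<k. g $$ (r i, p i)) + c * (\<Prod>i=0..<k. g $$ ((r(i0 := b)) i, p i))"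
    if p: "p permutes {0..<k}" for p
  proof -
    have pk: "p i < k" if "i < k" for i using permutes_in_image[OF p, of i] that by auto
    have split: "(\<Prod>i=0..<k. f i) = f i0 * (\<Prod>i\<in>{0..<k} - {i0}. f i)" for f :: "nat \<Rightarrow> complex"
      using assms(1) by (intro prod.remove) auto
    have 1: "(\<Prod>i\<in>{0..<k} - {i0}. g' $$ (r i, p i)) = (\<Prod>i\<in>{0..<k} - {i0}. g $$ (r i, p i))"
      using pk by (intro prod.cong refl same) auto
    have 2: "(\<Prod>i\<in>{0..<k} - {i0}. g $$ ((r(i0 := b)) i, p i)) = (\<Prod>i\<in>{0..<k} - {i0}. g $$ (r i, p i))"
      by (intro prod.cong refl) auto
    show ?thesis
      unfolding split 1 2 using comb[OF pk[OF assms(1)]] by (simp add: algebra_simps)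
  qed
  then have "row_minor k r g' = (\<Sum>p | p permutes {0..<k}. signof p * (\<Prod>i=0..<k. g $$ (r i, p i))
      + c * (signof p * (\<Prod>i=0..<k. g $$ ((r(i0 := b)) i, p i))))"
    unfolding row_minor_leibniz by (intro sum.cong refl) (simp add: algebra_simps)
  then show ?thesis
    unfolding row_minor_leibniz sum.distrib sum_distrib_left .
qed

text \<open>A set of rows fixes the order and hence the sign. \<open>row_minor\<close> keeps
  arbitrary row functions because exchanges produce permuted and repeated rows. The columns are
  always the first ones, so these are the Pluecker coordinates of the flag of a matrix.\<close>

definition set_minor :: "nat set \<Rightarrow> complex mat \<Rightarrow> complex" where
  "set_minor R g = row_minor (card R) (\<lambda>i. sorted_list_of_set R ! i) g"

lemma bij_betw_sorted_list_nth:
  "finite R \<Longrightarrow> bij_betw (\<lambda>i. sorted_list_of_set R ! i) {0..<card R} R"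
  using bij_betw_nth[of "sorted_list_of_set R" "{0..<card R}" R]
  by (simp add: atLeast0LessThan)

text \<open>Sorting the rows costs the sign of a permutation. It depends on \<open>r\<close> only
  and is chosen before \<open>g\<close>, so it can be pulled out of linear combinations over
  \<open>g\<close>.\<close>

lemma row_minor_eq_set_minor:
  assumes r: "bij_betw r {0..<k} R"
  shows "\<exists>\<epsilon>\<in>{1, -1}. \<forall>g. row_minor k r g = \<epsilon> * set_minor R g"
proof -
  have fin: "finite R" and k: "card R = k"
    using bij_betw_finite[OF r] bij_betw_same_card[OF r] by auto
  let ?s = "\<lambda>i. sorted_list_of_set R ! i"
  have s: "bij_betw ?s {0..<k} R" using bij_betw_sorted_list_nth[OF fin] k by simp
  define p where "p = (\<lambda>i. if i < k then the_inv_into {0..<k} ?s (r i) else i)"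
  have "bij_betw (\<lambda>i. the_inv_into {0..<k} ?s (r i)) {0..<k} {0..<k}"
    using bij_betw_trans[OF r bij_betw_the_inv_into[OF s]] by (simp add: o_def)
  then have "bij_betw p {0..<k} {0..<k}"
    by (rule bij_betw_cong[THEN iffD1, rotated]) (auto simp: p_def)
  then have p: "p permutes {0..<k}"
    by (rule bij_imp_permutes) (auto simp: p_def)
  have sp: "?s (p i) = r i" if "i < k" for i
    using that f_the_inv_into_f_bij_betw[OF s, of "r i"] bij_betwE[OF r] by (auto simp: p_def)
  have "row_minor k r g = signof p * set_minor R g" for g
    using row_minor_permute[OF p, of ?s g] row_minor_cong[of k g r g "\<lambda>i. ?s (p i)"] sp
    by (simp add: set_minor_def k)
  then show ?thesis by (auto simp: sign_def)
qed

section \<open>Straightening\<close>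

text \<open>\<open>z\<close> lists the \<open>a + b\<close> moving rows, first those of the first
  minor, then those of the second; \<open>\<alpha>\<close> and \<open>\<beta>\<close> fill the fixed
  positions. A Garnir exchange is then just a permutation of the arguments of
  \<open>z\<close>.\<close>

definition minor_pair ::
  "nat \<Rightarrow> nat \<Rightarrow> nat \<Rightarrow> nat \<Rightarrow> (nat \<Rightarrow> nat) \<Rightarrow> (nat \<Rightarrow> nat) \<Rightarrow> complex mat \<Rightarrow> (nat \<Rightarrow> nat) \<Rightarrow> complex"
where
  "minor_pair p q a b \<alpha> \<beta> g z =
     row_minor p (\<lambda>i. if i < a then z i else \<alpha> i) g *
     row_minor q (\<lambda>i. if i < b then z (a + i) else \<beta> i) g"

lemma prod_split_block:
  assumes "(a::nat) \<le> p"
  shows "(\<Prod>i=0..<p. (if i < a then f i else h i)) = (\<Prod>i=0..<a. f i) * (\<Prod>i=a..<p. h i :: complex)"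
proof -
  have "(\<Prod>i=0..<p. (if i < a then f i else h i)) =
      (\<Prod>i=0..<a. (if i < a then f i else h i)) * (\<Prod>i=a..<p. (if i < a then f i else h i))"
    using assms by (intro prod.atLeastLessThan_concat[symmetric]) auto
  then show ?thesis by simp
qed

text \<open>In the Leibniz expansion of the two minors, the \<open>a + b\<close> moving rows meet columns numbered
  below \<open>p < a + b\<close>, so two of them share a column and the antisymmetrization vanishes.\<close>

lemma garnir_relation:
  assumes ab: "a \<le> p" "b \<le> q" "q \<le> p" "p < a + b"
  shows "(\<Sum>\<sigma> | \<sigma> permutes {0..<a + b}.
    signof \<sigma> * minor_pair p q a b \<alpha> \<beta> g (\<lambda>i. z (\<sigma> i))) = 0"
proof -
  let ?M = "a + b"
  \<comment> \<open>For Leibniz terms \<open>\<pi>\<close> and \<open>\<tau>\<close> of the two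
    minors, the moving row at position \<open>i\<close> meets this column of
    \<open>g\<close>.\<close>
  define col where "col \<pi> \<tau> i = (if i < a then \<pi> i else \<tau> (i - a))" for \<pi> \<tau> :: "nat \<Rightarrow> nat" and i
  define K where "K \<pi> \<tau> = signof \<pi> * signof \<tau> * (\<Prod>i=a..<p. g $$ (\<alpha> i, \<pi> i)) *
      (\<Prod>i=b..<q. g $$ (\<beta> i, \<tau> i))" for \<pi> \<tau> :: "nat \<Rightarrow> nat"
  have expand: "minor_pair p q a b \<alpha> \<beta> g y = (\<Sum>\<pi> | \<pi> permutes {0..<p}. \<Sum>\<tau> | \<tau> permutes {0..<q}.
      K \<pi> \<tau> * (\<Prod>i=0..<?M. g $$ (y i, col \<pi> \<tau> i)))" for y
  proof -
    have 1: "(\<Prod>i=0..<p. g $$ (if i < a then y i else \<alpha> i, \<pi> i)) =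
        (\<Prod>i=0..<a. g $$ (y i, \<pi> i)) * (\<Prod>i=a..<p. g $$ (\<alpha> i, \<pi> i))" for \<pi>
      using prod_split_block[OF ab(1), of "\<lambda>i. g $$ (y i, \<pi> i)" "\<lambda>i. g $$ (\<alpha> i, \<pi> i)"]
      by (simp add: if_distrib[of "\<lambda>r. g $$ (r, _)"] cong: if_cong)
    have 2: "(\<Prod>i=0..<q. g $$ (if i < b then y (a + i) else \<beta> i, \<tau> i)) =
        (\<Prod>i=0..<b. g $$ (y (a + i), \<tau> i)) * (\<Prod>i=b..<q. g $$ (\<beta> i, \<tau> i))" for \<tau>
      using prod_split_block[OF ab(2), of "\<lambda>i. g $$ (y (a + i), \<tau> i)" "\<lambda>i. g $$ (\<beta> i, \<tau> i)"]
      by (simp add: if_distrib[of "\<lambda>r. g $$ (r, _)"] cong: if_cong)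
    have 3: "(\<Prod>i=0..<?M. g $$ (y i, col \<pi> \<tau> i)) =
        (\<Prod>i=0..<a. g $$ (y i, \<pi> i)) * (\<Prod>i=0..<b. g $$ (y (a + i), \<tau> i))" for \<pi> \<tau>
    proof -
      have "(\<Prod>i=0..<?M. g $$ (y i, col \<pi> \<tau> i)) =
          (\<Prod>i=0..<a. g $$ (y i, col \<pi> \<tau> i)) * (\<Prod>i=a..<?M. g $$ (y i, col \<pi> \<tau> i))"
        by (simp add: prod.atLeastLessThan_concat)
      also have "(\<Prod>i=a..<?M. g $$ (y i, col \<pi> \<tau> i)) = (\<Prod>i=0..<b. g $$ (y (a + i), \<tau> i))"
        using prod.shift_bounds_nat_ivl[of "\<lambda>i. g $$ (y i, col \<pi> \<tau> i)" 0 a b]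
        by (simp add: col_def add.commute)
      finally show ?thesis by (simp add: col_def)
    qed
    show ?thesis
      unfolding minor_pair_def row_minor_leibniz sum_product 1 2 3 K_def
      by (intro sum.cong refl) (simp add: mult_ac)
  qed
  have vanish: "(\<Sum>\<sigma> | \<sigma> permutes {0..<?M}. signof \<sigma> * (\<Prod>i=0..<?M. g $$ (z (\<sigma> i), col \<pi> \<tau> i))) = 0"
    if \<pi>: "\<pi> permutes {0..<p}" and \<tau>: "\<tau> permutes {0..<q}" for \<pi> \<tau>
  proof -
    have "col \<pi> \<tau> i < p" if "i < ?M" for i
      using permutes_in_image[OF \<pi>, of i] permutes_in_image[OF \<tau>, of "i - a"] that ab
      by (auto simp: col_def)
    then have "col \<pi> \<tau> ` {0..<?M} \<subseteq> {0..<p}" by auto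
    then have "card (col \<pi> \<tau> ` {0..<?M}) < card {0..<?M}"
      using card_mono[of "{0..<p}" "col \<pi> \<tau> ` {0..<?M}"] ab(4) by simp
    then have "\<not> inj_on (col \<pi> \<tau>) {0..<?M}" using pigeonhole by blast
    then obtain i j where ij: "i < ?M" "j < ?M" "i \<noteq> j" "col \<pi> \<tau> i = col \<pi> \<tau> j"
      by (auto simp: inj_on_def)
    \<comment> \<open>The moving rows are laid out as columns here, so the Leibniz sum is the
      antisymmetrization, and two positions that share a column of \<open>g\<close> become two equal
      rows.\<close>
    let ?A = "mat ?M ?M (\<lambda>(i, j). g $$ (z j, col \<pi> \<tau> i))"
    have "det ?A = 0"
      by (rule det_identical_rows[of _ ?M i j]) (use ij in \<open>auto intro!: eq_vecI\<close>)
    moreover have "det ?A = (\<Sum>\<sigma> | \<sigma> permutes {0..<?M}. signof \<sigma> *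
        (\<Prod>i=0..<?M. ?A $$ (i, \<sigma> i)))"
      by (rule det_def') auto
    moreover have "\<dots> = (\<Sum>\<sigma> | \<sigma> permutes {0..<?M}. signof \<sigma> * (\<Prod>i=0..<?M. g $$ (z (\<sigma> i), col \<pi> \<tau> i)))"
    proof (intro sum.cong refl arg_cong2[where f = "(*)"] prod.cong)
      fix \<sigma> i assume "\<sigma> \<in> {p. p permutes {0..<?M}}" "i \<in> {0..<?M}"
      then have "\<sigma> i < ?M" "i < ?M" using permutes_in_image[of \<sigma> "{0..<?M}" i] by auto
      then show "?A $$ (i, \<sigma> i) = g $$ (z (\<sigma> i), col \<pi> \<tau> i)" by simp
    qed
    ultimately show ?thesis by simp
  qed
  have "(\<Sum>\<sigma> | \<sigma> permutes {0..<?M}. signof \<sigma> * minor_pair p q a b \<alpha> \<beta> g (\<lambda>i. z (\<sigma> i))) =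
      (\<Sum>\<pi> | \<pi> permutes {0..<p}. \<Sum>\<tau> | \<tau> permutes {0..<q}. \<Sum>\<sigma> | \<sigma> permutes {0..<?M}.
        K \<pi> \<tau> * (signof \<sigma> * (\<Prod>i=0..<?M. g $$ (z (\<sigma> i), col \<pi> \<tau> i))))"
    unfolding expand sum_distrib_left
    by (rule trans[OF sum.swap], rule sum.cong[OF refl], rule trans[OF sum.swap],
        rule sum.cong[OF refl], rule sum.cong[OF refl]) (simp add: mult_ac)
  also have "\<dots> = 0"
    unfolding sum_distrib_left[symmetric] using vanish by simp
  finally show ?thesis .
qed

lemma minor_pair_permute_left:
  assumes "a \<le> p" "\<sigma> permutes {0..<a}"
  shows "minor_pair p q a b \<alpha> \<beta> g (\<lambda>i. z (\<sigma> i)) = signof \<sigma> * minor_pair p q a b \<alpha> \<beta> g z"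
proof -
  have \<sigma>: "\<sigma> permutes {0..<p}" by (rule permutes_subset[OF assms(2)]) (use assms(1) in auto)
  have lt: "\<sigma> i < a \<longleftrightarrow> i < a" for i using permutes_in_image[OF assms(2), of i] by simp
  have fx: "\<sigma> i = i" if "\<not> i < a" for i using permutes_not_in[OF assms(2), of i] that by simp
  have 1: "(\<lambda>i. if i < a then z (\<sigma> i) else \<alpha> i) = (\<lambda>i. (\<lambda>j. if j < a then z j else \<alpha> j) (\<sigma> i))"
    using lt fx by auto
  have 2: "(\<lambda>i. if i < b then z (\<sigma> (a + i)) else \<beta> i) = (\<lambda>i. if i < b then z (a + i) else \<beta> i)"
    using fx by auto
  show ?thesis
    unfolding minor_pair_def 2 unfolding 1
    using row_minor_permute[OF \<sigma>, of "\<lambda>j. if j < a then z j else \<alpha> j" g] by (simp only: mult.assoc)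
qed

lemma minor_pair_transpose_right:
  assumes "b \<le> q" "x \<in> {a..<a + b}" "y \<in> {a..<a + b}" "x \<noteq> y"
  shows "minor_pair p q a b \<alpha> \<beta> g (\<lambda>i. z (Transposition.transpose x y i)) = - minor_pair p q a b \<alpha> \<beta> g z"
proof -
  let ?t = "Transposition.transpose (x - a) (y - a)"
  have t: "?t permutes {0..<q}"
    by (rule permutes_swap_id) (use assms in auto)
  have 1: "(\<lambda>i. if i < a then z (Transposition.transpose x y i) else \<alpha> i) = (\<lambda>i. if i < a then z i else \<alpha> i)"
    using assms by (auto simp: Transposition.transpose_def)
  have 2: "(\<lambda>i. if i < b then z (Transposition.transpose x y (a + i)) else \<beta> i) =
      (\<lambda>i. (\<lambda>j. if j < b then z (a + j) else \<beta> j) (?t i))"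
  proof
    fix i
    have "?t permutes {0..<b}"
      by (rule permutes_swap_id) (use assms in auto)
    then have lt: "?t i < b \<longleftrightarrow> i < b" using permutes_in_image[of ?t "{0..<b}" i] by simp
    obtain x' y' where "x = a + x'" "y = a + y'"
      using assms(2,3) by (metis atLeastLessThan_iff le_Suc_ex)
    then have tr: "Transposition.transpose x y (a + i) = a + ?t i"
      by (simp add: Transposition.transpose_def)
    have "?t i = i" if "\<not> i < b"
      using that assms(2,3) by (intro transpose_apply_other) auto
    then show "(if i < b then z (Transposition.transpose x y (a + i)) else \<beta> i) =
        (\<lambda>j. if j < b then z (a + j) else \<beta> j) (?t i)"
      unfolding tr by (simp add: lt)
  qed
  have "sign ?t = -1" using assms by (subst sign_swap_id) auto
  then show ?thesis
    unfolding minor_pair_def 1 unfolding 2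
    using row_minor_permute[OF t, of "\<lambda>j. if j < b then z (a + j) else \<beta> j" g] by simp
qed

lemma minor_pair_permute_right:
  assumes "b \<le> q" "\<sigma> permutes {a..<a + b}"
  shows "minor_pair p q a b \<alpha> \<beta> g (\<lambda>i. z (\<sigma> i)) = signof \<sigma> * minor_pair p q a b \<alpha> \<beta> g z"
proof -
  \<comment> \<open>The claim is needed for all \<open>z\<close>, because the induction step uses it
    for \<open>z\<close> composed with a transposition.\<close>
  have "\<forall>z. minor_pair p q a b \<alpha> \<beta> g (\<lambda>i. z (\<sigma> i)) = signof \<sigma> * minor_pair p q a b \<alpha> \<beta> g z"
    using assms(2) finite_atLeastLessThan
  proof (induction rule: permutes_induct)
    case id
    then show ?case by simp
  next
    case (swap x y \<tau>)
    have perm: "permutation \<tau>" using swap.hyps permutation_permutes by blast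
    have sg: "sign (Transposition.transpose x y \<circ> \<tau>) = - sign \<tau>"
      using swap.hyps by (simp add: sign_compose[OF permutation_swap_id perm] sign_swap_id)
    show ?case
    proof
      fix z
      have "minor_pair p q a b \<alpha> \<beta> g (\<lambda>i. z ((Transposition.transpose x y \<circ> \<tau>) i)) =
          signof \<tau> * minor_pair p q a b \<alpha> \<beta> g (\<lambda>i. z (Transposition.transpose x y i))"
        using swap.IH[rule_format, of "\<lambda>i. z (Transposition.transpose x y i)"] by simp
      also have "\<dots> = - (signof \<tau> * minor_pair p q a b \<alpha> \<beta> g z)"
        using minor_pair_transpose_right[OF assms(1) swap.hyps(1-3)] by simp
      finally show "minor_pair p q a b \<alpha> \<beta> g (\<lambda>i. z ((Transposition.transpose x y \<circ> \<tau>) i)) =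
          signof (Transposition.transpose x y \<circ> \<tau>) * minor_pair p q a b \<alpha> \<beta> g z"
        by (simp add: sg)
    qed
  qed
  then show ?thesis by blast
qed

text \<open>Such a \<open>\<sigma>\<close> is a permutation of the first block times one of the
  second, and each minor alternates in its own rows. All these permutations therefore contribute the
  same signed term.\<close>

lemma minor_pair_permute_blocks:
  assumes "a \<le> p" "b \<le> q" "\<sigma> permutes {0..<a + b}" "\<sigma> ` {0..<a} = {0..<a}"
  shows "signof \<sigma> * minor_pair p q a b \<alpha> \<beta> g (\<lambda>i. z (\<sigma> i)) = minor_pair p q a b \<alpha> \<beta> g z"
proof -
  define s1 where "s1 = (\<lambda>i. if i < a then \<sigma> i else i)"
  define s2 where "s2 = (\<lambda>i. if i < a then i else \<sigma> i)"
  have inj: "inj \<sigma>" using permutes_inj[OF assms(3)] .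
  have lt: "\<sigma> i < a \<longleftrightarrow> i < a" for i
  proof
    assume "\<sigma> i < a"
    then have "\<sigma> i \<in> \<sigma> ` {0..<a}" using assms(4) by simp
    then show "i < a" using inj_image_mem_iff[OF inj, of i "{0..<a}"] by simp
  qed (use assms(4) in auto)
  have s1: "s1 permutes {0..<a}"
  proof (rule bij_imp_permutes)
    have "bij_betw \<sigma> {0..<a} {0..<a}"
      using inj assms(4) by (auto simp: bij_betw_def inj_on_def inj_def)
    then show "bij_betw s1 {0..<a} {0..<a}"
      by (rule bij_betw_cong[THEN iffD1, rotated]) (auto simp: s1_def)
  qed (auto simp: s1_def)
  have s2: "s2 permutes {a..<a + b}"
  proof (rule bij_imp_permutes)
    have "\<sigma> ` {a..<a + b} \<subseteq> {a..<a + b}"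
      using lt permutes_in_image[OF assms(3)] by (fastforce simp: not_less[symmetric])
    then have "\<sigma> ` {a..<a + b} = {a..<a + b}"
      using inj by (intro card_subset_eq) (auto simp: card_image inj_on_def inj_def)
    then have "bij_betw \<sigma> {a..<a + b} {a..<a + b}"
      using inj by (auto simp: bij_betw_def inj_on_def inj_def)
    then show "bij_betw s2 {a..<a + b} {a..<a + b}"
      by (rule bij_betw_cong[THEN iffD1, rotated]) (auto simp: s2_def)
  next
    fix i assume "i \<notin> {a..<a + b}"
    then show "s2 i = i" using permutes_not_in[OF assms(3), of i] by (auto simp: s2_def)
  qed
  have comp: "\<sigma> = s1 \<circ> s2" by (rule ext) (simp add: s1_def s2_def lt)
  have perm: "permutation s1" "permutation s2" using s1 s2 permutation_permutes by blast+
  have "minor_pair p q a b \<alpha> \<beta> g (\<lambda>i. z (\<sigma> i)) = signof s2 * (signof s1 * minor_pair p q a b \<alpha> \<beta> g z)"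
    using minor_pair_permute_right[OF assms(2) s2, of p \<alpha> \<beta> g "\<lambda>i. z (s1 i)"]
      minor_pair_permute_left[OF assms(1) s1, of q b \<alpha> \<beta> g z] comp by simp
  moreover have "sign \<sigma> * (sign s2 * sign s1) = 1"
    unfolding comp sign_compose[OF perm] by (simp add: sign_def)
  then have "signof \<sigma> * (signof s2 * signof s1) = (1 :: complex)"
    by (metis of_int_1 of_int_mult)
  ultimately show ?thesis
    by (metis mult.assoc mult_1)
qed

lemma sum_shift_block: "(\<Sum>i=0..<b. f (a + i)) = (\<Sum>i=a..<a + b. f i)" for f :: "nat \<Rightarrow> nat"
  using sum.shift_bounds_nat_ivl[of f 0 a b] by (simp add: add.commute)

lemma sum_split_block:
  assumes "(a::nat) \<le> p"
  shows "(\<Sum>i=0..<p. (if i < a then f i else h i)) = (\<Sum>i=0..<a. f i) + (\<Sum>i=a..<p. h i :: nat)"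
proof -
  have "(\<Sum>i=0..<p. (if i < a then f i else h i)) =
      (\<Sum>i=0..<a. (if i < a then f i else h i)) + (\<Sum>i=a..<p. (if i < a then f i else h i))"
    using assms by (intro sum.atLeastLessThan_concat[symmetric]) auto
  then show ?thesis by simp
qed

lemma sum_exchange_less:
  fixes z :: "nat \<Rightarrow> nat"
  assumes "finite J" "finite K" "card J = card K" "J \<noteq> K"
    and "\<And>j. j \<in> J - K \<Longrightarrow> z j < m" "\<And>j. j \<in> K \<Longrightarrow> m \<le> z j"
  shows "sum z J < sum z K"
proof -
  have cards: "card (J - K) = card (K - J)"
    using assms(1-3) by (simp add: card_Diff_subset_Int Int_commute)
  have "J - K \<noteq> {}"
    using assms(1-4) by (metis Diff_eq_empty_iff card_subset_eq)
  then have "sum z (J - K) < (\<Sum>j\<in>J - K. m)"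
    using assms(1,5) by (intro sum_strict_mono) auto
  also have "\<dots> = (\<Sum>j\<in>K - J. m)" using cards by simp
  also have "\<dots> \<le> sum z (K - J)" using assms(6) by (intro sum_mono) auto
  finally have "sum z (J - K) < sum z (K - J)" .
  moreover have "sum z J = sum z (J \<inter> K) + sum z (J - K)"
    using assms(1) by (metis sum.Int_Diff)
  moreover have "sum z K = sum z (J \<inter> K) + sum z (K - J)"
    using assms(2) by (metis Int_commute sum.Int_Diff)
  ultimately show ?thesis by simp
qed

lemma ex_bij_betw_interval:
  assumes "finite A"
  shows "\<exists>f. bij_betw f {m..<m + card A} A"
proof -
  obtain h where "bij_betw h {0..<card A} A" using ex_bij_betw_nat_finite[OF assms] by blast
  moreover have "bij_betw (\<lambda>i. i - m) {m..<m + card A} {0..<card A}"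
    by (rule bij_betwI[of _ _ _ "\<lambda>i. i + m"]) auto
  ultimately show ?thesis using bij_betw_trans by blast
qed

lemma bij_betw_join:
  assumes "bij_betw f A C" "bij_betw h B D" "A \<inter> B = {}" "C \<inter> D = {}"
    and "\<And>x. x \<in> A \<Longrightarrow> k x = f x" "\<And>x. x \<in> B \<Longrightarrow> k x = h x"
  shows "bij_betw k (A \<union> B) (C \<union> D)"
  by (rule bij_betw_combine[OF _ _ assms(4)])
    (use assms bij_betw_cong[of A k f C] bij_betw_cong[of B k h D] in auto)

text \<open>By \<open>viol\<close>, the rows of \<open>R\<close> below \<open>m\<close> and the rows
  of \<open>S\<close> from \<open>m\<close> on outnumber the columns of the larger minor. The Garnir
  relation on these rows replaces the term by exchanges that bring smaller rows into
  \<open>S\<close>. The weight \<open>c\<close> is arbitrary so that it can absorb the other factors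
  of a longer product.\<close>

lemma straightening_pair:
  assumes fin: "finite R" "finite S" and le: "card S \<le> card R"
    and viol: "card {r \<in> R. m \<le> r} < card {s \<in> S. m \<le> s}"
    and smaller: "\<And>R' S'. R' \<subseteq> R \<union> S \<Longrightarrow> S' \<subseteq> R \<union> S \<Longrightarrow> card R' = card R \<Longrightarrow> card S' = card S \<Longrightarrow>
      \<Sum>R' + \<Sum>S' = \<Sum>R + \<Sum>S \<Longrightarrow> \<Sum>S' < \<Sum>S \<Longrightarrow>
      (\<Sum>g\<in>G. c g * (set_minor R' g * set_minor S' g)) = 0"
  shows "(\<Sum>g\<in>G. c g * (set_minor R g * set_minor S g)) = 0"
proof -
  \<comment> \<open>The rows in \<open>X\<close> and \<open>Y\<close> move, those in
    \<open>A\<close> and \<open>B\<close> stay fixed.\<close>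
  define X where "X = {r \<in> R. r < m}"
  define A where "A = {r \<in> R. m \<le> r}"
  define Y where "Y = {s \<in> S. m \<le> s}"
  define B where "B = {s \<in> S. s < m}"
  have finXY: "finite X" "finite A" "finite Y" "finite B" using fin by (auto simp: X_def A_def Y_def B_def)
  define a where "a = card X"
  define b where "b = card Y"
  define p where "p = card R"
  define q where "q = card S"
  have R: "R = X \<union> A" "X \<inter> A = {}" by (auto simp: X_def A_def)
  have S: "S = Y \<union> B" "Y \<inter> B = {}" by (auto simp: Y_def B_def)
  have p: "p = a + card A" unfolding p_def a_def R(1) by (rule card_Un_disjoint) (use finXY R in auto)
  have q: "q = b + card B" unfolding q_def b_def S(1) by (rule card_Un_disjoint) (use finXY S in auto)
  have ab: "a \<le> p" "b \<le> q" "q \<le> p" "p < a + b"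
    using p q le viol by (auto simp: p_def q_def a_def b_def A_def Y_def)
  obtain zX where zX: "bij_betw zX {0..<a} X"
    using ex_bij_betw_interval[OF finXY(1), of 0] by (auto simp: a_def)
  obtain zY where zY: "bij_betw zY {a..<a + b} Y"
    using ex_bij_betw_interval[OF finXY(3), of a] by (auto simp: b_def)
  obtain \<alpha> where \<alpha>: "bij_betw \<alpha> {a..<p} A"
    using ex_bij_betw_interval[OF finXY(2), of a] by (auto simp: p)
  obtain \<beta> where \<beta>: "bij_betw \<beta> {b..<q} B"
    using ex_bij_betw_interval[OF finXY(4), of b] by (auto simp: q)
  define z where "z i = (if i < a then zX i else zY i)" for i
  have zX': "bij_betw z {0..<a} X" using zX bij_betw_cong[of "{0..<a}" z zX] by (simp add: z_def)
  have zY': "bij_betw z {a..<a + b} Y" using zY bij_betw_cong[of "{a..<a + b}" z zY] by (simp add: z_def)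
  have z_low: "z i < m" if "i < a" for i
    using bij_betwE[OF zX'] that by (auto simp: X_def)
  have z_high: "m \<le> z i" if "i \<in> {a..<a + b}" for i
    using bij_betwE[OF zY'] that by (auto simp: Y_def)
  have z_in: "z i \<in> R \<union> S" if "i < a + b" for i
    using bij_betwE[OF zX'] bij_betwE[OF zY'] that R S by (cases "i < a") auto
  define r1 where "r1 \<sigma> i = (if i < a then z (\<sigma> i) else \<alpha> i)" for \<sigma> :: "nat \<Rightarrow> nat" and i
  define r2 where "r2 \<sigma> i = (if i < b then z (\<sigma> (a + i)) else \<beta> i)" for \<sigma> :: "nat \<Rightarrow> nat" and i
  define F where "F \<sigma> = (\<Sum>g\<in>G. c g * (row_minor p (r1 \<sigma>) g * row_minor q (r2 \<sigma>) g))" for \<sigma>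
  have F_pair: "F \<sigma> = (\<Sum>g\<in>G. c g * minor_pair p q a b \<alpha> \<beta> g (\<lambda>i. z (\<sigma> i)))" for \<sigma>
    by (simp add: F_def minor_pair_def r1_def[abs_def] r2_def[abs_def])
  have sum1: "(\<Sum>i=0..<p. r1 \<sigma> i) = (\<Sum>i=0..<a. z (\<sigma> i)) + \<Sum>A" for \<sigma>
    unfolding r1_def sum_split_block[OF ab(1)] using sum.reindex_bij_betw[OF \<alpha>, of "\<lambda>x. x"] by simp
  have sum2: "(\<Sum>i=0..<q. r2 \<sigma> i) = (\<Sum>i=a..<a + b. z (\<sigma> i)) + \<Sum>B" for \<sigma>
    unfolding r2_def sum_split_block[OF ab(2)]
    using sum.reindex_bij_betw[OF \<beta>, of "\<lambda>x. x"] sum_shift_block[of "\<lambda>i. z (\<sigma> i)" a b] by simp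
  have base1: "bij_betw (r1 id) {0..<p} R"
  proof -
    have "{0..<p} = {0..<a} \<union> {a..<p}" using ab by auto
    then show ?thesis unfolding R(1)
      using bij_betw_join[OF zX' \<alpha> _ R(2), of "r1 id"] by (auto simp: r1_def)
  qed
  have base2: "bij_betw (r2 id) {0..<q} S"
  proof -
    have "bij_betw (\<lambda>i. a + i) {0..<b} {a..<a + b}" by (rule bij_betwI[of _ _ _ "\<lambda>i. i - a"]) auto
    then have "bij_betw (\<lambda>i. z (a + i)) {0..<b} Y" using bij_betw_trans[OF _ zY'] unfolding o_def by blast
    moreover have "{0..<q} = {0..<b} \<union> {b..<q}" using ab by auto
    ultimately show ?thesis unfolding S(1)
      using bij_betw_join[OF _ \<beta> _ S(2), of _ "{0..<b}" "r2 id"] by (auto simp: r2_def)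
  qed
  have sumR: "\<Sum>R = (\<Sum>i=0..<p. r1 id i)" using sum.reindex_bij_betw[OF base1, of "\<lambda>x. x"] by simp
  have sumS: "\<Sum>S = (\<Sum>i=0..<q. r2 id i)" using sum.reindex_bij_betw[OF base2, of "\<lambda>x. x"] by simp
  \<comment> \<open>An exchange that mixes the blocks either repeats a row, which kills a minor, or
    leads to a pair covered by \<open>smaller\<close>.\<close>
  have zero: "F \<sigma> = 0" if \<sigma>: "\<sigma> permutes {0..<a + b}" and nb: "\<sigma> ` {0..<a} \<noteq> {0..<a}" for \<sigma>
  proof (cases "inj_on (r1 \<sigma>) {0..<p} \<and> inj_on (r2 \<sigma>) {0..<q}")
    case False
    then have "row_minor p (r1 \<sigma>) g * row_minor q (r2 \<sigma>) g = 0" for g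
      using row_minor_repeated[of _ p _ "r1 \<sigma>" g] row_minor_repeated[of _ q _ "r2 \<sigma>" g]
      by (fastforce simp: inj_on_def)
    then show ?thesis by (simp add: F_def del: mult_eq_0_iff)
  next
    case True
    define R' where "R' = r1 \<sigma> ` {0..<p}"
    define S' where "S' = r2 \<sigma> ` {0..<q}"
    have b1: "bij_betw (r1 \<sigma>) {0..<p} R'" and b2: "bij_betw (r2 \<sigma>) {0..<q} S'"
      using True by (auto simp: R'_def S'_def bij_betw_def)
    have \<sigma>_lt: "\<sigma> i < a + b \<longleftrightarrow> i < a + b" for i using permutes_in_image[OF \<sigma>, of i] by simp
    have inj: "inj \<sigma>" using permutes_inj[OF \<sigma>] .
    have "r1 \<sigma> i \<in> R \<union> S" if "i < p" for i
      using z_in[of "\<sigma> i"] \<sigma>_lt[of i] bij_betwE[OF \<alpha>, rule_format, of i] R(1) that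
      by (cases "i < a") (auto simp: r1_def)
    then have "R' \<subseteq> R \<union> S" unfolding R'_def by (intro image_subsetI) simp
    moreover have "r2 \<sigma> i \<in> R \<union> S" if "i < q" for i
      using z_in[of "\<sigma> (a + i)"] \<sigma>_lt[of "a + i"] bij_betwE[OF \<beta>, rule_format, of i] S(1) that
      by (cases "i < b") (auto simp: r2_def)
    then have "S' \<subseteq> R \<union> S" unfolding S'_def by (intro image_subsetI) simp
    moreover have "card R' = card R" "card S' = card S"
      using bij_betw_same_card[OF b1] bij_betw_same_card[OF b2] by (auto simp: p_def q_def)
    moreover have sR: "\<Sum>R' = (\<Sum>i=0..<a. z (\<sigma> i)) + \<Sum>A"
      using sum.reindex_bij_betw[OF b1, of "\<lambda>x. x"] sum1 by simp
    moreover have sS: "\<Sum>S' = (\<Sum>i=a..<a + b. z (\<sigma> i)) + \<Sum>B"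
      using sum.reindex_bij_betw[OF b2, of "\<lambda>x. x"] sum2 by simp
    have tot: "(\<Sum>i=0..<a. z (\<sigma> i)) + (\<Sum>i=a..<a + b. z (\<sigma> i)) = (\<Sum>i=0..<a. z i) + (\<Sum>i=a..<a + b. z i)"
      using sum.permute[OF \<sigma>, of z] by (simp add: sum.atLeastLessThan_concat o_def)
    have "\<Sum>R' + \<Sum>S' = \<Sum>R + \<Sum>S"
      unfolding sR sS sumR sumS sum1 sum2 using tot by simp
    moreover have "\<Sum>S' < \<Sum>S"
    proof -
      \<comment> \<open>Positions that enter the second block carry rows below \<open>m\<close>; the
        positions they displace carry rows from \<open>m\<close> on.\<close>
      let ?J = "\<sigma> ` {a..<a + b}"
      have "?J \<noteq> {a..<a + b}"
      proof
        assume eq: "?J = {a..<a + b}"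
        have "\<sigma> ` {0..<a} \<subseteq> {0..<a}"
        proof
          fix y assume "y \<in> \<sigma> ` {0..<a}"
          then obtain i where i: "i < a" "y = \<sigma> i" by auto
          then have "y < a + b" using \<sigma>_lt by simp
          moreover have "y \<notin> ?J" using i inj_image_mem_iff[OF inj, of i "{a..<a + b}"] by simp
          ultimately show "y \<in> {0..<a}" using eq by auto
        qed
        then have "\<sigma> ` {0..<a} = {0..<a}"
          using inj by (intro card_subset_eq) (auto simp: card_image inj_on_def inj_def)
        then show False using nb by simp
      qed
      moreover have "card ?J = card {a..<a + b}"
        using inj by (intro card_image) (auto simp: inj_on_def inj_def)
      moreover have "z j < m" if "j \<in> ?J - {a..<a + b}" for j
        using that \<sigma>_lt z_low by auto
      ultimately have "sum z ?J < sum z {a..<a + b}"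
        using z_high by (intro sum_exchange_less[of _ _ z m]) auto
      moreover have "sum z ?J = (\<Sum>i=a..<a + b. z (\<sigma> i))"
        using inj by (subst sum.reindex) (auto simp: inj_on_def inj_def)
      ultimately show ?thesis unfolding sS sumS sum2 by simp
    qed
    ultimately have "(\<Sum>g\<in>G. c g * (set_minor R' g * set_minor S' g)) = 0"
      by (intro smaller)
    moreover obtain \<epsilon>1 \<epsilon>2 where "\<forall>g. row_minor p (r1 \<sigma>) g = \<epsilon>1 * set_minor R' g"
      "\<forall>g. row_minor q (r2 \<sigma>) g = \<epsilon>2 * set_minor S' g"
      using row_minor_eq_set_minor[OF b1] row_minor_eq_set_minor[OF b2] by blast
    then have "F \<sigma> = \<epsilon>1 * \<epsilon>2 * (\<Sum>g\<in>G. c g * (set_minor R' g * set_minor S' g))"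
      unfolding F_def sum_distrib_left by (intro sum.cong refl) (simp add: mult_ac)
    ultimately show ?thesis by simp
  qed
  let ?P = "{\<sigma>. \<sigma> permutes {0..<a + b}}"
  let ?B = "{\<sigma> \<in> ?P. \<sigma> ` {0..<a} = {0..<a}}"
  have finP: "finite ?P" by (rule finite_permutations) simp
  have "(\<Sum>\<sigma>\<in>?P. signof \<sigma> * F \<sigma>) =
      (\<Sum>g\<in>G. c g * (\<Sum>\<sigma>\<in>?P. signof \<sigma> * minor_pair p q a b \<alpha> \<beta> g (\<lambda>i. z (\<sigma> i))))"
    unfolding F_pair sum_distrib_left
    by (rule trans[OF sum.swap]) (simp add: mult_ac)
  also have "\<dots> = 0" using garnir_relation[OF ab] by simp
  finally have "0 = (\<Sum>\<sigma>\<in>?P. signof \<sigma> * F \<sigma>)" by simp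
  also have "\<dots> = (\<Sum>\<sigma>\<in>?B. signof \<sigma> * F \<sigma>)"
    using zero finP by (intro sum.mono_neutral_right) auto
  also have "\<dots> = (\<Sum>\<sigma>\<in>?B. F id)"
  proof (rule sum.cong[OF refl])
    fix \<sigma> assume "\<sigma> \<in> ?B"
    then show "signof \<sigma> * F \<sigma> = F id"
      unfolding F_pair sum_distrib_left
      using minor_pair_permute_blocks[OF ab(1,2), of \<sigma> \<alpha> \<beta> _ z]
      by (intro sum.cong refl) (simp add: mult.left_commute[of "signof \<sigma>"])
  qed
  \<comment> \<open>Only block-preserving permutations survive, all with the same term; their number
    is invertible in the complex numbers.\<close>
  also have "\<dots> = of_nat (card ?B) * F id" by simp
  finally have "of_nat (card ?B) * F id = 0" by simp
  moreover have "id \<in> ?B" by (auto simp: permutes_id)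
  moreover have "finite ?B" using finP by simp
  ultimately have "F id = 0"
    by (metis (no_types, lifting) card_eq_0_iff empty_iff mult_eq_0_iff of_nat_eq_0_iff)
  moreover obtain \<epsilon>1 \<epsilon>2 where \<epsilon>: "\<epsilon>1 \<in> {1, -1}" "\<epsilon>2 \<in> {1, -1::complex}"
      "\<forall>g. row_minor p (r1 id) g = \<epsilon>1 * set_minor R g" "\<forall>g. row_minor q (r2 id) g = \<epsilon>2 * set_minor S g"
    using row_minor_eq_set_minor[OF base1] row_minor_eq_set_minor[OF base2] by blast
  then have "F id = \<epsilon>1 * \<epsilon>2 * (\<Sum>g\<in>G. c g * (set_minor R g * set_minor S g))"
    unfolding F_def sum_distrib_left by (intro sum.cong refl) (simp add: mult_ac)
  ultimately show ?thesis using \<epsilon>(1,2) by auto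
qed

section \<open>Column tuples, semistandardness and straightening of longer products\<close>

definition col_tuples :: "nat \<Rightarrow> nat list \<Rightarrow> nat set list set" where
  "col_tuples n ks = {T. length T = length ks \<and> (\<forall>c<length ks. T ! c \<subseteq> {0..n} \<and> card (T ! c) = ks ! c)}"

definition tail_count :: "nat \<Rightarrow> nat set \<Rightarrow> nat" where
  "tail_count i R = card {r \<in> R. i \<le> r}"

text \<open>This is semistandardness for the reversed order on the entries: with columns sorted
  downwards, rows weakly decrease. Equivalently, for every \<open>i\<close> the entries
  \<open>\<ge> i\<close> fill a Young diagram, the form that suits Gelfand--Tsetlin
  patterns.\<close>

definition nested :: "nat set list \<Rightarrow> bool" where
  "nested T \<longleftrightarrow> (\<forall>c. Suc c < length T \<longrightarrow> (\<forall>i. tail_count i (T ! Suc c) \<le> tail_count i (T ! c)))"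

definition tuple_minor :: "nat set list \<Rightarrow> complex mat \<Rightarrow> complex" where
  "tuple_minor T g = (\<Prod>c<length T. set_minor (T ! c) g)"

theorem straightening:
  assumes dec: "\<And>d. Suc d < length ks \<Longrightarrow> ks ! Suc d \<le> ks ! d"
    and std: "\<And>T. T \<in> col_tuples n ks \<Longrightarrow> nested T \<Longrightarrow> (\<Sum>g\<in>G. c g * tuple_minor T g) = 0"
    and T: "T \<in> col_tuples n ks"
  shows "(\<Sum>g\<in>G. c g * tuple_minor T g) = 0"
  using T
\<comment> \<open>An exchange keeps the total of two neighbouring columns and makes the right one
  smaller, so the sum of all entries weighted by their column index drops.\<close>
proof (induction T rule: measure_induct_rule[of "\<lambda>T. \<Sum>d<length ks. d * \<Sum>(T ! d)"])
  case (less T)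
  show ?case
  proof (cases "nested T")
    case True
    then show ?thesis using std less.prems by blast
  next
    case False
    have len: "length T = length ks" using less.prems by (simp add: col_tuples_def)
    from False obtain e m where e: "Suc e < length ks"
      and viol: "tail_count m (T ! e) < tail_count m (T ! Suc e)"
      by (auto simp: nested_def len not_le)
    let ?R = "T ! e" and ?S = "T ! Suc e"
    have RS: "?R \<subseteq> {0..n}" "?S \<subseteq> {0..n}" "card ?R = ks ! e" "card ?S = ks ! Suc e"
      using less.prems e by (auto simp: col_tuples_def)
    define K where "K g = (\<Prod>d\<in>{..<length ks} - {e, Suc e}. set_minor (T ! d) g)" for g
    have split: "(\<Prod>d<length ks. f d) = (f e * f (Suc e)) * (\<Prod>d\<in>{..<length ks} - {e, Suc e}. f d)"
      for f :: "nat \<Rightarrow> complex"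
    proof -
      have "(\<Prod>d<length ks. f d) = (\<Prod>d\<in>{e, Suc e}. f d) * (\<Prod>d\<in>{..<length ks} - {e, Suc e}. f d)"
        using e by (subst mult.commute, intro prod.subset_diff) auto
      then show ?thesis by simp
    qed
    have splits: "(\<Sum>d<length ks. f d) = (f e + f (Suc e)) + (\<Sum>d\<in>{..<length ks} - {e, Suc e}. f d)"
      for f :: "nat \<Rightarrow> nat"
    proof -
      have "(\<Sum>d<length ks. f d) = (\<Sum>d\<in>{e, Suc e}. f d) + (\<Sum>d\<in>{..<length ks} - {e, Suc e}. f d)"
        using e by (subst add.commute, intro sum.subset_diff) auto
      then show ?thesis by simp
    qed
    \<comment> \<open>The minors of the other columns join the weight.\<close>
    have "(\<Sum>g\<in>G. (c g * K g) * (set_minor ?R g * set_minor ?S g)) = 0"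
    proof (rule straightening_pair[where m = m])
      show "finite ?R" "finite ?S" using RS finite_subset by blast+
      show "card ?S \<le> card ?R" using RS dec e by simp
      show "card {r \<in> ?R. m \<le> r} < card {s \<in> ?S. m \<le> s}" using viol by (simp add: tail_count_def)
      fix R' S'
      assume *: "R' \<subseteq> ?R \<union> ?S" "S' \<subseteq> ?R \<union> ?S" "card R' = card ?R" "card S' = card ?S"
        "\<Sum>R' + \<Sum>S' = \<Sum>?R + \<Sum>?S" "\<Sum>S' < \<Sum>?S"
      define T' where "T' = T[e := R', Suc e := S']"
      have T'_nth: "T' ! e = R'" "T' ! Suc e = S'" "\<And>d. d \<noteq> e \<Longrightarrow> d \<noteq> Suc e \<Longrightarrow> T' ! d = T ! d"
        using e len by (auto simp: T'_def nth_list_update)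
      have lenT': "length T' = length ks" by (simp add: T'_def len)
      have "T' \<in> col_tuples n ks"
        unfolding col_tuples_def
      proof (intro CollectI conjI allI impI lenT')
        fix d assume d: "d < length ks"
        consider "d = e" | "d = Suc e" | "d \<noteq> e" "d \<noteq> Suc e" by blast
        then have "T' ! d \<subseteq> {0..n} \<and> card (T' ! d) = ks ! d"
        proof cases
          case 1
          then show ?thesis unfolding 1 T'_nth using *(1,3) RS by (metis Un_least order_trans)
        next
          case 2
          then show ?thesis unfolding 2 T'_nth using *(2,4) RS by (metis Un_least order_trans)
        next
          case 3
          then show ?thesis using less.prems d T'_nth(3)[OF 3] by (simp add: col_tuples_def)
        qed
        then show "T' ! d \<subseteq> {0..n}" "card (T' ! d) = ks ! d" by auto
      qed
      moreover have "(\<Sum>d<length ks. d * \<Sum>(T' ! d)) < (\<Sum>d<length ks. d * \<Sum>(T ! d))"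
      proof -
        have "(\<Sum>d\<in>{..<length ks} - {e, Suc e}. d * \<Sum>(T' ! d)) = (\<Sum>d\<in>{..<length ks} - {e, Suc e}. d * \<Sum>(T ! d))"
          using T'_nth by (intro sum.cong) auto
        moreover have "e * \<Sum>R' + Suc e * \<Sum>S' < e * \<Sum>?R + Suc e * \<Sum>?S"
        proof -
          have "e * \<Sum>R' + Suc e * \<Sum>S' = e * (\<Sum>R' + \<Sum>S') + \<Sum>S'" by (simp add: algebra_simps)
          also have "\<dots> < e * (\<Sum>?R + \<Sum>?S) + \<Sum>?S" using *(5,6) by simp
          finally show ?thesis by (simp add: algebra_simps)
        qed
        ultimately show ?thesis unfolding splits T'_nth by simp
      qed
      ultimately have "(\<Sum>g\<in>G. c g * tuple_minor T' g) = 0" using less.IH by blast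
      moreover have "tuple_minor T' g = set_minor R' g * set_minor S' g * K g" for g
      proof -
        have "(\<Prod>d\<in>{..<length ks} - {e, Suc e}. set_minor (T' ! d) g) = K g"
          unfolding K_def using T'_nth by (intro prod.cong) auto
        then show ?thesis unfolding tuple_minor_def lenT' split T'_nth by simp
      qed
      ultimately show "(\<Sum>g\<in>G. (c g * K g) * (set_minor R' g * set_minor S' g)) = 0"
        by (simp add: mult_ac)
    qed
    moreover have "tuple_minor T g = set_minor ?R g * set_minor ?S g * K g" for g
      unfolding tuple_minor_def len split K_def by simp
    ultimately show ?thesis by (simp add: mult_ac)
  qed
qed

section \<open>Minors along the word\<close>

definition lower_elem :: "nat \<Rightarrow> nat \<Rightarrow> complex \<Rightarrow> complex mat" where
  "lower_elem n i t = 1\<^sub>m (n + 1) + t \<cdot>\<^sub>m f_mat n i"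

definition upper_elem :: "nat \<Rightarrow> nat \<Rightarrow> complex \<Rightarrow> complex mat" where
  "upper_elem n i t = 1\<^sub>m (n + 1) + t \<cdot>\<^sub>m e_mat n i"

lemma f_mat_carrier: "f_mat n i \<in> carrier_mat (n + 1) (n + 1)"
  and e_mat_carrier: "e_mat n i \<in> carrier_mat (n + 1) (n + 1)"
  by (auto simp: f_mat_def e_mat_def matrix_unit_def)

lemmas [simp] = f_mat_carrier[simplified] e_mat_carrier[simplified]

lemma f_mat_dim [simp]: "dim_row (f_mat n i) = Suc n" "dim_col (f_mat n i) = Suc n"
  and e_mat_dim [simp]: "dim_row (e_mat n i) = Suc n" "dim_col (e_mat n i) = Suc n"
  by (auto simp: f_mat_def e_mat_def matrix_unit_def)

lemma lower_elem_carrier: "lower_elem n i t \<in> carrier_mat (n + 1) (n + 1)"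
  and upper_elem_carrier: "upper_elem n i t \<in> carrier_mat (n + 1) (n + 1)"
  unfolding lower_elem_def upper_elem_def
  by (rule add_carrier_mat, rule smult_carrier_mat, rule f_mat_carrier e_mat_carrier)+

lemmas [simp] = lower_elem_carrier[simplified] upper_elem_carrier[simplified]

lemma lower_elem_dim [simp]: "dim_row (lower_elem n i t) = Suc n" "dim_col (lower_elem n i t) = Suc n"
  and upper_elem_dim [simp]: "dim_row (upper_elem n i t) = Suc n" "dim_col (upper_elem n i t) = Suc n"
  using carrier_matD[OF lower_elem_carrier[of n i t]] carrier_matD[OF upper_elem_carrier[of n i t]]
  by simp_all

lemma mat_exp_square_zero:
  assumes A: "A \<in> carrier_mat m m" and sq: "A * A = 0\<^sub>m m m"
  shows "mat_exp A = 1\<^sub>m m + A"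
proof (rule eq_matI)
  have pow: "A ^\<^sub>m (k + 2) = 0\<^sub>m m m" for k
  proof (induction k)
    case 0
    then show ?case using sq A by (simp add: numeral_2_eq_2)
  next
    case (Suc k)
    then show ?case using A by simp
  qed
  fix r c assume "r < dim_row (1\<^sub>m m + A)" "c < dim_col (1\<^sub>m m + A)"
  then have rc: "r < m" "c < m" using A by auto
  have "(\<Sum>k. (A ^\<^sub>m k) $$ (r, c) / fact k) = (\<Sum>k\<in>{0, 1}. (A ^\<^sub>m k) $$ (r, c) / fact k)"
  proof (rule suminf_finite)
    fix k :: nat assume "k \<notin> {0, 1}"
    then have "A ^\<^sub>m k = 0\<^sub>m m m" using pow[of "k - 2"] by (cases k; cases "k - 1") auto
    then show "(A ^\<^sub>m k) $$ (r, c) / fact k = 0" using rc by simp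
  qed simp
  then show "mat_exp A $$ (r, c) = (1\<^sub>m m + A) $$ (r, c)"
    using A rc by (simp add: mat_exp_def)
qed (use A in \<open>auto simp: mat_exp_def\<close>)

lemma f_mat_square: "(t \<cdot>\<^sub>m f_mat n i) * (t \<cdot>\<^sub>m f_mat n i) = 0\<^sub>m (n + 1) (n + 1)"
  by (rule eq_matI) (auto simp: f_mat_def matrix_unit_def scalar_prod_def intro!: sum.neutral)

lemma e_mat_square: "(t \<cdot>\<^sub>m e_mat n i) * (t \<cdot>\<^sub>m e_mat n i) = 0\<^sub>m (n + 1) (n + 1)"
  by (rule eq_matI) (auto simp: e_mat_def matrix_unit_def scalar_prod_def intro!: sum.neutral)

lemma mat_exp_f: "mat_exp (t \<cdot>\<^sub>m f_mat n i) = lower_elem n i t"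
  unfolding lower_elem_def
  by (rule mat_exp_square_zero[OF smult_carrier_mat[OF f_mat_carrier] f_mat_square])

lemma mat_exp_e: "mat_exp (t \<cdot>\<^sub>m e_mat n i) = upper_elem n i t"
  unfolding upper_elem_def
  by (rule mat_exp_square_zero[OF smult_carrier_mat[OF e_mat_carrier] e_mat_square])

lemma s_lift_eq: "s_lift n i = lower_elem n i 1 * upper_elem n i (-1) * lower_elem n i 1"
proof -
  have "1 \<cdot>\<^sub>m f_mat n i = f_mat n i" "(-1) \<cdot>\<^sub>m e_mat n i = - e_mat n i"
    by (auto intro!: eq_matI)
  then show ?thesis unfolding s_lift_def using mat_exp_f[of 1 n i] mat_exp_e[of "-1" n i] by simp
qed

lemma s_lift_carrier: "s_lift n i \<in> carrier_mat (n + 1) (n + 1)"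
  unfolding s_lift_eq by (meson lower_elem_carrier upper_elem_carrier mult_carrier_mat)

lemmas [simp] = s_lift_carrier[simplified]

text \<open>With rows numbered from 0, the only entry of \<open>f_mat n i\<close> sits at
  \<open>(i, i - 1)\<close>; the letter \<open>i\<close> therefore involves the rows
  \<open>i - 1\<close> and \<open>i\<close>.\<close>

lemma lower_elem_mult_index:
  assumes g: "g \<in> carrier_mat (n + 1) m" and "1 \<le> i" "i \<le> n" "r \<le> n" "j < m"
  shows "(lower_elem n i t * g) $$ (r, j) = g $$ (r, j) + (if r = i then t * g $$ (i - 1, j) else 0)"
proof -
  have "(lower_elem n i t * g) $$ (r, j) = (\<Sum>k=0..<n + 1. lower_elem n i t $$ (r, k) * g $$ (k, j))"
    using assms
    by (subst index_mult_mat) (auto simp: scalar_prod_def simp del: sum.op_ivl_Suc)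
  also have "\<dots> = (\<Sum>k=0..<n + 1. (if k = r then g $$ (k, j) else 0) +
      (if k = i - 1 then if r = i then t * g $$ (k, j) else 0 else 0))"
    using assms by (intro sum.cong refl) (auto simp: lower_elem_def f_mat_def matrix_unit_def)
  also have "\<dots> = g $$ (r, j) + (if r = i then t * g $$ (i - 1, j) else 0)"
    using assms unfolding sum.distrib by (auto simp: sum.delta)
  finally show ?thesis .
qed

lemma upper_elem_mult_index:
  assumes g: "g \<in> carrier_mat (n + 1) m" and "1 \<le> i" "i \<le> n" "r \<le> n" "j < m"
  shows "(upper_elem n i t * g) $$ (r, j) = g $$ (r, j) + (if r = i - 1 then t * g $$ (i, j) else 0)"
proof -
  have "(upper_elem n i t * g) $$ (r, j) = (\<Sum>k=0..<n + 1. upper_elem n i t $$ (r, k) * g $$ (k, j))"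
    using assms
    by (subst index_mult_mat) (auto simp: scalar_prod_def simp del: sum.op_ivl_Suc)
  also have "\<dots> = (\<Sum>k=0..<n + 1. (if k = r then g $$ (k, j) else 0) +
      (if k = i then if r = i - 1 then t * g $$ (k, j) else 0 else 0))"
    using assms by (intro sum.cong refl) (auto simp: upper_elem_def e_mat_def matrix_unit_def)
  also have "\<dots> = g $$ (r, j) + (if r = i - 1 then t * g $$ (i, j) else 0)"
    using assms unfolding sum.distrib by (auto simp: sum.delta)
  finally show ?thesis .
qed

text \<open>Three row operations compose to an exchange of the rows \<open>i - 1\<close> and
  \<open>i\<close>, with the sign on the new row \<open>i - 1\<close>.\<close>

lemma s_lift_mult_index:
  assumes g: "g \<in> carrier_mat (n + 1) m" and "1 \<le> i" "i \<le> n" "r \<le> n" "j < m"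
  shows "(s_lift n i * g) $$ (r, j) =
    (if r = i then 1 else if r = i - 1 then -1 else 1) * g $$ (Transposition.transpose (i - 1) i r, j)"
proof -
  have assoc: "s_lift n i * g = lower_elem n i 1 * (upper_elem n i (-1) * (lower_elem n i 1 * g))"
    unfolding s_lift_eq
    using assoc_mult_mat[OF mult_carrier_mat[OF lower_elem_carrier upper_elem_carrier] lower_elem_carrier g]
      assoc_mult_mat[OF lower_elem_carrier upper_elem_carrier mult_carrier_mat[OF lower_elem_carrier g]]
    by simp
  have c1: "lower_elem n i 1 * g \<in> carrier_mat (n + 1) m"
    using g by (rule mult_carrier_mat[OF lower_elem_carrier])
  have c2: "upper_elem n i (-1) * (lower_elem n i 1 * g) \<in> carrier_mat (n + 1) m"
    using c1 by (rule mult_carrier_mat[OF upper_elem_carrier])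
  show ?thesis
    unfolding assoc
    using lower_elem_mult_index[OF c2 assms(2-5), of 1]
      upper_elem_mult_index[OF c1 assms(2,3) _ assms(5), of r "-1"]
      upper_elem_mult_index[OF c1 assms(2,3) _ assms(5), of "i - 1" "-1"]
      lower_elem_mult_index[OF g assms(2,3) _ assms(5), of r 1]
      lower_elem_mult_index[OF g assms(2,3) _ assms(5), of "i - 1" 1]
      lower_elem_mult_index[OF g assms(2,3) _ assms(5), of i 1] assms(2-4)
    by (auto simp: Transposition.transpose_def simp del: index_mult_mat)
qed

lemma inj_on_transpose: "inj_on (Transposition.transpose a b) R"
  by (rule inj_onI) (metis transpose_involutory)

definition swap_set :: "nat \<Rightarrow> nat set \<Rightarrow> nat set" where
  "swap_set i R = Transposition.transpose (i - 1) i ` R"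

lemma swap_set_swap_set [simp]: "swap_set i (swap_set i R) = R"
  by (simp add: swap_set_def image_comp)

lemma swap_set_subset:
  assumes "R \<subseteq> {0..n}" "1 \<le> i" "i \<le> n"
  shows "swap_set i R \<subseteq> {0..n}"
  using assms by (auto simp: swap_set_def Transposition.transpose_def)

lemma card_swap_set [simp]: "card (swap_set i R) = card R"
  unfolding swap_set_def by (rule card_image[OF inj_on_transpose])

lemma mem_swap_set: "x \<in> swap_set i R \<longleftrightarrow> Transposition.transpose (i - 1) i x \<in> R"
proof
  assume "Transposition.transpose (i - 1) i x \<in> R"
  then show "x \<in> swap_set i R"
    unfolding swap_set_def by (rule image_eqI[rotated]) simp
qed (auto simp: swap_set_def)

lemma bij_betw_swap_set:
  assumes "bij_betw r A R"
  shows "bij_betw (\<lambda>j. Transposition.transpose (i - 1) i (r j)) A (swap_set i R)"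
proof -
  have "bij_betw (Transposition.transpose (i - 1) i) R (swap_set i R)"
    unfolding swap_set_def by (rule bij_betw_imageI[OF inj_on_transpose refl])
  from bij_betw_trans[OF assms this] show ?thesis by (simp add: o_def)
qed

lemma set_minor_s_lift:
  assumes R: "R \<subseteq> {0..n}" and i: "1 \<le> i" "i \<le> n"
  shows "\<exists>\<epsilon>\<in>{1, -1}. \<forall>g\<in>carrier_mat (n + 1) (n + 1).
    set_minor R (s_lift n i * g) = \<epsilon> * set_minor (swap_set i R) g"
proof -
  have fin: "finite R" using R finite_subset by blast
  define k where "k = card R"
  have k: "k \<le> n + 1" using card_mono[OF _ R] by (simp add: k_def)
  define r where "r = (\<lambda>j. sorted_list_of_set R ! j)"
  have r: "bij_betw r {0..<k} R" using bij_betw_sorted_list_nth[OF fin] by (simp add: r_def k_def)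
  define sg where "sg x = (if x = i then 1 else if x = i - 1 then -1 else 1 :: complex)" for x
  define d where "d = (\<Prod>j=0..<k. sg (r j))"
  have b: "bij_betw (\<lambda>j. Transposition.transpose (i - 1) i (r j)) {0..<k} (swap_set i R)"
    by (rule bij_betw_swap_set[OF r])
  obtain e where e: "e \<in> {1, -1}" "\<forall>g. row_minor k (\<lambda>j. Transposition.transpose (i - 1) i (r j)) g
      = e * set_minor (swap_set i R) g"
    using row_minor_eq_set_minor[OF b] by blast
  have "d \<in> {1, -1}"
    unfolding d_def by (induction k) (auto simp: sg_def)
  moreover have "set_minor R (s_lift n i * g) = d * e * set_minor (swap_set i R) g"
    if g: "g \<in> carrier_mat (n + 1) (n + 1)" for g
  proof -
    have "set_minor R (s_lift n i * g) = row_minor k r (s_lift n i * g)"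
      by (simp add: set_minor_def r_def k_def)
    also have "\<dots> = d * row_minor k (\<lambda>j. Transposition.transpose (i - 1) i (r j)) g"
      unfolding d_def
    proof (rule row_minor_row_scale)
      fix x j assume "x < k" "j < k"
      moreover from this have "r x \<le> n" using bij_betwE[OF r] R by fastforce
      ultimately show "(s_lift n i * g) $$ (r x, j) =
          sg (r x) * g $$ (Transposition.transpose (i - 1) i (r x), j)"
        using k i s_lift_mult_index[OF g, of i "r x" j] unfolding sg_def by simp
    qed
    finally show ?thesis using e(2) by simp
  qed
  ultimately show ?thesis using e(1) by (intro bexI[of _ "d * e"]) auto
qed

text \<open>Row \<open>i\<close> gains \<open>t\<close> times row \<open>i - 1\<close>. If
  \<open>i - 1\<close> also lies in \<open>R\<close>, the extra minor repeats a row; otherwise its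
  row set is \<open>swap_set i R\<close>, up to a sign independent of \<open>t\<close> and
  \<open>g\<close>.\<close>

lemma set_minor_lower_elem:
  assumes R: "R \<subseteq> {0..n}" and i: "1 \<le> i" "i \<le> n"
  shows "\<exists>\<epsilon>\<in>{1, -1}. \<forall>t. \<forall>g\<in>carrier_mat (n + 1) (n + 1).
    set_minor R (lower_elem n i t * g) =
      set_minor R g + (if i \<in> R \<and> i - 1 \<notin> R then t * \<epsilon> * set_minor (swap_set i R) g else 0)"
proof -
  have fin: "finite R" using R finite_subset by blast
  define k where "k = card R"
  have k: "k \<le> n + 1" using card_mono[OF _ R] by (simp add: k_def)
  define r where "r = (\<lambda>j. sorted_list_of_set R ! j)"
  have r: "bij_betw r {0..<k} R" using bij_betw_sorted_list_nth[OF fin] by (simp add: r_def k_def)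
  have rn: "r x \<le> n" if "x < k" for x using bij_betwE[OF r] R that by fastforce
  have minor: "set_minor R g = row_minor k r g" for g by (simp add: set_minor_def r_def k_def)
  show ?thesis
  proof (cases "i \<in> R")
    case False
    have "set_minor R (lower_elem n i t * g) = set_minor R g" if g: "g \<in> carrier_mat (n + 1) (n + 1)" for t g
      unfolding minor
    proof (rule row_minor_cong)
      fix x j assume "x < k" "j < k"
      moreover from this have "r x \<noteq> i" using bij_betwE[OF r] False by fastforce
      ultimately show "(lower_elem n i t * g) $$ (r x, j) = g $$ (r x, j)"
        using k lower_elem_mult_index[OF g i rn] by simp
    qed
    then show ?thesis using False by auto
  next
    case True
    then obtain x0 where x0: "x0 < k" "r x0 = i"
      using bij_betw_imp_surj_on[OF r] by (metis (no_types, lifting) atLeastLessThan_iff imageE)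
    have lin: "set_minor R (lower_elem n i t * g) = set_minor R g + t * row_minor k (r(x0 := i - 1)) g"
      if g: "g \<in> carrier_mat (n + 1) (n + 1)" for t g
      unfolding minor
    proof (rule row_minor_row_linear[OF x0(1)])
      fix x j assume x: "x < k" "x \<noteq> x0" "j < k"
      then have "r x \<noteq> i" using x0 bij_betw_imp_inj_on[OF r] by (auto simp: inj_on_def)
      then show "(lower_elem n i t * g) $$ (r x, j) = g $$ (r x, j)"
        using x k lower_elem_mult_index[OF g i rn] by simp
    next
      fix j assume "j < k"
      then show "(lower_elem n i t * g) $$ (r x0, j) = g $$ (r x0, j) + t * g $$ (i - 1, j)"
        using k lower_elem_mult_index[OF g i rn[OF x0(1)]] x0 by simp
    qed
    show ?thesis
    proof (cases "i - 1 \<in> R")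
      case True
      then obtain x1 where x1: "x1 < k" "r x1 = i - 1"
        using bij_betw_imp_surj_on[OF r] by (metis (no_types, lifting) atLeastLessThan_iff imageE)
      then have "x1 \<noteq> x0" using x0 i by auto
      then have "row_minor k (r(x0 := i - 1)) g = 0" for g
        using row_minor_repeated[of x0 k x1 "r(x0 := i - 1)"] x0 x1 by simp
      then show ?thesis using lin True by auto
    next
      case False
      have ne: "r x \<noteq> i" if "x < k" "x \<noteq> x0" for x
        using that x0 bij_betw_imp_inj_on[OF r] by (auto simp: inj_on_def)
      have ne': "r x \<noteq> i - 1" if "x < k" for x
      proof -
        have "r x \<in> R" using that bij_betwE[OF r] by simp
        then show ?thesis using False by auto
      qed
      have "bij_betw (\<lambda>j. Transposition.transpose (i - 1) i (r j)) {0..<k} (swap_set i R)"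
        by (rule bij_betw_swap_set[OF r])
      then have b: "bij_betw (r(x0 := i - 1)) {0..<k} (swap_set i R)"
        by (rule bij_betw_cong[THEN iffD1, rotated])
          (use ne ne' x0 in \<open>auto simp: Transposition.transpose_def\<close>)
      show ?thesis
        using row_minor_eq_set_minor[OF b] lin True False by auto
    qed
  qed
qed

lemma u_lift_carrier: "u_lift n C q i \<in> carrier_mat (n + 1) (n + 1)"
  by (simp add: u_lift_def)

text \<open>One letter of the word, seen by a minor: \<open>a\<close> is the exponent of the parameter \<open>s\<close> along which
  the minor on \<open>S'\<close> survives; for \<open>a = 1\<close> the other term has the smaller exponent.\<close>

lemma set_minor_letter:
  fixes a :: nat
  assumes S': "S' \<subseteq> {0..n}" and i: "1 \<le> i" "i \<le> n"
    and S: "S = (if (q \<in> C) \<noteq> (a = 1) then swap_set i S' else S')"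
    and a: "a = 0 \<or> (a = 1 \<and> i - 1 \<in> S' \<and> i \<notin> S')"
  shows "\<exists>\<epsilon>\<in>{1, -1}. \<exists>\<eta>. \<forall>s. \<forall>g\<in>carrier_mat (n + 1) (n + 1).
    set_minor S (u_lift n C q i * (lower_elem n i s * g)) =
      (if a = 0 then \<epsilon> * set_minor S' g + s * \<eta> * set_minor (swap_set i S') g
       else s * \<epsilon> * set_minor S' g + \<eta> * set_minor (swap_set i S') g)"
proof -
  let ?W = "swap_set i S'"
  have W: "?W \<subseteq> {0..n}" using swap_set_subset[OF S' i] .
  have c: "lower_elem n i s * g \<in> carrier_mat (n + 1) (n + 1)" if "g \<in> carrier_mat (n + 1) (n + 1)" for s g
    using that by (rule mult_carrier_mat[OF lower_elem_carrier])
  obtain e1 where e1: "e1 \<in> {1, -1}" "\<And>t g. g \<in> carrier_mat (n + 1) (n + 1) \<Longrightarrow>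
      set_minor S' (lower_elem n i t * g) =
      set_minor S' g + (if i \<in> S' \<and> i - 1 \<notin> S' then t * e1 * set_minor ?W g else 0)"
    using set_minor_lower_elem[OF S' i] by blast
  obtain e2 where e2: "e2 \<in> {1, -1}" "\<And>t g. g \<in> carrier_mat (n + 1) (n + 1) \<Longrightarrow>
      set_minor ?W (lower_elem n i t * g) =
      set_minor ?W g + (if i \<in> ?W \<and> i - 1 \<notin> ?W then t * e2 * set_minor S' g else 0)"
    using set_minor_lower_elem[OF W i, unfolded swap_set_swap_set] by blast
  obtain d1 where d1: "d1 \<in> {1, -1}" "\<And>g. g \<in> carrier_mat (n + 1) (n + 1) \<Longrightarrow>
      set_minor S' (s_lift n i * g) = d1 * set_minor ?W g"
    using set_minor_s_lift[OF S' i] by blast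
  obtain d2 where d2: "d2 \<in> {1, -1}" "\<And>g. g \<in> carrier_mat (n + 1) (n + 1) \<Longrightarrow>
      set_minor ?W (s_lift n i * g) = d2 * set_minor S' g"
    using set_minor_s_lift[OF W i, unfolded swap_set_swap_set] by blast
  define \<eta>1 where "\<eta>1 = (if i \<in> S' \<and> i - 1 \<notin> S' then e1 else 0)"
  have e1': "set_minor S' (lower_elem n i t * g) = set_minor S' g + t * \<eta>1 * set_minor ?W g"
    if "g \<in> carrier_mat (n + 1) (n + 1)" for t g
    using e1(2)[OF that] by (simp add: \<eta>1_def)
  show ?thesis
  proof (cases "q \<in> C")
    case True
    then have u: "u_lift n C q i = s_lift n i" by (simp add: u_lift_def)
    show ?thesis
    proof (cases "a = 0")
      case True
      then have "S = ?W" using S \<open>q \<in> C\<close> by simp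
      then show ?thesis
        using d2 e1' c True u by (intro bexI[OF _ d2(1)] exI[of _ "d2 * \<eta>1"]) (auto simp: algebra_simps)
    next
      case False
      then have a1: "a = 1" "i - 1 \<in> S'" "i \<notin> S'" using a by auto
      then have "i \<in> ?W" "i - 1 \<notin> ?W" by (auto simp: mem_swap_set)
      moreover have "S = S'" using S \<open>q \<in> C\<close> a1 by simp
      ultimately show ?thesis
        using d1 e2 c a1 u
        by (intro bexI[of _ "d1 * e2"] exI[of _ d1]) (auto simp: algebra_simps)
    qed
  next
    case False
    then have u: "u_lift n C q i = 1\<^sub>m (n + 1)" by (simp add: u_lift_def)
    have u1: "1\<^sub>m (n + 1) * (lower_elem n i s * g) = lower_elem n i s * g"
      if "g \<in> carrier_mat (n + 1) (n + 1)" for s g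
      using c[OF that] by (rule left_mult_one_mat)
    show ?thesis
    proof (cases "a = 0")
      case True
      then have "S = S'" using S \<open>q \<notin> C\<close> by simp
      then show ?thesis
        using e1' True u u1 by (intro bexI[of _ 1] exI[of _ \<eta>1]) auto
    next
      case False
      then have a1: "a = 1" "i - 1 \<in> S'" "i \<notin> S'" using a by auto
      then have "i \<in> ?W" "i - 1 \<notin> ?W" by (auto simp: mem_swap_set)
      moreover have "S = ?W" using S \<open>q \<notin> C\<close> a1 by simp
      ultimately show ?thesis
        using e2 a1 u u1
        by (intro bexI[OF _ e2(1)] exI[of _ 1]) (auto simp: algebra_simps)
    qed
  qed
qed

text \<open>The part of the word \<open>i\<^sub>1, \<dots>, i\<^sub>N\<close> that starts at \<open>q\<^sub>j\<^sup>(\<^sup>i\<^sup>)\<close> with \<open>i + j + l = n + 2\<close>;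
  the number \<open>l\<close> counts the antidiagonals from the one acting first.\<close>

fun word_suffix :: "nat \<Rightarrow> nat \<Rightarrow> nat \<Rightarrow> (gt \<times> nat) list" where
  "word_suffix n 0 i = []"
| "word_suffix n (Suc l) 0 = word_suffix n l (n + 1 - l)"
| "word_suffix n (Suc l) (Suc i) = (Q (Suc i) (n - l - i), Suc i) # word_suffix n (Suc l) i"

definition word_block :: "nat \<Rightarrow> (gt \<times> nat) list" where
  "word_block m = map (\<lambda>i. (Q i (m + 1 - i), i)) (rev [1..<m + 1])"

lemma word_suffix_block:
  "i \<le> n - l \<Longrightarrow> word_suffix n (Suc l) i =
    map (\<lambda>i. (Q i (n + 1 - l - i), i)) (rev [1..<i + 1]) @ word_suffix n l (n + 1 - l)"
  by (induction i) auto

lemma word_suffix_blocks: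
  "l \<le> n \<Longrightarrow> word_suffix n l (n + 1 - l) = concat (map word_block [n + 1 - l..<n + 1])"
proof (induction l)
  case (Suc l)
  have "[n - l..<n + 1] = (n - l) # [n + 1 - l..<n + 1]"
    using Suc.prems by (subst upt_conv_Cons) (auto simp: Suc_diff_le)
  moreover have eq: "n + 1 - l = n - l + 1" using Suc.prems by simp
  then have "word_suffix n (Suc l) (n - l) = word_block (n - l) @ word_suffix n l (n + 1 - l)"
    using word_suffix_block[of "n - l" n l] by (simp only: word_block_def order_refl simp_thms)
  ultimately show ?case
    using Suc by (simp del: upt_Suc)
qed simp

lemma zip_concat:
  "(\<And>x. x \<in> set xs \<Longrightarrow> length (f x) = length (g x)) \<Longrightarrow>
    zip (concat (map f xs)) (concat (map g xs)) = concat (map (\<lambda>x. zip (f x) (g x)) xs)"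
  by (induction xs) auto

lemma zip_gt_list_i_list: "zip (gt_list n) (i_list n) = word_suffix n n 1"
proof -
  have "zip (map (\<lambda>j. Q (m + 1 - j) j) [1..<m + 1]) (rev [1..<m + 1]) = word_block m" for m
    by (rule nth_equalityI) (auto simp: word_block_def rev_nth nth_append simp del: upt_Suc)
  then have "zip (gt_list n) (i_list n) = concat (map word_block [1..<n + 1])"
    unfolding gt_list_def i_list_def by (subst zip_concat) (auto simp del: upt_Suc)
  then show ?thesis using word_suffix_blocks[of n n] by simp
qed

definition word_mat :: "nat \<Rightarrow> gt set \<Rightarrow> (gt \<Rightarrow> complex) \<Rightarrow> (gt \<times> nat) list \<Rightarrow> complex mat" where
  "word_mat n C t ws =
    foldr (\<lambda>(q, i) g. u_lift n C q i * (lower_elem n i (t q) * g)) ws (1\<^sub>m (n + 1))"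

lemma word_mat_Nil [simp]: "word_mat n C t [] = 1\<^sub>m (n + 1)"
  and word_mat_Cons [simp]: "word_mat n C t ((q, i) # ws) =
    u_lift n C q i * (lower_elem n i (t q) * word_mat n C t ws)"
  by (simp_all add: word_mat_def)

lemma word_mat_carrier: "word_mat n C t ws \<in> carrier_mat (n + 1) (n + 1)"
proof (induction ws)
  case (Cons w ws)
  then show ?case
    by (cases w) (simp only: word_mat_Cons mult_carrier_mat[OF u_lift_carrier mult_carrier_mat[OF lower_elem_carrier]])
qed simp

text \<open>The exponent contributed by the column with entry set \<open>R\<close> at \<open>q\<^sub>j\<^sup>(\<^sup>i\<^sup>)\<close>, where
  \<open>i + j + l = n + 2\<close>: the image under the transfer map of the 0/1 pattern whose value at
  \<open>(i, l)\<close> is 1 iff \<open>l \<le> tail_count i R\<close>, translated.\<close>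

definition col_expo :: "nat \<Rightarrow> gt set \<Rightarrow> nat set \<Rightarrow> nat \<Rightarrow> nat \<Rightarrow> nat" where
  "col_expo n C R i l =
    (if Q i (n + 2 - i - l) \<in> C
     then if l \<le> tail_count i R \<and> tail_count (i + 1) R < l \<and> tail_count (i - 1) R < l + 1 then 1 else 0
     else if l \<le> tail_count i R \<and> card R < i + l then 1 else 0)"

text \<open>The path starts at the right end of the word, where the minors of the identity vanish
  except on initial segments. A reflection lift exchanges two rows, and so does taking the linear
  term of the exponential; doing both cancels. Hence the comparison of two truth values.\<close>

fun path :: "nat \<Rightarrow> gt set \<Rightarrow> nat set \<Rightarrow> nat \<Rightarrow> nat \<Rightarrow> nat set" where
  "path n C R 0 i = {0..<card R}"
| "path n C R (Suc l) 0 = path n C R l (n + 1 - l)"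
| "path n C R (Suc l) (Suc i) =
    (if (Q (Suc i) (n - l - i) \<in> C) \<noteq> (col_expo n C R (Suc i) (Suc l) = 1)
     then swap_set (Suc i) (path n C R (Suc l) i) else path n C R (Suc l) i)"

text \<open>How many letters \<open>i'\<close> occur in \<open>word_suffix n l i\<close>.\<close>

definition crossings :: "nat \<Rightarrow> nat \<Rightarrow> nat \<Rightarrow> nat \<Rightarrow> nat" where
  "crossings n l i i' = (if i' \<le> i then l else min (l - 1) (n + 1 - i'))"

lemma crossings_next_block:
  assumes "Suc l \<le> n" "1 \<le> i'" "i' \<le> n"
  shows "crossings n (Suc l) 0 i' = crossings n l (n + 1 - l) i'"
  using assms by (auto simp: crossings_def)

section \<open>Head counts and the extremal path of a column\<close>

definition head_count :: "nat \<Rightarrow> nat set \<Rightarrow> nat" where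
  "head_count i S = card {s \<in> S. s < i}"

lemma head_count_0 [simp]: "head_count 0 S = 0"
  by (simp add: head_count_def)

lemma head_count_Suc:
  "finite S \<Longrightarrow> head_count (Suc i) S = head_count i S + (if i \<in> S then 1 else 0)"
proof -
  assume fin: "finite S"
  have "{s \<in> S. s < Suc i} = {s \<in> S. s < i} \<union> (if i \<in> S then {i} else {})"
    by (auto simp: less_Suc_eq)
  then show ?thesis using fin by (auto simp: head_count_def card_insert_if)
qed

lemma head_count_le: "head_count i S \<le> i"
  unfolding head_count_def using card_mono[of "{..<i}" "{s \<in> S. s < i}"] by auto

lemma head_count_all: "S \<subseteq> {0..n} \<Longrightarrow> head_count (Suc n) S = card S"
  unfolding head_count_def by (rule arg_cong[where f = card]) auto

lemma tail_count_Suc: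
  "finite R \<Longrightarrow> tail_count i R = tail_count (Suc i) R + (if i \<in> R then 1 else 0)"
proof -
  assume fin: "finite R"
  have "{r \<in> R. i \<le> r} = {r \<in> R. Suc i \<le> r} \<union> (if i \<in> R then {i} else {})"
    by (auto simp: le_eq_less_or_eq Suc_le_eq)
  then show ?thesis using fin by (auto simp: tail_count_def card_insert_if)
qed

lemma tail_count_0 [simp]: "tail_count 0 R = card R"
  by (simp add: tail_count_def)

lemma tail_count_antimono: "finite R \<Longrightarrow> i \<le> j \<Longrightarrow> tail_count j R \<le> tail_count i R"
  unfolding tail_count_def by (rule card_mono) auto

lemma tail_count_above: "R \<subseteq> {0..n} \<Longrightarrow> n < i \<Longrightarrow> tail_count i R = 0"
  unfolding tail_count_def by (auto simp: card_eq_0_iff)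

lemma tail_count_le: "R \<subseteq> {0..n} \<Longrightarrow> tail_count i R \<le> n + 1 - i"
proof -
  assume "R \<subseteq> {0..n}"
  then have "{r \<in> R. i \<le> r} \<subseteq> {i..n}" by auto
  then have "card {r \<in> R. i \<le> r} \<le> card {i..n}" by (rule card_mono[rotated]) simp
  then show ?thesis by (simp add: tail_count_def)
qed

lemma card_le_tail_count_plus: "finite R \<Longrightarrow> card R \<le> tail_count i R + i"
proof (induction i)
  case (Suc i)
  then show ?case using tail_count_Suc[of R i] by (auto split: if_splits)
qed simp

text \<open>Only the threshold \<open>i\<close> separates \<open>i - 1\<close> from
  \<open>i\<close>, so no other head count can change.\<close>

lemma head_count_swap_set:
  assumes fin: "finite S" and i: "1 \<le> i"
  shows "head_count x (swap_set i S) = (if x \<noteq> i then head_count x S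
    else head_count x S + (if i \<in> S \<and> i - 1 \<notin> S then 1 else 0)
      - (if i - 1 \<in> S \<and> i \<notin> S then 1 else 0))"
proof (cases "x = i")
  case False
  have "Transposition.transpose (i - 1) i s < x \<longleftrightarrow> s < x" for s
    using False i by (auto simp: Transposition.transpose_def)
  then have "{s \<in> swap_set i S. s < x} = swap_set i {s \<in> S. s < x}"
    unfolding swap_set_def by blast
  then have "head_count x (swap_set i S) = head_count x S"
    unfolding head_count_def by simp
  then show ?thesis using False by simp
next
  case True
  have fin': "finite (swap_set i S)" using fin by (simp add: swap_set_def)
  obtain m where m: "i = Suc m" using i by (cases i) auto
  have "Transposition.transpose m i s < m \<longleftrightarrow> s < m" for s
    using m by (auto simp: Transposition.transpose_def)
  then have "{s \<in> swap_set i S. s < m} = swap_set i {s \<in> S. s < m}"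
    unfolding swap_set_def m diff_Suc_1 by blast
  then have "head_count m (swap_set i S) = head_count m S"
    unfolding head_count_def by simp
  moreover have "m \<in> swap_set i S \<longleftrightarrow> i \<in> S" using m by (simp add: mem_swap_set)
  ultimately show ?thesis
    using True m head_count_Suc[OF fin', of m] head_count_Suc[OF fin, of m] by auto
qed

lemma set_minor_one:
  assumes S: "S \<subseteq> {0..n}" and nz: "set_minor S (1\<^sub>m (n + 1)) \<noteq> 0"
  shows "S = {0..<card S}"
proof -
  have fin: "finite S" using S finite_subset by blast
  have kn: "card S \<le> n + 1" using card_mono[OF _ S] by simp
  have b: "bij_betw (\<lambda>i. sorted_list_of_set S ! i) {0..<card S} S"
    by (rule bij_betw_sorted_list_nth[OF fin])
  obtain p where p: "p permutes {0..<card S}"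
    and nzp: "(\<Prod>i=0..<card S. 1\<^sub>m (n + 1) $$ (sorted_list_of_set S ! i, p i)) \<noteq> (0::complex)"
    using nz unfolding set_minor_def row_minor_leibniz
    by (metis (mono_tags, lifting) mem_Collect_eq mult_zero_right sum.neutral)
  have "sorted_list_of_set S ! i = p i" if "i < card S" for i
  proof -
    have "1\<^sub>m (n + 1) $$ (sorted_list_of_set S ! i, p i) \<noteq> (0::complex)"
      using nzp that by auto
    moreover have "sorted_list_of_set S ! i < n + 1"
    proof -
      have "sorted_list_of_set S ! i \<in> S" using bij_betwE[OF b] that by simp
      then show ?thesis using S by auto
    qed
    moreover have "p i < n + 1" using permutes_in_image[OF p, of i] that kn by simp
    ultimately show ?thesis by (auto split: if_splits)
  qed
  then have "(\<lambda>i. sorted_list_of_set S ! i) ` {0..<card S} \<subseteq> {0..<card S}"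
    using permutes_in_image[OF p] by (intro image_subsetI) simp
  then have "S \<subseteq> {0..<card S}" unfolding bij_betw_imp_surj_on[OF b] .
  then show ?thesis by (intro card_subset_eq) auto
qed

lemma set_minor_initial_one: "k \<le> n + 1 \<Longrightarrow> set_minor {0..<k} (1\<^sub>m (n + 1)) = 1"
proof -
  assume k: "k \<le> n + 1"
  have "mat k k (\<lambda>(i, j). 1\<^sub>m (n + 1) $$ (sorted_list_of_set {0..<k} ! i, j)) = (1\<^sub>m k :: complex mat)"
    using k by (intro eq_matI) (auto simp: sorted_list_of_set_range)
  then show ?thesis by (simp add: set_minor_def row_minor_def)
qed

text \<open>Each letter \<open>i\<close> moves at most one element of \<open>S\<close> across the gap between \<open>i - 1\<close> and \<open>i\<close>.\<close>

lemma head_count_reachable: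
  assumes "l \<le> n" "i \<le> n + 1 - l" "S \<subseteq> {0..n}"
    and "set_minor S (word_mat n C t (word_suffix n l i)) \<noteq> 0" "1 \<le> x" "x \<le> n"
  shows "min x (card S - crossings n l i x) \<le> head_count x S"
  using assms
proof (induction n l i arbitrary: S x rule: word_suffix.induct)
  case (1 n i)
  then have S: "S = {0..<card S}" using set_minor_one by simp
  have "{s \<in> S. s < x} = {0..<min x (card S)}" by (subst S) auto
  then have "head_count x S = min x (card S)" by (simp add: head_count_def)
  then show ?case by simp
next
  case (2 n l)
  then show ?case using crossings_next_block[of l n x] by simp
next
  case (3 n l i)
  let ?i = "Suc i" and ?g = "word_mat n C t (word_suffix n (Suc l) i)"
  let ?q = "Q (Suc i) (n - l - i)"
  have i: "1 \<le> ?i" "?i \<le> n" using 3(3) by auto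
  have fin: "finite S" using 3(4) finite_subset by blast
  have SS: "swap_set ?i S \<subseteq> {0..n}" using swap_set_subset[OF 3(4) i] .
  \<comment> \<open>Both the exponential and the reflection lift send a minor to a combination of
    itself and its swap, so one of these two must survive on the shorter word.\<close>
  obtain S' where S': "S' = S \<or> S' = swap_set ?i S" "set_minor S' ?g \<noteq> 0"
  proof -
    have c: "lower_elem n ?i s * g \<in> carrier_mat (n + 1) (n + 1)" if "g \<in> carrier_mat (n + 1) (n + 1)" for s g
      using that by (rule mult_carrier_mat[OF lower_elem_carrier])
    note wc = word_mat_carrier[of n C t "word_suffix n (Suc l) i"]
    have low: "set_minor A ?g \<noteq> 0 \<or> set_minor (swap_set ?i A) ?g \<noteq> 0"
      if A: "A \<subseteq> {0..n}" and nz: "set_minor A (lower_elem n ?i (t ?q) * ?g) \<noteq> 0" for A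
    proof -
      obtain e where "\<And>t g. g \<in> carrier_mat (n + 1) (n + 1) \<Longrightarrow> set_minor A (lower_elem n ?i t * g) =
          set_minor A g + (if ?i \<in> A \<and> ?i - 1 \<notin> A then t * e * set_minor (swap_set ?i A) g else 0)"
        using set_minor_lower_elem[OF A i] by blast
      from this[OF wc] nz show ?thesis by (auto split: if_splits)
    qed
    have 1: "set_minor S ?g \<noteq> 0 \<or> set_minor (swap_set ?i S) ?g \<noteq> 0"
      if "set_minor S (lower_elem n ?i (t ?q) * ?g) \<noteq> 0"
      using low[OF 3(4) that] .
    have 2: "set_minor S ?g \<noteq> 0 \<or> set_minor (swap_set ?i S) ?g \<noteq> 0"
      if "set_minor (swap_set ?i S) (lower_elem n ?i (t ?q) * ?g) \<noteq> 0"
      using low[OF SS that] by auto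
    have "set_minor S (lower_elem n ?i (t ?q) * ?g) \<noteq> 0 \<or>
        set_minor (swap_set ?i S) (lower_elem n ?i (t ?q) * ?g) \<noteq> 0"
    proof (cases "?q \<in> C")
      case True
      obtain d where "\<And>g. g \<in> carrier_mat (n + 1) (n + 1) \<Longrightarrow>
          set_minor S (s_lift n ?i * g) = d * set_minor (swap_set ?i S) g"
        using set_minor_s_lift[OF 3(4) i] by blast
      from this[OF c[OF wc]] show ?thesis using 3(5) True by (auto simp: u_lift_def)
    next
      case False
      then have "u_lift n C ?q ?i * (lower_elem n ?i (t ?q) * ?g) = lower_elem n ?i (t ?q) * ?g"
        unfolding u_lift_def
        using left_mult_one_mat[OF c[OF word_mat_carrier[of n C t "word_suffix n (Suc l) i"]]] by simp
      then show ?thesis using 3(5) by simp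
    qed
    then show ?thesis using 1 2 that by blast
  qed
  have S'n: "S' \<subseteq> {0..n}" using S'(1) 3(4) SS by auto
  have cS': "card S' = card S" using S'(1) by auto
  have IH: "min y (card S - crossings n (Suc l) i y) \<le> head_count y S'" if "1 \<le> y" "y \<le> n" for y
    using 3(1)[OF 3(2) _ S'n S'(2) that] 3(3) cS' by simp
  show ?case
  proof (cases "x = ?i")
    case False
    then have "head_count x S' = head_count x S"
      using S'(1) head_count_swap_set[OF fin i(1), of x] by auto
    moreover have "crossings n (Suc l) ?i x = crossings n (Suc l) i x"
      using False by (auto simp: crossings_def)
    ultimately show ?thesis using IH[OF 3(6,7)] by simp
  next
    case True
    have fin': "finite S'" using S'n finite_subset by blast
    have S: "S = S' \<or> S = swap_set ?i S'" using S'(1) by auto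
    have cr: "crossings n (Suc l) ?i x = Suc l" "crossings n (Suc l) i x = l"
      using True 3(3) by (auto simp: crossings_def)
    have lb: "min x (card S - l) \<le> head_count x S'" using IH[of x] 3(6,7) cr by simp
    show ?thesis
    proof (cases "i \<in> S' \<and> x \<notin> S'")
      case False
      then have "head_count x S' \<le> head_count x S"
        using S head_count_swap_set[OF fin' i(1), of x] True by auto
      then show ?thesis using lb cr by auto
    next
      case up: True
      have "head_count x S' \<le> Suc (head_count x S)"
        using S head_count_swap_set[OF fin' i(1), of x] True by auto
      \<comment> \<open>The swap may lower the head count at \<open>x\<close> by one. If
        \<open>Suc x \<le> card S - l\<close>, the bound at the next gap would force
        \<open>x \<in> S'\<close>. So \<open>card S - l \<le> x\<close>, and the additional crossing
        lowers the required bound by one too, unless it is already 0.\<close>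
      moreover have "Suc x \<le> card S - l \<Longrightarrow> Suc x \<le> head_count (Suc x) S'"
      proof -
        assume *: "Suc x \<le> card S - l"
        show "Suc x \<le> head_count (Suc x) S'"
        proof (cases "x = n")
          case True
          then show ?thesis using head_count_all[OF S'n] cS' * by simp
        next
          case False
          then have "crossings n (Suc l) i (Suc x) = l" using True 3(3,7) by (auto simp: crossings_def)
          then show ?thesis using IH[of "Suc x"] False 3(7) * by simp
        qed
      qed
      then have "\<not> Suc x \<le> card S - l"
        using head_count_Suc[OF fin', of x] head_count_le[of x S'] up by auto
      ultimately show ?thesis using lb cr by auto
    qed
  qed
qed

text \<open>Describes when the gap below \<open>x\<close>, crossed \<open>d\<close> times, is still
  extremal: the path has as few elements below \<open>x\<close> as
  \<open>head_count_reachable\<close> allows. Testing the last crossing suffices, since exponent 1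
  at a chain element for \<open>d' < d\<close> would need
  \<open>tail_count (x - 1) R < d' + 1\<close>, against
  \<open>d \<le> tail_count x R\<close>.\<close>

definition upward :: "nat \<Rightarrow> gt set \<Rightarrow> nat set \<Rightarrow> nat \<Rightarrow> nat \<Rightarrow> bool" where
  "upward n C R x d \<longleftrightarrow>
    d = 0 \<or> (d \<le> tail_count x R \<and> \<not> (Q x (n + 2 - x - d) \<in> C \<and> col_expo n C R x d = 1))"

definition path_inv :: "nat \<Rightarrow> gt set \<Rightarrow> nat set \<Rightarrow> nat \<Rightarrow> nat \<Rightarrow> nat set \<Rightarrow> bool" where
  "path_inv n C R l i S \<longleftrightarrow> S \<subseteq> {0..n} \<and> card S = card R \<and>
    (\<forall>x. 1 \<le> x \<longrightarrow> x \<le> n \<longrightarrow> upward n C R x (crossings n l i x) \<longrightarrow>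
      head_count x S = min x (card R - crossings n l i x))"

lemma path_invD:
  assumes "path_inv n C R l i S" "1 \<le> x" "x \<le> n" "crossings n l i x = d" "upward n C R x d"
  shows "head_count x S = min x (card R - d)"
  using assms unfolding path_inv_def by blast

lemma col_expo_eq_1_iff:
  "col_expo n C R i l = 1 \<longleftrightarrow> l \<le> tail_count i R \<and>
    (if Q i (n + 2 - i - l) \<in> C then tail_count (i + 1) R < l \<and> tail_count (i - 1) R < l + 1
     else card R < i + l)"
  by (simp add: col_expo_def)

text \<open>At a chain element the second bound follows from
  \<open>tail_count (i - 1) R \<le> l\<close>, because at most \<open>i - 1\<close> entries of
  \<open>R\<close> lie below \<open>i - 1\<close>.\<close>

lemma col_expo_eq_1D:
  assumes R: "R \<subseteq> {0..n}" and i: "1 \<le> i" and a: "col_expo n C R i l = 1"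
  shows "l \<le> tail_count i R" "card R < i + l"
proof -
  have fin: "finite R" using R finite_subset by blast
  show "l \<le> tail_count i R" using a unfolding col_expo_eq_1_iff by simp
  show "card R < i + l"
  proof (cases "Q i (n + 2 - i - l) \<in> C")
    case True
    then have "tail_count (i - 1) R < l + 1" using a unfolding col_expo_eq_1_iff by simp
    then show ?thesis using card_le_tail_count_plus[OF fin, of "i - 1"] i by simp
  next
    case False
    then show ?thesis using a unfolding col_expo_eq_1_iff by simp
  qed
qed

text \<open>The three gaps around the letter are extremal: exponent 1 at their latest chain letters
  would require \<open>tail_count (i + 1) R < Suc l\<close> or
  \<open>tail_count i R < Suc l\<close>, and \<open>tc\<close> excludes both. These are the two
  inequalities in the chain case of \<open>col_expo\<close>.\<close>

lemma head_count_crossing: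
  assumes inv: "path_inv n C R (Suc l) i S" and R: "R \<subseteq> {0..n}"
    and l: "Suc l \<le> n" and i: "Suc i \<le> n - l" and tc: "Suc l \<le> tail_count (Suc i) R"
  shows "head_count i S = min i (card R - Suc l)"
    and "head_count (Suc i) S = min (Suc i) (card R - l)"
    and "head_count (Suc (Suc i)) S = min (Suc (Suc i)) (card R - l)"
proof -
  have fin: "finite R" using R finite_subset by blast
  note tc_Suc = tail_count_Suc[OF fin]
  show "head_count i S = min i (card R - Suc l)"
  proof (cases "i = 0")
    case False
    have "upward n C R i (Suc l)"
      using tc tc_Suc[of i] unfolding upward_def col_expo_eq_1_iff by (auto split: if_splits)
    then show ?thesis using path_invD[OF inv, of i "Suc l"] False i by (auto simp: crossings_def)
  qed simp
  show "head_count (Suc i) S = min (Suc i) (card R - l)"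
  proof -
    have "upward n C R (Suc i) l"
      using tc tc_Suc[of i] unfolding upward_def col_expo_eq_1_iff by (auto split: if_splits)
    then show ?thesis using path_invD[OF inv, of "Suc i" l] i by (auto simp: crossings_def)
  qed
  show "head_count (Suc (Suc i)) S = min (Suc (Suc i)) (card R - l)"
  proof (cases "Suc i = n")
    case True
    then have "l = 0" using i l by simp
    moreover have "head_count (Suc (Suc i)) S = card R"
      using head_count_all[of S n] inv True by (simp add: path_inv_def)
    moreover have "card R \<le> Suc n" using card_mono[OF _ R] by simp
    ultimately show ?thesis using True by simp
  next
    case False
    have "upward n C R (Suc (Suc i)) l"
      using tc tc_Suc[of "Suc i"] unfolding upward_def col_expo_eq_1_iff by (auto split: if_splits)
    then show ?thesis using path_invD[OF inv, of "Suc (Suc i)" l] i False by (auto simp: crossings_def)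
  qed
qed

text \<open>Membership is the difference of neighbouring head counts, all three of which are
  extremal here.\<close>

lemma crossing_members:
  assumes inv: "path_inv n C R (Suc l) i S" and R: "R \<subseteq> {0..n}"
    and l: "Suc l \<le> n" and i: "Suc i \<le> n - l" and tc: "Suc l \<le> tail_count (Suc i) R"
  shows "i \<in> S" and "Suc i \<in> S \<longleftrightarrow> Suc i + Suc l \<le> card R"
proof -
  have finR: "finite R" using R finite_subset by blast
  have fin: "finite S" using inv finite_subset by (auto simp: path_inv_def)
  have "Suc l \<le> card R" using tc tail_count_antimono[OF finR, of 0 "Suc i"] by simp
  then have 1: "head_count (Suc i) S = Suc (head_count i S)"
    and 2: "head_count (Suc (Suc i)) S = Suc (head_count (Suc i) S) \<longleftrightarrow> Suc i + Suc l \<le> card R"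
    unfolding head_count_crossing[OF assms] by auto
  show "i \<in> S" using 1 head_count_Suc[OF fin, of i] by (simp split: if_splits)
  show "Suc i \<in> S \<longleftrightarrow> Suc i + Suc l \<le> card R"
    unfolding 2[symmetric] using head_count_Suc[OF fin, of "Suc i"] by simp
qed

text \<open>Only the gap at \<open>Suc i\<close> changes. Under \<open>upward\<close>, an order
  letter with exponent 0 leaves the set alone, but then \<open>Suc i + Suc l \<le> card R\<close>
  and the extremal value is \<open>Suc i\<close> before and after. A chain letter with exponent 1
  gives up extremality, which is why \<open>upward\<close> exempts it.\<close>

lemma path_inv_letter:
  assumes inv: "path_inv n C R (Suc l) i S'" and R: "R \<subseteq> {0..n}"
    and l: "Suc l \<le> n" and i: "Suc i \<le> n - l"
    and S: "S = (if (Q (Suc i) (n - l - i) \<in> C) \<noteq> (col_expo n C R (Suc i) (Suc l) = 1)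
      then swap_set (Suc i) S' else S')"
  shows "path_inv n C R (Suc l) (Suc i) S"
proof -
  have S': "S' \<subseteq> {0..n}" "card S' = card R" using inv by (auto simp: path_inv_def)
  have finR: "finite R" using R finite_subset by blast
  have fin: "finite S'" using S' finite_subset by auto
  have ivl: "S \<subseteq> {0..n}" "card S = card R"
    using S' swap_set_subset[OF S'(1), of "Suc i"] i S by auto
  have q: "n + 2 - Suc i - Suc l = n - l - i" by simp
  have "head_count x S = min x (card R - crossings n (Suc l) (Suc i) x)"
    if x: "1 \<le> x" "x \<le> n" and up: "upward n C R x (crossings n (Suc l) (Suc i) x)" for x
  proof (cases "x = Suc i")
    case False
    then have "crossings n (Suc l) (Suc i) x = crossings n (Suc l) i x" by (auto simp: crossings_def)
    moreover have "head_count x S = head_count x S'"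
      using S head_count_swap_set[OF fin, of "Suc i" x] False by simp
    ultimately show ?thesis using inv x up by (simp add: path_inv_def)
  next
    case True
    have cr: "crossings n (Suc l) (Suc i) x = Suc l" using True by (simp add: crossings_def)
    then have tc: "Suc l \<le> tail_count (Suc i) R"
      and nc: "Q (Suc i) (n - l - i) \<in> C \<Longrightarrow> col_expo n C R (Suc i) (Suc l) \<noteq> 1"
      using up True q by (auto simp: upward_def)
    have hc: "head_count (Suc i) S' = min (Suc i) (card R - l)"
      using head_count_crossing[OF inv R l i tc] by simp
    note mem = crossing_members[OF inv R l i tc]
    have "Suc l \<le> card R" using tc tail_count_antimono[OF finR, of 0 "Suc i"] by simp
    moreover have "col_expo n C R (Suc i) (Suc l) = 1 \<longleftrightarrow> card R < Suc i + Suc l"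
      if "Q (Suc i) (n - l - i) \<notin> C"
      using that tc q by (simp only: col_expo_eq_1_iff if_False) simp
    ultimately show ?thesis
      using S nc hc mem cr True head_count_swap_set[OF fin, of "Suc i" "Suc i"]
      by (cases "card R < Suc i + Suc l") (auto simp: not_less min_def)
  qed
  then show ?thesis using ivl by (simp add: path_inv_def)
qed

lemma path_inv_path:
  assumes "R \<subseteq> {0..n}" "l \<le> n" "i \<le> n + 1 - l"
  shows "path_inv n C R l i (path n C R l i)"
  using assms
proof (induction n C R l i rule: path.induct)
  case (1 n C R i)
  have "card R \<le> Suc n" using card_mono[OF _ 1(1)] by simp
  moreover have "head_count x {0..<card R} = min x (card R)" for x
  proof -
    have "{s \<in> {0..<card R}. s < x} = {0..<min x (card R)}" by auto
    then show ?thesis by (simp add: head_count_def)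
  qed
  ultimately show ?case by (auto simp: path_inv_def crossings_def)
next
  case (2 n C R l)
  then have "path_inv n C R l (n + 1 - l) (path n C R l (n + 1 - l))" by simp
  then show ?case using 2(3) crossings_next_block[of l n] by (simp add: path_inv_def)
next
  case (3 n C R l i)
  have i: "Suc i \<le> n - l" using 3 by simp
  have "path_inv n C R (Suc l) i (path n C R (Suc l) i)" using 3 by auto
  from path_inv_letter[OF this 3(3,4) i refl] show ?case by simp
qed

text \<open>If the exponent is 1, the other predecessor of the path violates the bound of
  \<open>head_count_reachable\<close>, so its minor vanishes.\<close>

lemma column_letter:
  assumes R: "R \<subseteq> {0..n}" and l: "Suc l \<le> n" and i: "Suc i \<le> n - l"
  shows "\<exists>\<epsilon>\<in>{1, -1}. \<forall>t. \<exists>h. \<forall>s.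
    set_minor (path n C R (Suc l) (Suc i)) (u_lift n C (Q (Suc i) (n - l - i)) (Suc i) *
        (lower_elem n (Suc i) s * word_mat n C t (word_suffix n (Suc l) i))) =
      s ^ col_expo n C R (Suc i) (Suc l) *
        (\<epsilon> * set_minor (path n C R (Suc l) i) (word_mat n C t (word_suffix n (Suc l) i)) + s * h)"
proof -
  let ?S' = "path n C R (Suc l) i" and ?a = "col_expo n C R (Suc i) (Suc l)"
  let ?q = "Q (Suc i) (n - l - i)" and ?ws = "word_suffix n (Suc l) i"
  have inv: "path_inv n C R (Suc l) i ?S'" using path_inv_path[OF R] l i by simp
  have S': "?S' \<subseteq> {0..n}" "card ?S' = card R" using inv by (auto simp: path_inv_def)
  have fin: "finite ?S'" using S' finite_subset by auto
  have i': "1 \<le> Suc i" "Suc i \<le> n" using i by auto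
  have a01: "?a = 0 \<or> ?a = 1" by (simp add: col_expo_def)
  have one: "i \<in> ?S' \<and> Suc i \<notin> ?S' \<and> (\<forall>t. set_minor (swap_set (Suc i) ?S') (word_mat n C t ?ws) = 0)"
    if a: "?a = 1"
  proof -
    note tc = col_expo_eq_1D[OF R _ a]
    have tc1: "Suc l \<le> tail_count (Suc i) R" using tc by simp
    have mem: "i \<in> ?S'" "Suc i \<notin> ?S'"
      using crossing_members[OF inv R l i tc1] tc(2) by auto
    have hc: "head_count (Suc i) ?S' = min (Suc i) (card R - l)"
      using head_count_crossing[OF inv R l i tc1] by simp
    have "Suc l \<le> card R"
      using tc1 tail_count_antimono[OF finite_subset[OF R], of 0 "Suc i"] by simp
    then have hcW: "head_count (Suc i) (swap_set (Suc i) ?S') < min (Suc i) (card R - l)"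
      using head_count_swap_set[OF fin, of "Suc i" "Suc i"] mem hc tc(2) by auto
    have W: "swap_set (Suc i) ?S' \<subseteq> {0..n}" using swap_set_subset[OF S'(1) i'] .
    have "crossings n (Suc l) i (Suc i) = l" using i by (simp add: crossings_def)
    then have "set_minor (swap_set (Suc i) ?S') (word_mat n C t ?ws) = 0" for t
      using head_count_reachable[OF l _ W, of i C t "Suc i"] i hcW S'(2) by fastforce
    then show ?thesis using mem by blast
  qed
  have q: "path n C R (Suc l) (Suc i) = (if (?q \<in> C) \<noteq> (?a = 1) then swap_set (Suc i) ?S' else ?S')"
    by simp
  have pre: "?a = 0 \<or> ?a = 1 \<and> Suc i - 1 \<in> ?S' \<and> Suc i \<notin> ?S'" using a01 one by auto
  obtain \<epsilon> \<eta> where \<epsilon>: "\<epsilon> \<in> {1, -1}" and eq: "\<And>s g. g \<in> carrier_mat (n + 1) (n + 1) \<Longrightarrow>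
    set_minor (path n C R (Suc l) (Suc i)) (u_lift n C ?q (Suc i) * (lower_elem n (Suc i) s * g)) =
      (if ?a = 0 then \<epsilon> * set_minor ?S' g + s * \<eta> * set_minor (swap_set (Suc i) ?S') g
       else s * \<epsilon> * set_minor ?S' g + \<eta> * set_minor (swap_set (Suc i) ?S') g)"
    using set_minor_letter[OF S'(1) i' q pre] by blast
  show ?thesis
  proof (intro bexI[OF _ \<epsilon>] allI)
    fix t
    note eq' = eq[OF word_mat_carrier[of n C t ?ws]]
    show "\<exists>h. \<forall>s. set_minor (path n C R (Suc l) (Suc i)) (u_lift n C ?q (Suc i) *
        (lower_elem n (Suc i) s * word_mat n C t ?ws)) =
      s ^ ?a * (\<epsilon> * set_minor ?S' (word_mat n C t ?ws) + s * h)"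
    proof (cases "?a = 0")
      case True
      then show ?thesis
        unfolding eq' by (intro exI[of _ "\<eta> * set_minor (swap_set (Suc i) ?S') (word_mat n C t ?ws)"]) simp
    next
      case False
      then have a: "?a = 1" using a01 by simp
      then show ?thesis
        unfolding eq' using one[OF a] by (intro exI[of _ 0]) simp
    qed
  qed
qed

text \<open>The value \<open>y\<close> may be 0: the minor left over after a letter still depends on
  the parameters further right and can vanish for some of them.\<close>

definition low_term :: "(complex \<Rightarrow> complex) \<Rightarrow> nat \<Rightarrow> complex \<Rightarrow> bool" where
  "low_term f a y \<longleftrightarrow> (\<exists>p. poly p 0 = y \<and> (\<forall>s. f s = s ^ a * poly p s))"

lemma low_term_mult:
  assumes "low_term f a y" "low_term g b z"
  shows "low_term (\<lambda>s. f s * g s) (a + b) (y * z)"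
proof -
  obtain p q where "poly p 0 = y" "\<forall>s. f s = s ^ a * poly p s" "poly q 0 = z" "\<forall>s. g s = s ^ b * poly q s"
    using assms by (auto simp: low_term_def)
  then show ?thesis
    unfolding low_term_def by (intro exI[of _ "p * q"]) (auto simp: power_add mult_ac)
qed

lemma tuple_minor_Nil [simp]: "tuple_minor [] g = 1"
  by (simp add: tuple_minor_def)

lemma tuple_minor_Cons [simp]: "tuple_minor (R # T) g = set_minor R g * tuple_minor T g"
  unfolding tuple_minor_def list.size prod.lessThan_Suc_shift add_Suc_right add_0_right by simp

definition tuple_expo :: "nat \<Rightarrow> gt set \<Rightarrow> nat set list \<Rightarrow> nat \<Rightarrow> nat \<Rightarrow> nat" where
  "tuple_expo n C T i l = sum_list (map (\<lambda>R. col_expo n C R i l) T)"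

text \<open>Lowest exponents of the columns add under products. The sign comes before
  \<open>t\<close>, since it becomes a constant factor of a functional; only the polynomial cofactor
  depends on the remaining parameters.\<close>

lemma tuple_letter:
  assumes l: "Suc l \<le> n" and i: "Suc i \<le> n - l" and T: "\<And>R. R \<in> set T \<Longrightarrow> R \<subseteq> {0..n}"
  shows "\<exists>\<epsilon>\<in>{1, -1}. \<forall>t. low_term
    (\<lambda>s. tuple_minor (map (\<lambda>R. path n C R (Suc l) (Suc i)) T) (u_lift n C (Q (Suc i) (n - l - i)) (Suc i) *
        (lower_elem n (Suc i) s * word_mat n C t (word_suffix n (Suc l) i))))
    (tuple_expo n C T (Suc i) (Suc l))
    (\<epsilon> * tuple_minor (map (\<lambda>R. path n C R (Suc l) i) T) (word_mat n C t (word_suffix n (Suc l) i)))"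
  using T
proof (induction T)
  case Nil
  show ?case by (auto simp: low_term_def tuple_expo_def intro!: exI[of _ 1])
next
  case (Cons R T)
  let ?W = "\<lambda>t. word_mat n C t (word_suffix n (Suc l) i)"
  let ?X = "\<lambda>s t. u_lift n C (Q (Suc i) (n - l - i)) (Suc i) * (lower_elem n (Suc i) s * ?W t)"
  obtain e1 where e1: "e1 \<in> {1, -1}" "\<And>t. low_term
      (\<lambda>s. tuple_minor (map (\<lambda>R. path n C R (Suc l) (Suc i)) T) (?X s t))
      (tuple_expo n C T (Suc i) (Suc l)) (e1 * tuple_minor (map (\<lambda>R. path n C R (Suc l) i) T) (?W t))"
    using Cons.IH[OF Cons.prems[OF list.set_intros(2)]] by blast
  obtain e2 where e2: "e2 \<in> {1, -1}" "\<And>t. \<exists>h. \<forall>s. set_minor (path n C R (Suc l) (Suc i)) (?X s t) =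
      s ^ col_expo n C R (Suc i) (Suc l) * (e2 * set_minor (path n C R (Suc l) i) (?W t) + s * h)"
    using column_letter[OF Cons.prems[OF list.set_intros(1)] l i, of C] by blast
  have "low_term (\<lambda>s. set_minor (path n C R (Suc l) (Suc i)) (?X s t))
      (col_expo n C R (Suc i) (Suc l)) (e2 * set_minor (path n C R (Suc l) i) (?W t))" for t
  proof -
    obtain h where h: "\<forall>s. set_minor (path n C R (Suc l) (Suc i)) (?X s t) =
        s ^ col_expo n C R (Suc i) (Suc l) * (e2 * set_minor (path n C R (Suc l) i) (?W t) + s * h)"
      using e2(2) by blast
    show ?thesis
      unfolding low_term_def h[rule_format]
      by (intro exI[of _ "[:e2 * set_minor (path n C R (Suc l) i) (?W t), h:]"]) simp
  qed
  from low_term_mult[OF this e1(2)] show ?case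
    by (intro bexI[of _ "e2 * e1"])
      (use e1(1) e2(1) in \<open>auto simp: tuple_expo_def mult_ac simp del: path.simps\<close>)
qed

section \<open>Lattice points and tableaux\<close>

text \<open>The length of row \<open>l\<close> in the Young diagram of \<open>lam\<close>. The value
  at \<open>n + 1\<close> is 0, the marking of \<open>p\<^sub>0\<close>.\<close>

definition weight_tail :: "nat \<Rightarrow> (nat \<Rightarrow> nat) \<Rightarrow> nat \<Rightarrow> nat" where
  "weight_tail n lam l = (\<Sum>k=l..n. lam k)"

lemma weight_tail_antimono: "l \<le> m \<Longrightarrow> weight_tail n lam m \<le> weight_tail n lam l"
  unfolding weight_tail_def by (rule sum_mono2) auto

lemma weight_tail_Suc: "k \<le> n \<Longrightarrow> weight_tail n lam k = lam k + weight_tail n lam (Suc k)"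
  by (simp add: weight_tail_def sum.atLeast_Suc_atMost)

lemma marking_eq: "marking n lam j = real (weight_tail n lam (n + 1 - j))"
  by (simp add: marking_def weight_tail_def)

text \<open>The column lengths of the Young diagram of \<open>lam\<close>, in decreasing order.\<close>

definition shape :: "nat \<Rightarrow> (nat \<Rightarrow> nat) \<Rightarrow> nat list" where
  "shape n lam = map (\<lambda>c. card {l \<in> {1..n}. c < weight_tail n lam l}) [0..<weight_tail n lam 1]"

lemma length_shape [simp]: "length (shape n lam) = weight_tail n lam 1"
  by (simp add: shape_def)

lemma shape_nth_le: "c < weight_tail n lam 1 \<Longrightarrow> shape n lam ! c \<le> n"
proof -
  assume "c < weight_tail n lam 1"
  moreover have "card {l \<in> {1..n}. c < weight_tail n lam l} \<le> card {1..n}"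
    by (rule card_mono) auto
  ultimately show ?thesis by (simp add: shape_def)
qed

text \<open>The counting fact behind conjugation of partitions: an initial segment is recovered from
  its cardinality.\<close>

lemma initial_segment_card:
  fixes P :: "nat \<Rightarrow> bool"
  assumes "\<And>l l'. 1 \<le> l \<Longrightarrow> l \<le> l' \<Longrightarrow> l' \<le> m \<Longrightarrow> P l' \<Longrightarrow> P l" "1 \<le> l" "l \<le> m"
  shows "l \<le> card {l \<in> {1..m}. P l} \<longleftrightarrow> P l"
proof
  assume "P l"
  then have "{1..l} \<subseteq> {l \<in> {1..m}. P l}" using assms by auto
  then have "card {1..l} \<le> card {l \<in> {1..m}. P l}" by (rule card_mono[rotated]) simp
  then show "l \<le> card {l \<in> {1..m}. P l}" by simp
next
  assume *: "l \<le> card {l \<in> {1..m}. P l}"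
  show "P l"
  proof (rule ccontr)
    assume "\<not> P l"
    have "{l \<in> {1..m}. P l} \<subseteq> {1..<l}"
    proof
      fix x assume x: "x \<in> {l \<in> {1..m}. P l}"
      then have "\<not> l \<le> x" using assms(1)[of l x] assms(2) \<open>\<not> P l\<close> by auto
      then show "x \<in> {1..<l}" using x by auto
    qed
    then have "card {l \<in> {1..m}. P l} \<le> card {1..<l}" by (rule card_mono[rotated]) simp
    then show False using * assms(2) by simp
  qed
qed

lemma le_shape_nth_iff:
  assumes "c < weight_tail n lam 1" "1 \<le> l"
  shows "l \<le> shape n lam ! c \<longleftrightarrow> c < weight_tail n lam l"
proof (cases "l \<le> n")
  case True
  have "l \<le> card {l \<in> {1..n}. c < weight_tail n lam l} \<longleftrightarrow> c < weight_tail n lam l"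
    using assms True weight_tail_antimono less_le_trans
    by (intro initial_segment_card) blast+
  then show ?thesis using assms by (simp add: shape_def)
next
  case False
  then have "weight_tail n lam l = 0" by (simp add: weight_tail_def)
  then show ?thesis using False shape_nth_le[OF assms(1)] by simp
qed

lemma shape_decreasing: "Suc c < length (shape n lam) \<Longrightarrow> shape n lam ! Suc c \<le> shape n lam ! c"
  using le_shape_nth_iff[of c n lam "shape n lam ! Suc c"]
    le_shape_nth_iff[of "Suc c" n lam "shape n lam ! Suc c"]
  by (cases "shape n lam ! Suc c") auto

text \<open>The columns of length \<open>k\<close> are those with index from
  \<open>weight_tail n lam (Suc k)\<close> up to, but excluding, \<open>weight_tail n lam k\<close>,
  so there are \<open>lam k\<close> of them.\<close>

lemma prod_shape:
  "(\<Prod>c<length (shape n lam). h (shape n lam ! c)) = (\<Prod>k=1..n. h k ^ lam k :: complex)"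
proof -
  let ?s = "\<lambda>c. shape n lam ! c" and ?W = "weight_tail n lam"
  have fiber: "{c \<in> {..<?W 1}. ?s c = k} = {?W (Suc k)..<?W k}" if k: "k \<in> {1..n}" for k
  proof -
    have "?W k \<le> ?W 1" using k by (intro weight_tail_antimono) auto
    moreover have "?s c = k \<longleftrightarrow> c < ?W k \<and> \<not> c < ?W (Suc k)" if "c < ?W 1" for c
    proof -
      have "?s c = k \<longleftrightarrow> k \<le> ?s c \<and> \<not> Suc k \<le> ?s c" by auto
      then show ?thesis
        using le_shape_nth_iff[OF that, of k] le_shape_nth_iff[OF that, of "Suc k"] k by simp
    qed
    ultimately have "c \<in> {c \<in> {..<?W 1}. ?s c = k} \<longleftrightarrow> c \<in> {?W (Suc k)..<?W k}" for c
      by (cases "c < ?W 1") (simp_all add: not_less conj_commute)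
    then show ?thesis by blast
  qed
  have "?s ` {..<?W 1} \<subseteq> {1..n}"
    using shape_nth_le[of _ n lam] le_shape_nth_iff[of _ n lam 1] by auto
  then have "(\<Prod>c<?W 1. h (?s c)) = (\<Prod>k\<in>{1..n}. \<Prod>c\<in>{c \<in> {..<?W 1}. ?s c = k}. h (?s c))"
    by (intro prod.group[symmetric]) auto
  also have "\<dots> = (\<Prod>k=1..n. \<Prod>c\<in>{c \<in> {..<?W 1}. ?s c = k}. h k)"
    by (intro prod.cong) auto
  also have "\<dots> = (\<Prod>k=1..n. h k ^ lam k)"
  proof (intro prod.cong refl)
    fix k assume k: "k \<in> {1..n}"
    show "(\<Prod>c\<in>{c \<in> {..<?W 1}. ?s c = k}. h k) = h k ^ lam k"
      unfolding fiber[OF k] using weight_tail_Suc[of k n lam] k by simp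
  qed
  finally show ?thesis by simp
qed

text \<open>The Gelfand--Tsetlin pattern of a tableau: row \<open>i\<close> consists of the row
  lengths of the diagram filled by the entries \<open>\<ge> i\<close>. Row 0 is the shape
  itself.\<close>

definition pattern :: "nat set list \<Rightarrow> nat \<Rightarrow> nat \<Rightarrow> nat" where
  "pattern T i l = card {c \<in> {..<length T}. l \<le> tail_count i (T ! c)}"

lemma nested_tail_count_antimono:
  assumes "nested T" "c \<le> d" "d < length T"
  shows "tail_count i (T ! d) \<le> tail_count i (T ! c)"
  using assms(2,3)
proof (induction d rule: dec_induct)
  case (step d)
  then have "tail_count i (T ! Suc d) \<le> tail_count i (T ! d)" using assms(1) by (auto simp: nested_def)
  then show ?case using step by simp
qed simp

lemma card_down_closed:
  fixes P :: "nat \<Rightarrow> bool"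
  assumes "\<And>c d. c \<le> d \<Longrightarrow> d < m \<Longrightarrow> P d \<Longrightarrow> P c"
  shows "{c \<in> {..<m}. P c} = {..<card {c \<in> {..<m}. P c}}"
  using assms
proof (induction m)
  case (Suc m)
  show ?case
  proof (cases "P m")
    case True
    then have "{c \<in> {..<Suc m}. P c} = {..<Suc m}" using Suc.prems[of _ m] by auto
    then show ?thesis by simp
  next
    case False
    then have "{c \<in> {..<Suc m}. P c} = {c \<in> {..<m}. P c}" by (auto simp: less_Suc_eq)
    moreover have "{c \<in> {..<m}. P c} = {..<card {c \<in> {..<m}. P c}}"
      using Suc.prems by (intro Suc.IH) auto
    ultimately show ?thesis by simp
  qed
qed simp

lemma nested_set_eq:
  assumes "nested T"
  shows "{c \<in> {..<length T}. l \<le> tail_count i (T ! c)} = {..<pattern T i l}"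
  unfolding pattern_def
proof (rule card_down_closed)
  fix c d assume "c \<le> d" "d < length T" "l \<le> tail_count i (T ! d)"
  then show "l \<le> tail_count i (T ! c)" using nested_tail_count_antimono[OF assms] le_trans by blast
qed

lemma le_tail_count_iff:
  assumes "nested T" "c < length T"
  shows "l \<le> tail_count i (T ! c) \<longleftrightarrow> c < pattern T i l"
  using nested_set_eq[OF assms(1), of l i] assms(2) by blast

lemma col_tuplesD:
  assumes "T \<in> col_tuples n ks" "c < length T"
  shows "T ! c \<subseteq> {0..n}" "finite (T ! c)" "card (T ! c) = ks ! c"
proof -
  show 1: "T ! c \<subseteq> {0..n}" "card (T ! c) = ks ! c" using assms by (auto simp: col_tuples_def)
  show "finite (T ! c)" using finite_subset[OF 1(1)] by simp
qed

lemma pattern_0: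
  assumes "T \<in> col_tuples n (shape n lam)" "1 \<le> l"
  shows "pattern T 0 l = weight_tail n lam l"
proof -
  have len: "length T = weight_tail n lam 1" using assms by (simp add: col_tuples_def)
  have "{c \<in> {..<length T}. l \<le> tail_count 0 (T ! c)} = {c. c < weight_tail n lam l}"
    using col_tuplesD(3)[OF assms(1)] le_shape_nth_iff[of _ n lam l] assms(2) len
      weight_tail_antimono[of 1 l n lam] by auto
  then show ?thesis by (simp add: pattern_def)
qed

text \<open>All three hold column by column, since a tail count drops by at most one from
  \<open>i\<close> to \<open>Suc i\<close>. The first two are the interlacing conditions; the third
  keeps the translated order coordinates nonnegative.\<close>

lemma pattern_ineqs:
  assumes "T \<in> col_tuples n ks"
  shows "pattern T (Suc i) l \<le> pattern T i l" "pattern T i (Suc l) \<le> pattern T (Suc i) l"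
    and "pattern T 0 (i + l) \<le> pattern T i l"
proof -
  have tc: "tail_count (Suc i) (T ! c) \<le> tail_count i (T ! c)"
    "tail_count i (T ! c) \<le> Suc (tail_count (Suc i) (T ! c))"
    "card (T ! c) \<le> tail_count i (T ! c) + i" if "c < length T" for c
    using tail_count_Suc[OF col_tuplesD(2)[OF assms that], of i]
      card_le_tail_count_plus[OF col_tuplesD(2)[OF assms that], of i] by auto
  have sub: "card {c \<in> {..<length T}. A c} \<le> card {c \<in> {..<length T}. B c}"
    if "\<And>c. c < length T \<Longrightarrow> A c \<Longrightarrow> B c" for A B
    using that by (intro card_mono) auto
  show "pattern T (Suc i) l \<le> pattern T i l" unfolding pattern_def using tc by (intro sub) fastforce
  show "pattern T i (Suc l) \<le> pattern T (Suc i) l" unfolding pattern_def using tc by (intro sub) fastforce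
  show "pattern T 0 (i + l) \<le> pattern T i l" unfolding pattern_def using tc by (intro sub) fastforce
qed

lemma pattern_above:
  assumes "T \<in> col_tuples n ks" "n + 1 - i < l"
  shows "pattern T i l = 0"
proof -
  have "\<not> l \<le> tail_count i (T ! c)" if "c < length T" for c
    using tail_count_le[OF col_tuplesD(1)[OF assms(1) that], of i] assms(2) by simp
  then show ?thesis by (auto simp: pattern_def)
qed

lemma tuple_expo_card:
  "tuple_expo n C T i l = card {c \<in> {..<length T}. col_expo n C (T ! c) i l = 1}"
proof -
  have "tuple_expo n C T i l = (\<Sum>c<length T. col_expo n C (T ! c) i l)"
    by (simp add: tuple_expo_def sum_list_sum_nth atLeast0LessThan)
  also have "\<dots> = (\<Sum>c<length T. if col_expo n C (T ! c) i l = 1 then 1 else 0)"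
    by (intro sum.cong refl) (simp add: col_expo_def)
  also have "\<dots> = card {c \<in> {..<length T}. col_expo n C (T ! c) i l = 1}"
    by (simp add: sum.inter_filter[symmetric])
  finally show ?thesis .
qed

lemma tuple_expo_order:
  assumes T: "T \<in> col_tuples n ks" and q: "Q i (n + 2 - i - l) \<notin> C"
  shows "tuple_expo n C T i l = pattern T i l - pattern T 0 (i + l)"
proof -
  have fin: "finite (T ! c)" if "c < length T" for c using col_tuplesD(2)[OF T that] .
  let ?A = "{c \<in> {..<length T}. l \<le> tail_count i (T ! c)}"
  let ?B = "{c \<in> {..<length T}. i + l \<le> tail_count 0 (T ! c)}"
  have "{c \<in> {..<length T}. col_expo n C (T ! c) i l = 1} = ?A - ?B"
    unfolding col_expo_eq_1_iff using q by auto
  moreover have "?B \<subseteq> ?A" using card_le_tail_count_plus[OF fin, of _ i] by fastforce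
  ultimately show ?thesis
    unfolding tuple_expo_card pattern_def by (simp add: card_Diff_subset)
qed

text \<open>Here \<open>nested\<close> enters. The columns excluded by the two lower neighbours form
  two initial segments, so their union has the larger of the two cardinalities. Thus the column
  exponents sum to the transfer of the whole pattern, although a maximum is not additive.\<close>

lemma tuple_expo_chain:
  assumes T: "T \<in> col_tuples n ks" and nest: "nested T" and q: "Q i (n + 2 - i - l) \<in> C" and i: "1 \<le> i"
  shows "tuple_expo n C T i l = pattern T i l - max (pattern T (i + 1) l) (pattern T (i - 1) (l + 1))"
    and "max (pattern T (i + 1) l) (pattern T (i - 1) (l + 1)) \<le> pattern T i l"
proof -
  show le: "max (pattern T (i + 1) l) (pattern T (i - 1) (l + 1)) \<le> pattern T i l"
    using pattern_ineqs(1)[OF T, of i l] pattern_ineqs(2)[OF T, of "i - 1" l] i by simp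
  have "{c \<in> {..<length T}. col_expo n C (T ! c) i l = 1} =
      {c \<in> {..<length T}. l \<le> tail_count i (T ! c)} - ({c \<in> {..<length T}. l \<le> tail_count (i + 1) (T ! c)} \<union>
        {c \<in> {..<length T}. l + 1 \<le> tail_count (i - 1) (T ! c)})"
    unfolding col_expo_eq_1_iff using q by auto
  also have "\<dots> = {max (pattern T (i + 1) l) (pattern T (i - 1) (l + 1))..<pattern T i l}"
    unfolding nested_set_eq[OF nest] by auto
  finally show "tuple_expo n C T i l = pattern T i l - max (pattern T (i + 1) l) (pattern T (i - 1) (l + 1))"
    unfolding tuple_expo_card by simp
qed

text \<open>Every nonnegative integer Gelfand--Tsetlin pattern is a sum of 0/1 patterns, its level
  sets, and these are the columns of a tableau.\<close>

lemma ex_tuple_of_pattern: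
  fixes N :: "nat \<Rightarrow> nat \<Rightarrow> nat"
  assumes top: "\<And>l. 1 \<le> l \<Longrightarrow> l \<le> n + 1 \<Longrightarrow> N 0 l = weight_tail n lam l"
    and up: "\<And>i l. 1 \<le> l \<Longrightarrow> i + l \<le> n \<Longrightarrow> N (Suc i) l \<le> N i l"
    and down: "\<And>i l. 1 \<le> l \<Longrightarrow> i + l \<le> n \<Longrightarrow> N i (Suc l) \<le> N (Suc i) l"
  shows "\<exists>T\<in>col_tuples n (shape n lam). nested T \<and>
    (\<forall>i l. 1 \<le> l \<longrightarrow> i + l \<le> n + 1 \<longrightarrow> pattern T i l = N i l)"
proof -
  \<comment> \<open>\<open>m i c\<close> is to become the tail count of column \<open>c\<close>,
    hence \<open>R c\<close> collects the places where it drops.\<close>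
  define m where "m i c = card {l \<in> {1..n + 1 - i}. c < N i l}" for i c
  define R where "R c = {r \<in> {0..n}. m (Suc r) c < m r c}" for c
  define T where "T = map R [0..<weight_tail n lam 1]"
  have step': "N i (Suc l) \<le> N i l" if "1 \<le> l" "i + l \<le> n" for i l
    using up[OF that] down[OF that] by simp
  have anti: "N i l' \<le> N i l" if "1 \<le> l" "l \<le> l'" "l' \<le> n + 1 - i" for i l l'
    using that(2,3)
  proof (induction l' rule: dec_induct)
    case (step k)
    have "1 \<le> k" "i + k \<le> n" using step \<open>1 \<le> l\<close> by auto
    then have "N i (Suc k) \<le> N i k" by (rule step')
    also have "N i k \<le> N i l" using step by auto
    finally show ?case .
  qed simp
  have m_iff: "l \<le> m i c \<longleftrightarrow> c < N i l" if "1 \<le> l" "i + l \<le> n + 1" for i l c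
    unfolding m_def using that anti less_le_trans by (intro initial_segment_card) (blast, auto)
  have m1: "m (Suc i) c \<le> m i c" for i c
    unfolding m_def
  proof (rule card_mono)
    show "{l \<in> {1..n + 1 - Suc i}. c < N (Suc i) l} \<subseteq> {l \<in> {1..n + 1 - i}. c < N i l}"
    proof
      fix l assume l: "l \<in> {l \<in> {1..n + 1 - Suc i}. c < N (Suc i) l}"
      then have "N (Suc i) l \<le> N i l" by (intro up) auto
      then show "l \<in> {l \<in> {1..n + 1 - i}. c < N i l}" using l by auto
    qed
  qed simp
  \<comment> \<open>The second interlacing inequality, shifted by one in \<open>l\<close>, lets the
    tail count drop by at most one per step.\<close>
  have m2: "m i c \<le> Suc (m (Suc i) c)" for i c
  proof -
    let ?A = "{l \<in> {1..n + 1 - i}. c < N i l}" and ?B = "{l \<in> {1..n + 1 - Suc i}. c < N (Suc i) l}"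
    have "?A \<subseteq> insert 1 (Suc ` ?B)"
    proof
      fix l assume l: "l \<in> ?A"
      show "l \<in> insert 1 (Suc ` ?B)"
      proof (cases "l = 1")
        case False
        then obtain k where k: "l = Suc k" "1 \<le> k" using l by (cases l) auto
        then have "N i (Suc k) \<le> N (Suc i) k" using l by (intro down) auto
        then show ?thesis using l k by auto
      qed simp
    qed
    then have "card ?A \<le> card (insert 1 (Suc ` ?B))" by (rule card_mono[rotated]) simp
    also have "\<dots> \<le> Suc (card (Suc ` ?B))" by (rule card_insert_le_m1[THEN order_trans]) auto
    also have "card (Suc ` ?B) = card ?B" by (rule card_image) simp
    finally show ?thesis by (simp add: m_def)
  qed
  have Rn: "R c \<subseteq> {0..n}" for c by (auto simp: R_def)
  have finR: "finite (R c)" for c by (simp add: R_def)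
  have tc: "tail_count i (R c) = m i c" if "i \<le> n + 1" for i c
    using that
  proof (induction i rule: inc_induct)
    case base
    then show ?case using tail_count_above[OF Rn[of c], of "n + 1"] by (simp add: m_def)
  next
    case (step i)
    have "i \<in> R c \<longleftrightarrow> m (Suc i) c < m i c" using step by (simp add: R_def)
    then show ?case using tail_count_Suc[OF finR, of i c] step m1[of i c] m2[of i c] by auto
  qed
  have T_nth: "T ! c = R c" if "c < length T" for c using that by (simp add: T_def)
  have lenT: "length T = weight_tail n lam 1" by (simp add: T_def)
  have "card (R c) = shape n lam ! c" if c: "c < weight_tail n lam 1" for c
  proof -
    have "card (R c) = m 0 c" using tc[of 0 c] by simp
    also have "\<dots> = card {1..shape n lam ! c}"
      unfolding m_def using top le_shape_nth_iff[OF c] shape_nth_le[OF c]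
      by (intro arg_cong[where f = card]) fastforce
    finally show ?thesis by simp
  qed
  then have "T \<in> col_tuples n (shape n lam)"
    using Rn T_nth lenT by (simp add: col_tuples_def)
  moreover have "nested T"
    unfolding nested_def
  proof (intro allI impI)
    fix c i assume c: "Suc c < length T"
    show "tail_count i (T ! Suc c) \<le> tail_count i (T ! c)"
    proof (cases "i \<le> n + 1")
      case True
      have "m i (Suc c) \<le> m i c" unfolding m_def by (rule card_mono) auto
      then show ?thesis using T_nth c tc[OF True] by simp
    next
      case False
      then show ?thesis using tail_count_above[OF Rn, of i] T_nth c by simp
    qed
  qed
  moreover have "pattern T i l = N i l" if il: "1 \<le> l" "i + l \<le> n + 1" for i l
  proof -
    have "N i l \<le> N 0 l"
      using il(2)
    proof (induction i)
      case (Suc i)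
      then show ?case using up[OF il(1), of i] by simp
    qed simp
    also have "\<dots> \<le> weight_tail n lam 1" using top[OF il(1)] il weight_tail_antimono[OF il(1)] by simp
    finally have "{c \<in> {..<length T}. l \<le> tail_count i (T ! c)} = {..<N i l}"
      using T_nth tc[of i] m_iff[OF il] il lenT by auto
    then show ?thesis by (simp add: pattern_def)
  qed
  ultimately show ?thesis by blast
qed

text \<open>Coordinates \<open>(i, l)\<close> that match \<open>pattern T i l\<close>. The marked
  elements form row 0, with \<open>P 0\<close> at \<open>l = n + 1\<close>.\<close>

definition node :: "nat \<Rightarrow> nat \<Rightarrow> nat \<Rightarrow> gt" where
  "node n i l = (if i = 0 then P (n + 1 - l) else Q i (n + 2 - i - l))"

definition node_value :: "nat \<Rightarrow> (nat \<Rightarrow> nat \<Rightarrow> real) \<Rightarrow> gt \<Rightarrow> real" where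
  "node_value n X p = (case p of P j \<Rightarrow> X 0 (n + 1 - j) | Q i j \<Rightarrow> X i (n + 2 - i - j))"

lemma node_value_node: "i + l \<le> n + 1 \<Longrightarrow> node_value n X (node n i l) = X i l"
  by (auto simp: node_value_def node_def)

lemma node_unmarked:
  "1 \<le> i \<Longrightarrow> 1 \<le> l \<Longrightarrow> i + l \<le> n + 1 \<Longrightarrow> node n i l \<in> gt_unmarked n"
  by (auto simp: node_def gt_unmarked_def)

lemma gt_unmarkedE:
  assumes "p \<in> gt_unmarked n"
  obtains i l where "1 \<le> i" "1 \<le> l" "i + l \<le> n + 1" "p = node n i l"
proof -
  obtain i j where p: "p = Q i j" "1 \<le> i" "i \<le> n" "1 \<le> j" "j \<le> n + 1 - i"
    using assms by (auto simp: gt_unmarked_def)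
  show thesis by (rule that[of i "n + 2 - i - j"]) (use p in \<open>auto simp: node_def\<close>)
qed

lemma gt_gen_node_up:
  assumes "1 \<le> l" "i + l \<le> n"
  shows "gt_gen n (node n (Suc i) l) (node n i l)"
proof (cases "i = 0")
  case True
  then show ?thesis using gt_gen.intros(2)[of "n + 1 - l" n] assms by (auto simp: node_def)
next
  case False
  moreover have "n + 2 - i - l = (n + 1 - i - l) + 1" using assms by simp
  ultimately show ?thesis
    using gt_gen.intros(4)[of i n "n + 1 - i - l"] assms by (auto simp: node_def)
qed

lemma gt_gen_node_down:
  assumes "1 \<le> l" "i + l \<le> n"
  shows "gt_gen n (node n i (Suc l)) (node n (Suc i) l)"
proof (cases "i = 0")
  case True
  then show ?thesis using gt_gen.intros(1)[of "n + 1 - l" n] assms by (auto simp: node_def)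
next
  case False
  then show ?thesis
    using gt_gen.intros(3)[of i n "n + 1 - i - l"] assms by (auto simp: node_def)
qed

lemma gt_genE:
  assumes "gt_gen n a b"
  obtains (up) i l where "1 \<le> l" "i + l \<le> n" "a = node n (Suc i) l" "b = node n i l"
  | (down) i l where "1 \<le> l" "i + l \<le> n" "a = node n i (Suc l)" "b = node n (Suc i) l"
  using assms
proof cases
  case (1 j)
  then show ?thesis by (intro down[of "n + 1 - j" 0]) (auto simp: node_def)
next
  case (2 j)
  then show ?thesis by (intro up[of "n + 1 - j" 0]) (auto simp: node_def)
next
  case (3 i j)
  then show ?thesis by (intro down[of "n + 1 - i - j" i]) (auto simp: node_def)
next
  case (4 i j)
  then show ?thesis by (intro up[of "n + 1 - i - j" i]) (auto simp: node_def)
qed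

lemma node_eq_iff:
  assumes "i + l \<le> n + 1" "i' + l' \<le> n + 1" "1 \<le> l" "1 \<le> l'"
  shows "node n i l = node n i' l' \<longleftrightarrow> i = i' \<and> l = l'"
  using assms by (auto simp: node_def split: if_splits)

text \<open>The chain inequalities reduce to covering relations. For \<open>p \<in> C\<close> and
  any \<open>a\<close> below \<open>p\<close>, the value of \<open>X\<close> at \<open>a\<close>
  plus \<open>y p\<close> is at most the value of \<open>X\<close> at \<open>p\<close>, so the sum
  over a chain telescopes against the pattern.\<close>

lemma transfer_in_polytope:
  assumes CO: "C \<union> Or = gt_unmarked n"
    and top: "\<And>l. 1 \<le> l \<Longrightarrow> l \<le> n + 1 \<Longrightarrow> X 0 l = real (weight_tail n lam l)"
    and up: "\<And>i l. 1 \<le> l \<Longrightarrow> i + l \<le> n \<Longrightarrow> X (Suc i) l \<le> X i l"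
    and down: "\<And>i l. 1 \<le> l \<Longrightarrow> i + l \<le> n \<Longrightarrow> X i (Suc l) \<le> X (Suc i) l"
    and y0: "\<And>p. p \<notin> gt_unmarked n \<Longrightarrow> y p = 0"
    and yO: "\<And>i l. 1 \<le> i \<Longrightarrow> 1 \<le> l \<Longrightarrow> i + l \<le> n + 1 \<Longrightarrow> node n i l \<in> Or \<Longrightarrow> y (node n i l) = X i l"
    and yC0: "\<And>i l. 1 \<le> i \<Longrightarrow> 1 \<le> l \<Longrightarrow> i + l \<le> n + 1 \<Longrightarrow> node n i l \<in> C \<Longrightarrow> 0 \<le> y (node n i l)"
    and yC1: "\<And>i l. 1 \<le> l \<Longrightarrow> i + l \<le> n \<Longrightarrow> node n (Suc i) l \<in> C \<Longrightarrow>
      X i (Suc l) + y (node n (Suc i) l) \<le> X (Suc i) l"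
    and yC2: "\<And>i l. 1 \<le> i \<Longrightarrow> 1 \<le> l \<Longrightarrow> i + l \<le> n \<Longrightarrow> node n i l \<in> C \<Longrightarrow>
      X (Suc i) l + y (node n i l) \<le> X i l"
  shows "y \<in> chain_order_polytope n lam C Or"
proof -
  let ?V = "node_value n X"
  have gen: "?V a \<le> ?V b" if "gt_gen n a b" for a b
    using that by (cases rule: gt_genE) (use up down in \<open>simp_all add: node_value_node\<close>)
  have less: "?V a \<le> ?V b" if "gt_less n a b" for a b
    using that by (induction rule: tranclp_induct) (use gen in \<open>fastforce+\<close>)
  have genC: "?V a + y b \<le> ?V b" if "gt_gen n a b" "b \<in> C" for a b
    using that(1)
  proof (cases rule: gt_genE)
    case (up i l)
    have "i \<noteq> 0"
    proof
      assume "i = 0"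
      then have "b \<notin> gt_unmarked n" using up by (auto simp: node_def gt_unmarked_def)
      then show False using that CO by auto
    qed
    then show ?thesis using yC2[of i l] up that(2) by (simp add: node_value_node)
  next
    case (down i l)
    then show ?thesis using yC1[of l i] that(2) by (simp add: node_value_node)
  qed
  \<comment> \<open>Only the last covering relation below \<open>b\<close> involves
    \<open>y b\<close>; below it monotonicity of the pattern suffices.\<close>
  have lessC: "?V a + y b \<le> ?V b" if ab: "gt_less n a b" and b: "b \<in> C" for a b
  proof -
    from ab obtain c where c: "gt_gen n c b" "c = a \<or> gt_less n a c"
      by (cases rule: tranclp.cases) auto
    then have "?V a \<le> ?V c" using less by auto
    then show ?thesis using genC[OF c(1) b] by simp
  qed
  have chain: "sum_list (map y ps) \<le> ?V b - ?V a"
    if "set ps \<subseteq> C" "sorted_wrt (gt_less n) (a # ps @ [b])" for a b ps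
    using that
  proof (induction ps arbitrary: a)
    case Nil
    then show ?case using less[of a b] by simp
  next
    case (Cons p ps)
    then have "sum_list (map y ps) \<le> ?V b - ?V p" by simp
    moreover have "?V a + y p \<le> ?V p" using Cons.prems by (intro lessC) auto
    ultimately show ?case by simp
  qed
  have val: "gt_value n lam y c = ?V c" if c: "c \<in> gt_marked n \<union> Or" for c
  proof (cases "c \<in> Or")
    case True
    then obtain i l where "1 \<le> i" "1 \<le> l" "i + l \<le> n + 1" "c = node n i l"
      using CO gt_unmarkedE[of c n] by blast
    then show ?thesis
      using yO[of i l] True by (simp add: node_value_node gt_value_def) (simp add: node_def)
  next
    case False
    then obtain j where "c = P j" "j \<le> n" using c by (auto simp: gt_marked_def)
    then show ?thesis using top[of "n + 1 - j"] by (simp add: gt_value_def node_value_def marking_eq)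
  qed
  have "0 \<le> y p" if p: "p \<in> C" for p
  proof -
    obtain i l where "1 \<le> i" "1 \<le> l" "i + l \<le> n + 1" "p = node n i l"
      using CO gt_unmarkedE[of p n] p by blast
    then show ?thesis using yC0[of i l] p by simp
  qed
  then show ?thesis
    unfolding chain_order_polytope_def using y0 chain val by auto
qed

text \<open>The transfer map is solved upwards along the poset. The lower covers are
  \<open>(i + 1, l)\<close> and \<open>(i - 1, l + 1)\<close>, the first missing on the edge
  \<open>i + l = n + 1\<close>; each of them lowers \<open>i + 2 * l\<close> in no case and raises
  it by one, which gives the termination measure. The value 0 outside the triangle is a
  default.\<close>

function inverse_transfer ::
  "nat \<Rightarrow> (nat \<Rightarrow> nat) \<Rightarrow> gt set \<Rightarrow> (gt \<Rightarrow> real) \<Rightarrow> nat \<Rightarrow> nat \<Rightarrow> real"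
where
  "inverse_transfer n lam C y i l =
    (if i = 0 then real (weight_tail n lam l)
     else if n + 1 < i + l then 0
     else if node n i l \<notin> C then y (node n i l)
     else y (node n i l) +
       (if i + l \<le> n
        then max (inverse_transfer n lam C y (i + 1) l) (inverse_transfer n lam C y (i - 1) (l + 1))
        else inverse_transfer n lam C y (i - 1) (l + 1)))"
  by pat_completeness auto
termination
  by (relation "measure (\<lambda>(n, lam, C, y, i, l). 2 * n + 4 - i - 2 * l)") auto

declare inverse_transfer.simps [simp del]

section \<open>From points of the polytope back to Gelfand--Tsetlin patterns\<close>

locale polytope_point =
  fixes n :: nat and lam :: "nat \<Rightarrow> nat" and C Or :: "gt set" and y :: "gt \<Rightarrow> real"
  assumes CO: "C \<union> Or = gt_unmarked n" "C \<inter> Or = {}"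
    and y: "y \<in> chain_order_polytope n lam C Or"
begin

abbreviation "X \<equiv> inverse_transfer n lam C y"
abbreviation "V \<equiv> node_value n X"

lemma X_0: "X 0 l = real (weight_tail n lam l)"
  by (simp add: inverse_transfer.simps)

lemma X_order: "1 \<le> i \<Longrightarrow> i + l \<le> n + 1 \<Longrightarrow> node n i l \<notin> C \<Longrightarrow> X i l = y (node n i l)"
  by (subst inverse_transfer.simps) auto

lemma X_chain:
  "1 \<le> i \<Longrightarrow> i + l \<le> n + 1 \<Longrightarrow> node n i l \<in> C \<Longrightarrow> X i l = y (node n i l) +
    (if i + l \<le> n then max (X (i + 1) l) (X (i - 1) (l + 1)) else X (i - 1) (l + 1))"
  by (subst inverse_transfer.simps) auto

lemma gt_value_V:
  assumes "c \<in> gt_marked n \<union> Or"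
  shows "gt_value n lam y c = V c"
proof (cases "c \<in> Or")
  case True
  then obtain i l where il: "1 \<le> i" "1 \<le> l" "i + l \<le> n + 1" "c = node n i l"
    using CO gt_unmarkedE[of c n] by blast
  moreover have "node n i l \<notin> C" using True CO il by auto
  ultimately show ?thesis
    using X_order[of i l] by (simp add: node_value_node gt_value_def) (simp add: node_def)
next
  case False
  then obtain j where "c = P j" "j \<le> n" using assms by (auto simp: gt_marked_def)
  then show ?thesis by (simp add: gt_value_def node_value_def marking_eq X_0)
qed

lemma node_cases:
  assumes "1 \<le> l" "i + l \<le> n + 1" "node n i l \<notin> C"
  shows "node n i l \<in> gt_marked n \<union> Or"
  using assms CO node_unmarked[of i l n]
  by (cases "i = 0") (auto simp: node_def gt_marked_def)

text \<open>Unrolling the maxima in \<open>X\<close> produces a chain that attains them.\<close>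

lemma ex_attaining_chain:
  assumes "1 \<le> i" "1 \<le> l" "i + l \<le> n + 1" "node n i l \<in> C"
  shows "\<exists>a\<in>gt_marked n \<union> Or. \<exists>ps. set ps \<subseteq> C \<and> sorted_wrt (gt_less n) (a # ps @ [node n i l]) \<and>
    X i l = V a + sum_list (map y ps) + y (node n i l)"
  using assms
proof (induction "2 * n + 4 - i - 2 * l" arbitrary: i l rule: less_induct)
  case less
  obtain i' l' where il': "1 \<le> l'" "i' + l' \<le> n + 1" "gt_gen n (node n i' l') (node n i l)"
    and Xil: "X i l = y (node n i l) + X i' l'"
    and meas: "2 * n + 4 - i' - 2 * l' < 2 * n + 4 - i - 2 * l"
  proof (cases "i + l \<le> n \<and> X (i - 1) (l + 1) \<le> X (i + 1) l")
    case True
    show ?thesis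
    proof (rule that[of l "i + 1"])
      show "gt_gen n (node n (i + 1) l) (node n i l)"
        using gt_gen_node_up[of l i n] less.prems True by simp
      show "X i l = y (node n i l) + X (i + 1) l"
        using X_chain[of i l] less.prems True by (simp add: max_def)
    qed (use less.prems True in auto)
  next
    case False
    show ?thesis
    proof (rule that[of "l + 1" "i - 1"])
      show "gt_gen n (node n (i - 1) (l + 1)) (node n i l)"
        using gt_gen_node_down[of l "i - 1" n] less.prems by simp
      show "X i l = y (node n i l) + X (i - 1) (l + 1)"
        using X_chain[of i l] less.prems False by (auto simp: max_def)
    qed (use less.prems in auto)
  qed
  let ?z = "node n i' l'"
  have zp: "gt_less n ?z (node n i l)" using il'(3) by blast
  have Vz: "V ?z = X i' l'" using il' by (simp add: node_value_node)
  show ?case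
  proof (cases "?z \<in> C")
    case False
    then have "?z \<in> gt_marked n \<union> Or" using node_cases il' by blast
    then show ?thesis using zp Xil Vz by (intro bexI[of _ ?z] exI[of _ "[]"]) auto
  next
    case True
    then have "1 \<le> i'" using CO by (cases "i' = 0") (auto simp: node_def gt_unmarked_def)
    from less.hyps[OF meas this il'(1,2) True] obtain a ps where
      a: "a \<in> gt_marked n \<union> Or" and ps: "set ps \<subseteq> C" "sorted_wrt (gt_less n) (a # ps @ [?z])"
      "X i' l' = V a + sum_list (map y ps) + y ?z" by blast
    have "gt_less n x (node n i l)" if "x \<in> set (a # ps @ [?z])" for x
    proof (cases "x = ?z")
      case False
      then have "gt_less n x ?z" using ps(2) that by (auto simp: sorted_wrt_append)
      then show ?thesis using zp by (rule tranclp_trans)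
    qed (use zp in simp)
    then have "sorted_wrt (gt_less n) ((a # ps @ [?z]) @ [node n i l])"
      using ps(2) unfolding sorted_wrt_append[of _ "a # ps @ [?z]"] by auto
    then show ?thesis
      using a ps True Xil by (intro bexI[OF _ a] exI[of _ "ps @ [?z]"]) auto
  qed
qed

text \<open>For \<open>b \<in> C\<close> the maximum in the recursion and \<open>0 \<le> y b\<close>
  give this. Otherwise it is an inequality of the polytope: a chain attaining the value at
  \<open>a\<close> is prolonged to \<open>b\<close>, or the empty chain is taken if \<open>a\<close>
  is not in \<open>C\<close>.\<close>

lemma V_mono_gen:
  assumes "gt_gen n a b"
  shows "V a \<le> V b"
proof -
  have ex: "\<exists>i l. 1 \<le> l \<and> i + l \<le> n + 1 \<and> a = node n i l" "\<exists>i l. 1 \<le> l \<and> i + l \<le> n + 1 \<and> b = node n i l"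
    using assms by (cases rule: gt_genE; force)+
  then obtain i l i' l' where a: "1 \<le> l" "i + l \<le> n + 1" "a = node n i l"
    and b: "1 \<le> l'" "i' + l' \<le> n + 1" "b = node n i' l'" by blast
  have ab: "gt_less n a b" using assms by blast
  show ?thesis
  proof (cases "b \<in> C")
    case True
    then have i': "1 \<le> i'" using CO b by (cases "i' = 0") (auto simp: node_def gt_unmarked_def)
    have y0: "0 \<le> y b" using y True by (simp add: chain_order_polytope_def)
    have Vb: "V b = y b + (if i' + l' \<le> n then max (X (i' + 1) l') (X (i' - 1) (l' + 1)) else X (i' - 1) (l' + 1))"
      using X_chain[of i' l'] i' b True by (simp add: node_value_node)
    show ?thesis
      using assms
    proof (cases rule: gt_genE)
      case (up j m)
      then have "i' = j" "l' = m" using node_eq_iff[of i' l' n j m] b by auto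
      then show ?thesis using Vb y0 up by (simp add: node_value_node)
    next
      case (down j m)
      then have "i' = Suc j" "l' = m" using node_eq_iff[of i' l' n "Suc j" m] b by auto
      then show ?thesis using Vb y0 down by (simp add: node_value_node split: if_splits)
    qed
  next
    case False
    then have bM: "b \<in> gt_marked n \<union> Or" using node_cases b by blast
    have ineq: "sum_list (map y ps) \<le> V b - V c" if "c \<in> gt_marked n \<union> Or" "set ps \<subseteq> C"
      "sorted_wrt (gt_less n) (c # ps @ [b])" for c ps
      using y that bM unfolding chain_order_polytope_def
      by (auto simp: gt_value_V[OF bM, symmetric] gt_value_V[OF that(1), symmetric])
    show ?thesis
    proof (cases "a \<in> C")
      case False
      then have "a \<in> gt_marked n \<union> Or" using node_cases a by blast
      from ineq[OF this, of "[]"] show ?thesis using ab by simp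
    next
      case True
      then have "1 \<le> i" using CO a by (cases "i = 0") (auto simp: node_def gt_unmarked_def)
      from ex_attaining_chain[OF this a(1,2)] True a(3) obtain c ps where
        c: "c \<in> gt_marked n \<union> Or" and ps: "set ps \<subseteq> C" "sorted_wrt (gt_less n) (c # ps @ [a])"
        "X i l = V c + sum_list (map y ps) + y a" by blast
      have "gt_less n x b" if "x \<in> set (c # ps @ [a])" for x
      proof (cases "x = a")
        case False
        then have "gt_less n x a" using ps(2) that by (auto simp: sorted_wrt_append)
        then show ?thesis using ab by (rule tranclp_trans)
      qed (use ab in simp)
      then have "sorted_wrt (gt_less n) ((c # ps @ [a]) @ [b])"
        using ps(2) unfolding sorted_wrt_append[of _ "c # ps @ [a]"] by auto
      then have "sum_list (map y (ps @ [a])) \<le> V b - V c"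
        using ps True by (intro ineq[OF c]) auto
      then show ?thesis using ps(3) a by (simp add: node_value_node)
    qed
  qed
qed

lemma X_up: "1 \<le> l \<Longrightarrow> i + l \<le> n \<Longrightarrow> X (Suc i) l \<le> X i l"
  using V_mono_gen[OF gt_gen_node_up[of l i n]] by (simp add: node_value_node)

lemma X_down: "1 \<le> l \<Longrightarrow> i + l \<le> n \<Longrightarrow> X i (Suc l) \<le> X (Suc i) l"
  using V_mono_gen[OF gt_gen_node_down[of l i n]] by (simp add: node_value_node)

lemma X_nonneg: "1 \<le> l \<Longrightarrow> i + l \<le> n + 1 \<Longrightarrow> 0 \<le> X i l"
proof (induction i arbitrary: l)
  case (Suc i)
  have "0 \<le> X i (Suc l)" using Suc.prems by (intro Suc.IH) auto
  also have "\<dots> \<le> X (Suc i) l" using Suc.prems by (intro X_down) auto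
  finally show ?case .
qed (simp add: X_0)

lemma X_int:
  assumes "\<And>p. y p \<in> \<int>"
  shows "X i l \<in> \<int>"
proof (induction "2 * n + 4 - i - 2 * l" arbitrary: i l rule: less_induct)
  case less
  show ?case
  proof (cases "i \<noteq> 0 \<and> i + l \<le> n + 1 \<and> node n i l \<in> C")
    case False
    then show ?thesis using assms by (subst inverse_transfer.simps) auto
  next
    case True
    have "X (i + 1) l \<in> \<int>" if "i + l \<le> n"
      using less[of "i + 1" l] that by simp
    moreover have "X (i - 1) (l + 1) \<in> \<int>"
      using less[of "i - 1" "l + 1"] True by (cases "l \<le> n") auto
    ultimately show ?thesis
      using X_chain[of i l] True assms by (auto simp: max_def)
  qed
qed

end

section \<open>The bijection between tableaux and lattice points\<close>

definition tableaux :: "nat \<Rightarrow> (nat \<Rightarrow> nat) \<Rightarrow> nat set list set" where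
  "tableaux n lam = {T \<in> col_tuples n (shape n lam). nested T}"

definition tuple_point :: "nat \<Rightarrow> gt set \<Rightarrow> nat set list \<Rightarrow> gt \<Rightarrow> int" where
  "tuple_point n C T p =
    (if p \<in> gt_unmarked n then case p of P _ \<Rightarrow> 0 | Q i j \<Rightarrow> int (tuple_expo n C T i (n + 2 - i - j)) else 0)"

lemma tuple_point_node:
  assumes "1 \<le> i" "1 \<le> l" "i + l \<le> n + 1"
  shows "tuple_point n C T (node n i l) = int (tuple_expo n C T i l)"
  using node_unmarked[OF assms] assms unfolding tuple_point_def by (simp add: node_def)

lemma node_eq_Q: "1 \<le> i \<Longrightarrow> node n i l = Q i (n + 2 - i - l)"
  by (simp add: node_def)

text \<open>With \<open>j = n + 2 - i - l\<close>, the condition \<open>j \<ge> n - k + 2\<close>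
  reads \<open>i + l \<le> k\<close>. At order elements the translation is therefore the pattern
  entry at \<open>(0, i + l)\<close>.\<close>

lemma d_vec_node:
  assumes "1 \<le> i" "1 \<le> l" "i + l \<le> n + 1"
  shows "d_vec n lam Or (node n i l) = (if node n i l \<in> Or then real (weight_tail n lam (i + l)) else 0)"
proof -
  have "d_fund n Or k (node n i l) = (if node n i l \<in> Or \<and> i + l \<le> k then 1 else 0)" if "k \<le> n" for k
    using that assms by (auto simp: d_fund_def node_eq_Q)
  then have "d_vec n lam Or (node n i l) =
      (\<Sum>k=1..n. if node n i l \<in> Or \<and> i + l \<le> k then real (lam k) else 0)"
    unfolding d_vec_def by (intro sum.cong refl) auto
  also have "\<dots> = (if node n i l \<in> Or then (\<Sum>k\<in>{k \<in> {1..n}. i + l \<le> k}. real (lam k)) else 0)"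
    by (simp add: sum.inter_filter[symmetric])
  also have "{k \<in> {1..n}. i + l \<le> k} = {i + l..n}" using assms by auto
  finally show ?thesis by (simp add: weight_tail_def)
qed

lemma d_vec_off:
  assumes "Or \<subseteq> gt_unmarked n" "p \<notin> gt_unmarked n"
  shows "d_vec n lam Or p = 0"
proof -
  have "p \<notin> Or" using assms by blast
  then have "d_fund n Or k p = 0" for k by (cases p) (auto simp: d_fund_def)
  then show ?thesis by (simp add: d_vec_def)
qed

lemma tuple_point_in_lattice_points:
  assumes CO: "C \<union> Or = gt_unmarked n" "C \<inter> Or = {}" and T: "T \<in> tableaux n lam"
  shows "tuple_point n C T \<in> lattice_points n lam C Or"
proof -
  have Tc: "T \<in> col_tuples n (shape n lam)" and nest: "nested T" using T by (auto simp: tableaux_def)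
  define y where "y p = real_of_int (tuple_point n C T p) + d_vec n lam Or p" for p
  define X where "X i l = real (pattern T i l)" for i l
  have disj: "node n i l \<notin> C" if "node n i l \<in> Or" for i l using CO that by auto
  have disj': "node n i l \<notin> Or" if "node n i l \<in> C" for i l using CO that by auto
  have yO: "y (node n i l) = X i l" if il: "1 \<le> i" "1 \<le> l" "i + l \<le> n + 1" and O: "node n i l \<in> Or" for i l
  proof -
    have "tuple_expo n C T i l = pattern T i l - pattern T 0 (i + l)"
      using tuple_expo_order[OF Tc, of i l] disj[OF O] il by (simp add: node_eq_Q)
    then show ?thesis
      unfolding y_def tuple_point_node[OF il] d_vec_node[OF il] X_def
      using O pattern_ineqs(3)[OF Tc, of i l] pattern_0[OF Tc, of "i + l"] il by simp
  qed
  have yC: "y (node n i l) + real (max (pattern T (i + 1) l) (pattern T (i - 1) (l + 1))) = X i l"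
    if il: "1 \<le> i" "1 \<le> l" "i + l \<le> n + 1" and C: "node n i l \<in> C" for i l
  proof -
    have "Q i (n + 2 - i - l) \<in> C" using C il by (simp add: node_eq_Q)
    from tuple_expo_chain[OF Tc nest this il(1)] show ?thesis
      unfolding y_def tuple_point_node[OF il] d_vec_node[OF il] X_def using disj'[OF C]
      by (simp add: of_nat_diff)
  qed
  have "y \<in> chain_order_polytope n lam C Or"
  proof (rule transfer_in_polytope[OF CO(1), of X])
    show "X 0 l = real (weight_tail n lam l)" if "1 \<le> l" for l
      using pattern_0[OF Tc that] by (simp add: X_def)
    show "X (Suc i) l \<le> X i l" "X i (Suc l) \<le> X (Suc i) l" for i l
      using pattern_ineqs[OF Tc] by (auto simp: X_def)
    show "y p = 0" if "p \<notin> gt_unmarked n" for p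
      using that d_vec_off[of Or n p lam] CO by (auto simp: y_def tuple_point_def)
    show "y (node n i l) = X i l" if "1 \<le> i" "1 \<le> l" "i + l \<le> n + 1" "node n i l \<in> Or" for i l
      using yO that by blast
    show "0 \<le> y (node n i l)" if il: "1 \<le> i" "1 \<le> l" "i + l \<le> n + 1" and C: "node n i l \<in> C" for i l
      unfolding y_def tuple_point_node[OF il] d_vec_node[OF il] by simp
    show "X i (Suc l) + y (node n (Suc i) l) \<le> X (Suc i) l"
      if "1 \<le> l" "i + l \<le> n" "node n (Suc i) l \<in> C" for i l
      using yC[of "Suc i" l] that by (simp add: X_def)
    show "X (Suc i) l + y (node n i l) \<le> X i l"
      if "1 \<le> i" "1 \<le> l" "i + l \<le> n" "node n i l \<in> C" for i l
      using yC[of i l] that by (simp add: X_def)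
  qed
  moreover have "(\<lambda>p. real_of_int (tuple_point n C T p)) = (\<lambda>p. y p - d_vec n lam Or p)"
    by (simp add: y_def)
  ultimately show ?thesis
    unfolding lattice_points_def translated_polytope_def by blast
qed

lemma lattice_point_is_tuple_point:
  assumes CO: "C \<union> Or = gt_unmarked n" "C \<inter> Or = {}" and a: "a \<in> lattice_points n lam C Or"
  shows "\<exists>T\<in>tableaux n lam. a = tuple_point n C T"
proof -
  obtain y where y: "y \<in> chain_order_polytope n lam C Or"
    and ay: "(\<lambda>p. real_of_int (a p)) = (\<lambda>p. y p - d_vec n lam Or p)"
    using a by (auto simp: lattice_points_def translated_polytope_def)
  interpret polytope_point n lam C Or y using CO y by unfold_locales
  have yp: "y p = real_of_int (a p) + d_vec n lam Or p" for p using fun_cong[OF ay, of p] by simp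
  have d_int: "d_vec n lam Or p \<in> \<int>" for p
  proof (cases "p \<in> gt_unmarked n")
    case True
    then show ?thesis using d_vec_node by (auto elim!: gt_unmarkedE)
  next
    case False
    moreover have "Or \<subseteq> gt_unmarked n" using CO by blast
    ultimately show ?thesis using d_vec_off[of Or n p lam] by simp
  qed
  then have y_int: "y p \<in> \<int>" for p using yp by auto
  define N where "N i l = nat \<lfloor>X i l\<rfloor>" for i l
  have NX: "real (N i l) = X i l" if "1 \<le> l" "i + l \<le> n + 1" for i l
    using X_int[OF y_int, of i l] X_nonneg[OF that] by (auto simp: N_def elim!: Ints_cases)
  have "\<exists>T\<in>col_tuples n (shape n lam). nested T \<and>
      (\<forall>i l. 1 \<le> l \<longrightarrow> i + l \<le> n + 1 \<longrightarrow> pattern T i l = N i l)"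
  proof (rule ex_tuple_of_pattern)
    show "N 0 l = weight_tail n lam l" for l by (simp add: N_def X_0)
    show "N (Suc i) l \<le> N i l" if "1 \<le> l" "i + l \<le> n" for i l
      using X_up[OF that] by (simp add: N_def nat_mono floor_mono)
    show "N i (Suc l) \<le> N (Suc i) l" if "1 \<le> l" "i + l \<le> n" for i l
      using X_down[OF that] by (simp add: N_def nat_mono floor_mono)
  qed
  then obtain T where Tc: "T \<in> col_tuples n (shape n lam)" and nest: "nested T"
    and pat: "\<And>i l. 1 \<le> l \<Longrightarrow> i + l \<le> n + 1 \<Longrightarrow> real (pattern T i l) = X i l"
    using NX by metis
  have "a p = tuple_point n C T p" for p
  proof (cases "p \<in> gt_unmarked n")
    case False
    then have "y p = 0" "d_vec n lam Or p = 0"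
      using y d_vec_off[of Or n p lam] CO by (auto simp: chain_order_polytope_def)
    then show ?thesis using yp[of p] False by (simp add: tuple_point_def)
  next
    case True
    then obtain i l where il: "1 \<le> i" "1 \<le> l" "i + l \<le> n + 1" and p: "p = node n i l"
      by (rule gt_unmarkedE)
    have "real_of_int (a p) = real (tuple_expo n C T i l)"
    proof (cases "p \<in> C")
      case False
      then have "p \<in> Or" using True CO by auto
      then have "real_of_int (a p) = X i l - real (weight_tail n lam (i + l))"
        using yp[of p] X_order[of i l] False p il d_vec_node[OF il, of lam Or] by simp
      moreover have "tuple_expo n C T i l = pattern T i l - pattern T 0 (i + l)"
        using tuple_expo_order[OF Tc, of i l] False p il by (simp add: node_eq_Q)
      ultimately show ?thesis
        using pat[of l i] il pattern_0[OF Tc, of "i + l"] pattern_ineqs(3)[OF Tc, of i l] by simp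
    next
      case inC: True
      then have "p \<notin> Or" using CO by auto
      then have ya: "y p = real_of_int (a p)" using yp[of p] p d_vec_node[OF il, of lam Or] by simp
      have "X i l = y p + real (max (pattern T (i + 1) l) (pattern T (i - 1) (l + 1)))"
      proof (cases "i + l \<le> n")
        case True
        then show ?thesis
          using X_chain[of i l] il inC p pat[of l "i + 1"] pat[of "l + 1" "i - 1"] by simp
      next
        case False
        \<comment> \<open>On the edge of the triangle the missing lower cover corresponds to a zero
          entry, which leaves the maximum unchanged.\<close>
        then have "pattern T (i + 1) l = 0" using pattern_above[OF Tc, of "i + 1" l] il by simp
        then show ?thesis
          using X_chain[of i l] il inC p pat[of "l + 1" "i - 1"] False by simp
      qed
      moreover have "Q i (n + 2 - i - l) \<in> C" using inC p il by (simp add: node_eq_Q)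
      ultimately show ?thesis
        using tuple_expo_chain[OF Tc nest _ il(1), of l C] pat[of l i] il ya
        by (simp add: of_nat_diff)
    qed
    then show ?thesis unfolding p tuple_point_node[OF il] by linarith
  qed
  then show ?thesis using Tc nest by (intro bexI[of _ T]) (auto simp: tableaux_def)
qed

lemma lattice_points_eq:
  assumes "C \<union> Or = gt_unmarked n" "C \<inter> Or = {}"
  shows "lattice_points n lam C Or = tuple_point n C ` tableaux n lam"
  using lattice_point_is_tuple_point[OF assms] tuple_point_in_lattice_points[OF assms] by blast

lemma pattern_determines_tableau:
  assumes T: "T \<in> tableaux n lam" and T': "T' \<in> tableaux n lam"
    and pat: "\<And>i l. 1 \<le> l \<Longrightarrow> i + l \<le> n + 1 \<Longrightarrow> pattern T i l = pattern T' i l"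
  shows "T = T'"
proof (rule nth_equalityI)
  have c: "T \<in> col_tuples n (shape n lam)" "T' \<in> col_tuples n (shape n lam)" "nested T" "nested T'"
    using T T' by (auto simp: tableaux_def)
  show len: "length T = length T'" using c by (simp add: col_tuples_def)
  fix d assume d: "d < length T"
  have tc: "tail_count i (T ! d) = tail_count i (T' ! d)" for i
  proof -
    have "l \<le> tail_count i (T ! d) \<longleftrightarrow> l \<le> tail_count i (T' ! d)" for l
    proof (cases "1 \<le> l \<and> i + l \<le> n + 1")
      case True
      then show ?thesis
        using le_tail_count_iff[OF c(3) d, of l i] le_tail_count_iff[OF c(4), of d l i] d len pat[of l i]
        by simp
    next
      case False
      \<comment> \<open>For \<open>l = 0\<close> both sides hold; beyond the triangle both
        fail.\<close>
      moreover have "tail_count i (T ! d) \<le> n + 1 - i" "tail_count i (T' ! d) \<le> n + 1 - i"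
        using tail_count_le col_tuplesD(1)[OF c(1) d] col_tuplesD(1)[OF c(2)] d len by auto
      ultimately show ?thesis by auto
    qed
    then show ?thesis using order_antisym by blast
  qed
  have "i \<in> T ! d \<longleftrightarrow> i \<in> T' ! d" for i
    using tail_count_Suc[of "T ! d" i] tail_count_Suc[of "T' ! d" i] tc[of i] tc[of "Suc i"]
      col_tuplesD(2)[OF c(1) d] col_tuplesD(2)[OF c(2), of d] d len
    by (auto split: if_splits)
  then show "T ! d = T' ! d" by blast
qed

text \<open>The exponents determine the pattern through the recursion of
  \<open>inverse_transfer\<close>, hence the same induction measure; the pattern determines the
  tableau.\<close>

lemma tuple_point_inj:
  assumes "C \<subseteq> gt_unmarked n"
  shows "inj_on (tuple_point n C) (tableaux n lam)"
proof (rule inj_onI)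
  fix T T' assume T: "T \<in> tableaux n lam" and T': "T' \<in> tableaux n lam"
    and eq: "tuple_point n C T = tuple_point n C T'"
  have c: "T \<in> col_tuples n (shape n lam)" "T' \<in> col_tuples n (shape n lam)" "nested T" "nested T'"
    using T T' by (auto simp: tableaux_def)
  have expo: "tuple_expo n C T i l = tuple_expo n C T' i l" if "1 \<le> i" "1 \<le> l" "i + l \<le> n + 1" for i l
    using tuple_point_node[OF that, of C T] tuple_point_node[OF that, of C T'] eq by simp
  have "pattern T i l = pattern T' i l" if "1 \<le> l" "i + l \<le> n + 1" for i l
    using that
  proof (induction "2 * n + 4 - i - 2 * l" arbitrary: i l rule: less_induct)
    case less
    show ?case
    proof (cases "i = 0")
      case True
      then show ?thesis using pattern_0[OF c(1)] pattern_0[OF c(2)] less.prems by simp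
    next
      case False
      then have i: "1 \<le> i" by simp
      note ex = expo[OF i less.prems]
      show ?thesis
      proof (cases "Q i (n + 2 - i - l) \<in> C")
        case True
        have "pattern T (i + 1) l = pattern T' (i + 1) l"
        proof (cases "i + l \<le> n")
          case True
          then show ?thesis using less.hyps[of "i + 1" l] less.prems by simp
        next
          case False
          then have "n + 1 - (i + 1) < l" using less.prems by simp
          then show ?thesis using pattern_above[OF c(1)] pattern_above[OF c(2)] by simp
        qed
        moreover have "pattern T (i - 1) (l + 1) = pattern T' (i - 1) (l + 1)"
          using less.hyps[of "i - 1" "l + 1"] less.prems i by simp
        moreover have "pattern T i l = tuple_expo n C T i l + max (pattern T (i + 1) l) (pattern T (i - 1) (l + 1))"
          using tuple_expo_chain[OF c(1,3) True i] by (metis le_add_diff_inverse2)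
        moreover have "pattern T' i l = tuple_expo n C T' i l + max (pattern T' (i + 1) l) (pattern T' (i - 1) (l + 1))"
          using tuple_expo_chain[OF c(2,4) True i] by (metis le_add_diff_inverse2)
        ultimately show ?thesis using ex by metis
      next
        case False
        then show ?thesis
          using tuple_expo_order[OF c(1) False] tuple_expo_order[OF c(2) False] ex
            pattern_ineqs(3)[OF c(1), of i l] pattern_ineqs(3)[OF c(2), of i l]
            pattern_0[OF c(1), of "i + l"] pattern_0[OF c(2), of "i + l"] less.prems by simp
      qed
    qed
  qed
  then show "T = T'" by (rule pattern_determines_tableau[OF T T'])
qed

section \<open>The reproducing kernel of products of minors\<close>

lemma leading_minor: "set_minor {0..<k} g = row_minor k (\<lambda>i. i) g"
  unfolding set_minor_def by (rule trans[OF row_minor_cong]) (auto simp: sorted_list_of_set_range)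

abbreviation row_choices :: "nat \<Rightarrow> nat \<Rightarrow> (nat \<Rightarrow> nat) set" where
  "row_choices n k \<equiv> {0..<k} \<rightarrow>\<^sub>E {0..n}"

definition tuple_choices :: "nat \<Rightarrow> nat list \<Rightarrow> (nat \<Rightarrow> nat \<Rightarrow> nat) set" where
  "tuple_choices n ks = (\<Pi>\<^sub>E c\<in>{..<length ks}. row_choices n (ks ! c))"

definition choice_minor :: "nat list \<Rightarrow> (nat \<Rightarrow> nat \<Rightarrow> nat) \<Rightarrow> complex mat \<Rightarrow> complex" where
  "choice_minor ks \<tau> g = (\<Prod>c<length ks. row_minor (ks ! c) (\<tau> c) g)"

lemma finite_row_choices: "finite (row_choices n k)"
  by (intro finite_PiE) auto

lemma finite_tuple_choices: "finite (tuple_choices n ks)"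
  unfolding tuple_choices_def by (intro finite_PiE finite_row_choices) auto

lemma leading_minor_mult:
  assumes h: "h \<in> carrier_mat (n + 1) (n + 1)" and g: "g \<in> carrier_mat (n + 1) (n + 1)" and k: "k \<le> n + 1"
  shows "set_minor {0..<k} (h * g) =
    (\<Sum>r\<in>row_choices n k. (\<Prod>i=0..<k. h $$ (i, r i)) * row_minor k r g)"
proof -
  have "(\<Prod>i=0..<k. (h * g) $$ (i, p i)) =
      (\<Sum>r\<in>row_choices n k. (\<Prod>i=0..<k. h $$ (i, r i)) * (\<Prod>i=0..<k. g $$ (r i, p i)))"
    if p: "p permutes {0..<k}" for p
  proof -
    have "(\<Prod>i=0..<k. (h * g) $$ (i, p i)) = (\<Prod>i\<in>{0..<k}. \<Sum>m\<in>{0..n}. h $$ (i, m) * g $$ (m, p i))"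
    proof (rule prod.cong[OF refl])
      fix i assume "i \<in> {0..<k}"
      then have "i < n + 1" "p i < n + 1" using k permutes_in_image[OF p, of i] by auto
      then show "(h * g) $$ (i, p i) = (\<Sum>m\<in>{0..n}. h $$ (i, m) * g $$ (m, p i))"
        using h g by (simp add: scalar_prod_def atLeast0LessThan lessThan_Suc_atMost atLeast0AtMost
            del: sum.lessThan_Suc sum.atMost_Suc sum.op_ivl_Suc)
    qed
    then show ?thesis by (simp add: prod_sum_PiE prod.distrib)
  qed
  then have "set_minor {0..<k} (h * g) = (\<Sum>p | p permutes {0..<k}. \<Sum>r\<in>row_choices n k.
      (\<Prod>i=0..<k. h $$ (i, r i)) * (signof p * (\<Prod>i=0..<k. g $$ (r i, p i))))"
    unfolding leading_minor row_minor_leibniz by (simp add: sum_distrib_left mult_ac)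
  then show ?thesis
    unfolding row_minor_leibniz sum_distrib_left by (rule trans[OF _ sum.swap])
qed

text \<open>Summing over all row functions, not only the increasing ones, counts each minor \<open>k!\<close> times.\<close>

lemma cauchy_binet_leading:
  assumes h: "h \<in> carrier_mat (n + 1) (n + 1)" and g: "g \<in> carrier_mat (n + 1) (n + 1)" and k: "k \<le> n + 1"
  shows "fact k * set_minor {0..<k} (h * g) =
    (\<Sum>r\<in>row_choices n k. row_minor k r (transpose_mat h) * row_minor k r g)"
proof -
  have one: "(\<Sum>r\<in>row_choices n k. signof p * (\<Prod>i=0..<k. h $$ (p i, r i)) * row_minor k r g) =
      set_minor {0..<k} (h * g)" if p: "p permutes {0..<k}" for p
  proof -
    have pin: "p i < k \<longleftrightarrow> i < k" for i using permutes_in_image[OF p, of i] by simp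
    have ip: "inv_into UNIV p permutes {0..<k}" using permutes_inv[OF p] .
    have ipin: "inv_into UNIV p i < k \<longleftrightarrow> i < k" for i using permutes_in_image[OF ip, of i] by simp
    \<comment> \<open>Substituting \<open>r \<circ> p\<close> for \<open>r\<close> cancels the sign
      of \<open>p\<close> against the second minor, so all \<open>k!\<close> Leibniz terms of the
      first minor contribute equally.\<close>
    have "bij_betw (\<lambda>r. r \<circ> p) (row_choices n k) (row_choices n k)"
    proof (rule bij_betwI[of _ _ _ "\<lambda>r. r \<circ> inv_into UNIV p"])
      show "(\<lambda>r. r \<circ> p) \<in> row_choices n k \<rightarrow> row_choices n k"
        using pin by (auto simp: PiE_iff extensional_def)
      show "(\<lambda>r. r \<circ> inv_into UNIV p) \<in> row_choices n k \<rightarrow> row_choices n k"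
        using ipin by (auto simp: PiE_iff extensional_def)
    qed (use permutes_inverses[OF p] in \<open>auto simp: fun_eq_iff\<close>)
    then have "(\<Sum>r\<in>row_choices n k. signof p * (\<Prod>i=0..<k. h $$ (p i, r i)) * row_minor k r g) =
        (\<Sum>r\<in>row_choices n k. signof p * (\<Prod>i=0..<k. h $$ (p i, r (p i))) * row_minor k (\<lambda>i. r (p i)) g)"
      by (subst sum.reindex_bij_betw[symmetric]) (auto simp: o_def)
    also have "\<dots> = (\<Sum>r\<in>row_choices n k. (\<Prod>i=0..<k. h $$ (i, r i)) * row_minor k r g)"
    proof (rule sum.cong[OF refl])
      fix r
      have "(\<Prod>i=0..<k. h $$ (p i, r (p i))) = (\<Prod>i=0..<k. h $$ (i, r i))"
        using prod.permute[OF p, of "\<lambda>i. h $$ (i, r i)"] by (simp add: o_def)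
      moreover have "signof p * signof p = (1 :: complex)" by (simp add: sign_def)
      moreover have "signof p * x * (signof p * y) = (signof p * signof p) * (x * y)" for x y :: complex
        by (simp only: mult_ac)
      ultimately show "signof p * (\<Prod>i=0..<k. h $$ (p i, r (p i))) * row_minor k (\<lambda>i. r (p i)) g =
          (\<Prod>i=0..<k. h $$ (i, r i)) * row_minor k r g"
        unfolding row_minor_permute[OF p] by simp
    qed
    finally show ?thesis using leading_minor_mult[OF assms] by simp
  qed
  have tr: "row_minor k r (transpose_mat h) = (\<Sum>p | p permutes {0..<k}. signof p * (\<Prod>i=0..<k. h $$ (p i, r i)))"
    if r: "r \<in> row_choices n k" for r
    unfolding row_minor_leibniz
  proof (intro sum.cong refl arg_cong2[where f = "(*)"] prod.cong)
    fix p i assume "p \<in> {p. p permutes {0..<k}}" "i \<in> {0..<k}"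
    then have "p i < k" "i \<in> {0..<k}" using permutes_in_image[of p "{0..<k}" i] by auto
    then have "p i < n + 1" "r i < n + 1" using k PiE_mem[OF r, of i] by auto
    then show "transpose_mat h $$ (r i, p i) = h $$ (p i, r i)" using h by auto
  qed
  have "(\<Sum>r\<in>row_choices n k. row_minor k r (transpose_mat h) * row_minor k r g) =
      (\<Sum>r\<in>row_choices n k. \<Sum>p | p permutes {0..<k}. signof p * (\<Prod>i=0..<k. h $$ (p i, r i)) * row_minor k r g)"
    by (intro sum.cong refl) (simp add: tr sum_distrib_right)
  also have "\<dots> = (\<Sum>p | p permutes {0..<k}. set_minor {0..<k} (h * g))"
    by (rule trans[OF sum.swap], rule sum.cong[OF refl]) (use one in simp)
  also have "\<dots> = fact k * set_minor {0..<k} (h * g)"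
    by (simp add: card_permutations)
  finally show ?thesis by simp
qed

text \<open>For \<open>shape n lam\<close> this will be the matrix coefficient of the highest weight
  vector against the functional that is 1 on its orbit under lower unitriangular matrices.\<close>

definition base_minor :: "nat list \<Rightarrow> complex mat \<Rightarrow> complex" where
  "base_minor ks g = (\<Prod>c<length ks. set_minor {0..<ks ! c} g)"

lemma base_minor_mult:
  assumes h: "h \<in> carrier_mat (n + 1) (n + 1)" and g: "g \<in> carrier_mat (n + 1) (n + 1)"
    and ks: "\<And>c. c < length ks \<Longrightarrow> ks ! c \<le> n + 1"
  shows "(\<Prod>c<length ks. fact (ks ! c)) * base_minor ks (h * g) =
    (\<Sum>\<tau>\<in>tuple_choices n ks. choice_minor ks \<tau> (transpose_mat h) * choice_minor ks \<tau> g)"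
proof -
  have "(\<Prod>c<length ks. fact (ks ! c)) * base_minor ks (h * g) =
      (\<Prod>c\<in>{..<length ks}. \<Sum>r\<in>row_choices n (ks ! c).
        row_minor (ks ! c) r (transpose_mat h) * row_minor (ks ! c) r g)"
    unfolding base_minor_def prod.distrib[symmetric]
    using ks by (intro prod.cong refl cauchy_binet_leading[OF h g]) auto
  then show ?thesis
    by (simp add: prod_sum_PiE finite_row_choices tuple_choices_def choice_minor_def prod.distrib)
qed

lemma SL_carrier: "g \<in> SL n \<Longrightarrow> g \<in> carrier_mat (n + 1) (n + 1)"
  by (simp add: SL_def)

lemma SL_mult: "g \<in> SL n \<Longrightarrow> h \<in> SL n \<Longrightarrow> g * h \<in> SL n"
  unfolding SL_def using det_mult[of g "n + 1" h] by auto

lemma SL_one: "1\<^sub>m (n + 1) \<in> SL n"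
  unfolding SL_def by simp

lemma row_minor_map_cnj:
  assumes g: "g \<in> carrier_mat (n + 1) (n + 1)" and k: "k \<le> n + 1" and r: "\<And>i. i < k \<Longrightarrow> r i \<le> n"
  shows "row_minor k r (map_mat cnj g) = cnj (row_minor k r g)"
proof -
  have "(\<Prod>i=0..<k. map_mat cnj g $$ (r i, p i)) = (\<Prod>i=0..<k. cnj (g $$ (r i, p i)))"
    if "p permutes {0..<k}" for p
  proof (rule prod.cong[OF refl])
    fix i assume "i \<in> {0..<k}"
    then have "p i < n + 1" "r i < n + 1" using permutes_in_image[OF that, of i] k r[of i] by auto
    then show "map_mat cnj g $$ (r i, p i) = cnj (g $$ (r i, p i))" using g by auto
  qed
  then show ?thesis
    unfolding row_minor_leibniz by simp
qed

text \<open>The functions \<open>choice_minor ks \<tau>\<close> have the reproducing kernel \<open>base_minor ks (h * g)\<close>: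
  evaluated at the conjugate transpose of \<open>g'\<close> in place of \<open>h\<close> it is a positive multiple of
  \<open>\<Sum>\<tau>. cnj (choice_minor ks \<tau> g') * choice_minor ks \<tau> g\<close>.\<close>

lemma base_minor_kernel:
  assumes fin: "finite G" and G: "G \<subseteq> SL n"
    and ks: "\<And>c. c < length ks \<Longrightarrow> ks ! c \<le> n + 1"
    and zero: "\<And>h. h \<in> SL n \<Longrightarrow> (\<Sum>g\<in>G. c g * base_minor ks (h * g)) = 0"
    and \<tau>: "\<tau> \<in> tuple_choices n ks"
  shows "(\<Sum>g\<in>G. c g * choice_minor ks \<tau> g) = 0"
proof -
  define Y where "Y \<tau> = (\<Sum>g\<in>G. c g * choice_minor ks \<tau> g)" for \<tau>
  define F where "F = (\<Prod>c<length ks. fact (ks ! c) :: complex)"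
  \<comment> \<open>For \<open>h\<close> only the conjugate transposes of the matrices in the
    relation itself are inserted. Summed with the weights \<open>cnj (c g')\<close>, these equations
    become a vanishing sum of squares.\<close>
  have "(\<Sum>\<tau>\<in>tuple_choices n ks. choice_minor ks \<tau> (map_mat cnj g') * Y \<tau>) = 0" if g': "g' \<in> G" for g'
  proof -
    let ?h = "transpose_mat (map_mat cnj g')"
    have g'c: "g' \<in> carrier_mat (n + 1) (n + 1)" "det g' = 1" using g' G by (auto simp: SL_def)
    have "det (map_mat cnj g') = cnj (det g')"
    proof -
      interpret cnj_hom: comm_ring_hom cnj by unfold_locales auto
      show ?thesis by (rule cnj_hom.hom_det)
    qed
    moreover have "map_mat cnj g' \<in> carrier_mat (n + 1) (n + 1)" using g'c by simp
    ultimately have h: "?h \<in> SL n"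
      using g'c det_transpose[of "map_mat cnj g'" "n + 1"] by (auto simp: SL_def)
    have "(\<Sum>\<tau>\<in>tuple_choices n ks. choice_minor ks \<tau> (map_mat cnj g') * Y \<tau>) =
        (\<Sum>g\<in>G. c g * (\<Sum>\<tau>\<in>tuple_choices n ks. choice_minor ks \<tau> (map_mat cnj g') * choice_minor ks \<tau> g))"
      unfolding Y_def sum_distrib_left
      by (rule trans[OF sum.swap]) (simp add: mult_ac)
    also have "\<dots> = (\<Sum>g\<in>G. c g * (F * base_minor ks (?h * g)))"
    proof (intro sum.cong refl arg_cong2[where f = "(*)"])
      fix g assume "g \<in> G"
      then have g: "g \<in> carrier_mat (n + 1) (n + 1)" using G SL_carrier by blast
      show "(\<Sum>\<tau>\<in>tuple_choices n ks. choice_minor ks \<tau> (map_mat cnj g') * choice_minor ks \<tau> g) =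
          F * base_minor ks (?h * g)"
        using base_minor_mult[OF SL_carrier[OF h] g ks] by (simp add: F_def)
    qed
    also have "\<dots> = F * (\<Sum>g\<in>G. c g * base_minor ks (?h * g))"
      by (simp add: sum_distrib_left mult_ac)
    finally show ?thesis using zero[OF h] by simp
  qed
  then have "0 = (\<Sum>g'\<in>G. cnj (c g') * (\<Sum>\<tau>\<in>tuple_choices n ks. choice_minor ks \<tau> (map_mat cnj g') * Y \<tau>))"
    by simp
  also have "\<dots> = (\<Sum>\<tau>\<in>tuple_choices n ks. (\<Sum>g'\<in>G. cnj (c g') * choice_minor ks \<tau> (map_mat cnj g')) * Y \<tau>)"
    unfolding sum_distrib_left sum_distrib_right
    by (rule trans[OF sum.swap]) (simp add: mult_ac)
  also have "\<dots> = (\<Sum>\<tau>\<in>tuple_choices n ks. cnj (Y \<tau>) * Y \<tau>)"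
  proof (intro sum.cong refl arg_cong2[where f = "(*)"])
    fix \<tau> assume \<tau>: "\<tau> \<in> tuple_choices n ks"
    have "choice_minor ks \<tau> (map_mat cnj g) = cnj (choice_minor ks \<tau> g)" if "g \<in> G" for g
      unfolding choice_minor_def cnj_prod
    proof (rule prod.cong[OF refl])
      fix c assume c: "c \<in> {..<length ks}"
      then have "\<tau> c \<in> row_choices n (ks ! c)" using \<tau> by (auto simp: tuple_choices_def)
      then show "row_minor (ks ! c) (\<tau> c) (map_mat cnj g) = cnj (row_minor (ks ! c) (\<tau> c) g)"
        using ks[of c] c G that by (intro row_minor_map_cnj[of _ n]) (auto simp: SL_def)
    qed
    then show "(\<Sum>g'\<in>G. cnj (c g') * choice_minor ks \<tau> (map_mat cnj g')) = cnj (Y \<tau>)"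
      by (simp add: Y_def)
  qed
  also have "\<dots> = of_real (\<Sum>\<tau>\<in>tuple_choices n ks. (cmod (Y \<tau>))\<^sup>2)"
    by (simp add: complex_norm_square mult.commute del: of_real_power)
  finally have "of_real (\<Sum>\<tau>\<in>tuple_choices n ks. (cmod (Y \<tau>))\<^sup>2) = (0 :: complex)" by simp
  then have "(\<Sum>\<tau>\<in>tuple_choices n ks. (cmod (Y \<tau>))\<^sup>2) = 0" by (simp only: of_real_eq_0_iff)
  then have "(cmod (Y \<tau>))\<^sup>2 = 0"
    using sum_nonneg_eq_0_iff[OF finite_tuple_choices, of n ks "\<lambda>\<tau>. (cmod (Y \<tau>))\<^sup>2"] \<tau> by simp
  then show ?thesis by (simp add: Y_def)
qed

lemma choice_minor_of_tuple:
  assumes "T \<in> col_tuples n ks"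
  obtains \<tau> where "\<tau> \<in> tuple_choices n ks" "\<And>g. choice_minor ks \<tau> g = tuple_minor T g"
proof
  define \<tau> where "\<tau> = restrict (\<lambda>c. restrict (\<lambda>i. sorted_list_of_set (T ! c) ! i) {0..<ks ! c}) {..<length ks}"
  have len: "length T = length ks" using assms by (simp add: col_tuples_def)
  show "\<tau> \<in> tuple_choices n ks"
    unfolding tuple_choices_def
  proof (rule PiE_I)
    fix c assume c: "c \<in> {..<length ks}"
    have "bij_betw (\<lambda>i. sorted_list_of_set (T ! c) ! i) {0..<ks ! c} (T ! c)"
      using bij_betw_sorted_list_nth[of "T ! c"] col_tuplesD[OF assms, of c] c len by simp
    then have "sorted_list_of_set (T ! c) ! i \<in> {0..n}" if "i < ks ! c" for i
      using bij_betwE col_tuplesD(1)[OF assms, of c] c len that by fastforce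
    then show "\<tau> c \<in> row_choices n (ks ! c)" using c by (auto simp: \<tau>_def)
  qed (simp add: \<tau>_def)
  show "choice_minor ks \<tau> g = tuple_minor T g" for g
    unfolding choice_minor_def tuple_minor_def len
  proof (rule prod.cong[OF refl])
    fix c assume "c \<in> {..<length ks}"
    then show "row_minor (ks ! c) (\<tau> c) g = set_minor (T ! c) g"
      using col_tuplesD(3)[OF assms, of c] len
      by (auto simp: set_minor_def \<tau>_def intro!: row_minor_cong)
  qed
qed

lemma tuple_of_choice_minor:
  assumes \<tau>: "\<tau> \<in> tuple_choices n ks"
  shows "(\<forall>g. choice_minor ks \<tau> g = 0) \<or>
    (\<exists>T\<in>col_tuples n ks. \<exists>\<epsilon>. \<forall>g. choice_minor ks \<tau> g = \<epsilon> * tuple_minor T g)"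
proof (cases "\<forall>c<length ks. inj_on (\<tau> c) {0..<ks ! c}")
  case False
  then obtain c i j where c: "c < length ks" "i < ks ! c" "j < ks ! c" "i \<noteq> j" "\<tau> c i = \<tau> c j"
    by (auto simp: inj_on_def)
  have "choice_minor ks \<tau> g = 0" for g
    unfolding choice_minor_def using c row_minor_repeated[OF c(2-5)] by (intro prod_zero) auto
  then show ?thesis by blast
next
  case True
  define T where "T = map (\<lambda>c. \<tau> c ` {0..<ks ! c}) [0..<length ks]"
  have Tc: "T ! c = \<tau> c ` {0..<ks ! c}" if "c < length ks" for c using that by (simp add: T_def)
  have len: "length T = length ks" by (simp add: T_def)
  have "T \<in> col_tuples n ks"
    unfolding col_tuples_def
  proof (intro CollectI conjI allI impI len)
    fix c assume c: "c < length ks"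
    then have "\<tau> c \<in> row_choices n (ks ! c)" using \<tau> by (auto simp: tuple_choices_def)
    then show "T ! c \<subseteq> {0..n}" using c by (auto simp: Tc)
    show "card (T ! c) = ks ! c" using True c by (simp add: Tc card_image)
  qed
  moreover have "\<forall>c\<in>{..<length ks}. \<exists>\<epsilon>. \<forall>g. row_minor (ks ! c) (\<tau> c) g = \<epsilon> * set_minor (T ! c) g"
    using row_minor_eq_set_minor True Tc by (metis bij_betw_def lessThan_iff)
  then obtain \<epsilon> where "\<And>c g. c < length ks \<Longrightarrow> row_minor (ks ! c) (\<tau> c) g = \<epsilon> c * set_minor (T ! c) g"
    by (metis lessThan_iff)
  then have "\<forall>g. choice_minor ks \<tau> g = (\<Prod>c<length ks. \<epsilon> c) * tuple_minor T g"
    unfolding choice_minor_def tuple_minor_def len prod.distrib[symmetric] by (auto intro!: prod.cong)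
  ultimately show ?thesis by blast
qed

section \<open>The big cell\<close>

definition polyfun :: "(complex \<Rightarrow> complex) \<Rightarrow> bool" where
  "polyfun f \<longleftrightarrow> (\<exists>p. \<forall>z. f z = poly p z)"

lemma polyfun_const [simp]: "polyfun (\<lambda>_. a)"
  unfolding polyfun_def by (intro exI[of _ "[:a:]"]) simp

lemma polyfun_id [simp]: "polyfun (\<lambda>z. z)"
  unfolding polyfun_def by (intro exI[of _ "[:0, 1:]"]) simp

lemma polyfun_add: "polyfun f \<Longrightarrow> polyfun g \<Longrightarrow> polyfun (\<lambda>z. f z + g z)"
  unfolding polyfun_def by (metis poly_add)

lemma polyfun_mult: "polyfun f \<Longrightarrow> polyfun g \<Longrightarrow> polyfun (\<lambda>z. f z * g z)"
  unfolding polyfun_def by (metis poly_mult)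

lemma polyfun_diff: "polyfun f \<Longrightarrow> polyfun g \<Longrightarrow> polyfun (\<lambda>z. f z - g z)"
  unfolding polyfun_def by (metis poly_diff)

lemma polyfun_tendsto: "polyfun f \<Longrightarrow> (f \<longlongrightarrow> f a) (at a)"
  unfolding polyfun_def by (metis (mono_tags, lifting) isCont_def poly_isCont tendsto_cong always_eventually)

lemma polyfun_finite_zeros:
  assumes "polyfun f" "f a \<noteq> 0"
  shows "finite {z. f z = 0}"
proof -
  obtain p where p: "\<forall>z. f z = poly p z" using assms by (auto simp: polyfun_def)
  then have "p \<noteq> 0" using assms(2) by auto
  from poly_roots_finite[OF this] show ?thesis using p by simp
qed

lemma polynomial_fn_polyfun:
  assumes "polynomial_fn m p" "\<And>r c. r < m \<Longrightarrow> c < m \<Longrightarrow> polyfun (\<lambda>z. M z $$ (r, c))"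
  shows "polyfun (\<lambda>z. p (M z))"
  using assms(1) by induction (auto intro: polyfun_add polyfun_mult assms(2))

lemma polynomial_fn_tendsto:
  assumes "polynomial_fn m p" "\<And>r c. r < m \<Longrightarrow> c < m \<Longrightarrow> ((\<lambda>z. M z $$ (r, c)) \<longlongrightarrow> g $$ (r, c)) F"
  shows "((\<lambda>z. p (M z)) \<longlongrightarrow> p g) F"
  using assms(1) by induction (auto intro: tendsto_add tendsto_mult assms(2))

lemma polynomial_fn_sum:
  "(\<And>x. x \<in> A \<Longrightarrow> polynomial_fn m (f x)) \<Longrightarrow> polynomial_fn m (\<lambda>g. \<Sum>x\<in>A. f x g)"
  by (induction A rule: infinite_finite_induct) (auto intro: polynomial_fn.intros)

lemma polynomial_fn_prod:
  "(\<And>x. x \<in> A \<Longrightarrow> polynomial_fn m (f x)) \<Longrightarrow> polynomial_fn m (\<lambda>g. \<Prod>x\<in>A. f x g)"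
  by (induction A rule: infinite_finite_induct) (auto intro: polynomial_fn.intros)

lemma polynomial_fn_row_minor:
  assumes "k \<le> m" "\<And>i. i < k \<Longrightarrow> r i < m"
  shows "polynomial_fn m (row_minor k r)"
proof -
  have "polynomial_fn m (\<lambda>g. \<Prod>i=0..<k. g $$ (r i, p i))" if p: "p permutes {0..<k}" for p
  proof (rule polynomial_fn_prod)
    fix i assume "i \<in> {0..<k}"
    then have "p i < m" "r i < m" using permutes_in_image[OF p, of i] assms by auto
    then show "polynomial_fn m (\<lambda>g. g $$ (r i, p i))" by (intro polynomial_fn.entry)
  qed
  then show ?thesis
    unfolding row_minor_leibniz[abs_def]
    by (intro polynomial_fn_sum polynomial_fn.mult polynomial_fn.const) auto
qed

lemma polynomial_fn_base_minor:
  assumes "\<And>c. c < length ks \<Longrightarrow> ks ! c \<le> m"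
  shows "polynomial_fn m (base_minor ks)"
proof -
  have "polynomial_fn m (\<lambda>g. row_minor (ks ! c) (\<lambda>i. i) g)" if "c < length ks" for c
    using polynomial_fn_row_minor[of "ks ! c" m "\<lambda>i. i"] assms[OF that] by auto
  then show ?thesis
    unfolding base_minor_def[abs_def] leading_minor by (intro polynomial_fn_prod) auto
qed

text \<open>The products of a lower unitriangular and an upper triangular matrix, described by
  leading minors. The minor of size \<open>n + 1\<close> is the determinant, which is 1.\<close>

definition big_cell :: "nat \<Rightarrow> complex mat set" where
  "big_cell n = {g \<in> SL n. \<forall>k\<le>n. set_minor {0..<k} g \<noteq> 0}"

lemma det_eq_row_minor: "g \<in> carrier_mat m m \<Longrightarrow> det g = row_minor m (\<lambda>i. i) g"
  unfolding row_minor_def by (rule arg_cong[where f = det]) (auto intro!: eq_matI)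

text \<open>Density of the big cell: join \<open>g\<close> to the identity by a line, rescale the last row to
  restore determinant 1, and let the parameter tend to the end of the line.\<close>

lemma polynomial_fn_eq_on_SL:
  assumes p: "polynomial_fn (n + 1) p" and q: "polynomial_fn (n + 1) q"
    and eq: "\<And>g. g \<in> big_cell n \<Longrightarrow> p g = q g" and g: "g \<in> SL n"
  shows "p g = q g"
proof -
  have gc: "g \<in> carrier_mat (n + 1) (n + 1)" and dg: "det g = 1" using g by (auto simp: SL_def)
  define A where "A z = mat (n + 1) (n + 1) (\<lambda>(i, j). (if i = j then 1 - z else 0) + z * g $$ (i, j))" for z
  define d where "d z = row_minor (n + 1) (\<lambda>i. i) (A z)" for z
  \<comment> \<open>The last row occurs in no leading minor of size at most \<open>n\<close>, so the
    rescaling affects the determinant alone.\<close>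
  define M where "M z = mat (n + 1) (n + 1)
    (\<lambda>(i, j). (if i = n then inverse (d z) else 1) * A z $$ (i, j))" for z
  have A_entry: "polyfun (\<lambda>z. A z $$ (i, j))" if "i < n + 1" "j < n + 1" for i j
  proof -
    have "polyfun (\<lambda>z. (if i = j then 1 - z else 0) + z * g $$ (i, j))"
      using polyfun_diff[of "\<lambda>_. 1" "\<lambda>z. z"]
      by (cases "i = j") (auto intro!: polyfun_add polyfun_mult)
    then show ?thesis using that by (simp add: A_def cong: if_cong)
  qed
  have minor_poly: "polyfun (\<lambda>z. row_minor k (\<lambda>i. i) (A z))" if "k \<le> n + 1" for k
    using polynomial_fn_polyfun[OF polynomial_fn_row_minor[OF that, of "\<lambda>i. i"], of A] A_entry that by auto
  have A0: "A 0 = 1\<^sub>m (n + 1)" by (rule eq_matI) (auto simp: A_def)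
  have A1: "A 1 = g" using gc by (intro eq_matI) (auto simp: A_def)
  have at0: "row_minor k (\<lambda>i. i) (A 0) = 1" if "k \<le> n + 1" for k
    using set_minor_initial_one[OF that] by (simp add: A0 leading_minor)
  have d1: "d 1 = 1" using det_eq_row_minor[OF gc] dg by (simp add: d_def A1)
  \<comment> \<open>Each leading minor is a polynomial in \<open>z\<close> with value 1 at
    \<open>z = 0\<close>, so the exceptional parameters are finite in number.\<close>
  define Z where "Z = (\<Union>k\<in>{0..n + 1}. {z. row_minor k (\<lambda>i. i) (A z) = 0})"
  have "finite Z"
    unfolding Z_def
  proof (intro finite_UN_I)
    fix k assume "k \<in> {0..n + 1}"
    then show "finite {z. row_minor k (\<lambda>i. i) (A z) = 0}"
      using polyfun_finite_zeros[OF minor_poly, of k 0] at0[of k] by simp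
  qed simp
  then have "eventually (\<lambda>z. z \<notin> Z) (at 1)"
  proof -
    have "open (- (Z - {1}))" using \<open>finite Z\<close> by (intro open_Compl finite_imp_closed) auto
    then have "eventually (\<lambda>z. z \<in> - (Z - {1})) (at 1)"
      by (intro eventually_at_in_open') auto
    then show ?thesis
      using eventually_neq_at_within[of 1 1 UNIV] by eventually_elim auto
  qed
  moreover have "p (M z) = q (M z)" if z: "z \<notin> Z" for z
  proof (rule eq)
    have nz: "row_minor k (\<lambda>i. i) (A z) \<noteq> 0" if "k \<le> n + 1" for k using z that by (auto simp: Z_def)
    have Mc: "M z \<in> carrier_mat (n + 1) (n + 1)" by (simp add: M_def)
    have "row_minor (n + 1) (\<lambda>i. i) (M z) =
        (\<Prod>i=0..<n + 1. if i = n then inverse (d z) else 1) * row_minor (n + 1) (\<lambda>i. i) (A z)"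
      by (rule row_minor_row_scale) (simp add: M_def)
    also have "\<dots> = 1" using nz[of "n + 1"] by (simp add: d_def)
    finally have "det (M z) = 1" using det_eq_row_minor[OF Mc] by simp
    moreover have "set_minor {0..<k} (M z) \<noteq> 0" if "k \<le> n" for k
    proof -
      have "row_minor k (\<lambda>i. i) (M z) = row_minor k (\<lambda>i. i) (A z)"
        by (rule row_minor_cong) (use that in \<open>simp add: M_def\<close>)
      then show ?thesis using nz[of k] that by (simp add: leading_minor)
    qed
    ultimately show "M z \<in> big_cell n" using Mc by (simp add: big_cell_def SL_def)
  qed
  ultimately have ev: "eventually (\<lambda>z. p (M z) = q (M z)) (at 1)"
    by (simp add: eventually_mono)
  have entries: "((\<lambda>z. M z $$ (i, j)) \<longlongrightarrow> g $$ (i, j)) (at 1)" if ij: "i < n + 1" "j < n + 1" for i j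
  proof -
    have "((\<lambda>z. A z $$ (i, j)) \<longlongrightarrow> g $$ (i, j)) (at 1)"
      using polyfun_tendsto[OF A_entry[OF ij], of 1] by (simp add: A1)
    moreover have "(d \<longlongrightarrow> 1) (at 1)"
      using polyfun_tendsto[OF minor_poly[of "n + 1"], of 1] d1 by (simp add: d_def[abs_def])
    then have "((\<lambda>z. if i = n then inverse (d z) else 1) \<longlongrightarrow> 1) (at 1)"
      by (cases "i = n") (use tendsto_inverse[of d 1 "at 1"] in auto)
    ultimately have "((\<lambda>z. (if i = n then inverse (d z) else 1) * A z $$ (i, j)) \<longlongrightarrow>
        1 * g $$ (i, j)) (at 1)"
      by (intro tendsto_mult)
    then show ?thesis using ij by (simp add: M_def)
  qed
  have "((\<lambda>z. p (M z)) \<longlongrightarrow> p g) (at 1)" by (rule polynomial_fn_tendsto[OF p entries])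
  moreover have "((\<lambda>z. q (M z)) \<longlongrightarrow> q g) (at 1)" by (rule polynomial_fn_tendsto[OF q entries])
  then have "((\<lambda>z. p (M z)) \<longlongrightarrow> q g) (at 1)"
    using tendsto_cong[OF ev] by blast
  ultimately show ?thesis by (intro tendsto_unique[of "at (1::complex)"]) auto
qed

section \<open>Factorization on the big cell and contraction by a torus\<close>

definition lower_unitriangular :: "nat \<Rightarrow> complex mat \<Rightarrow> bool" where
  "lower_unitriangular n u \<longleftrightarrow> u \<in> carrier_mat (n + 1) (n + 1) \<and> (\<forall>i\<le>n. u $$ (i, i) = 1) \<and>
    (\<forall>i j. i < j \<longrightarrow> j \<le> n \<longrightarrow> u $$ (i, j) = 0)"

lemma set_minor_lower_unitriangular:
  assumes "lower_unitriangular n u" "k \<le> n + 1"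
  shows "set_minor {0..<k} u = 1"
proof -
  have "det (mat k k (\<lambda>(i, j). u $$ (i, j))) = prod_list (diag_mat (mat k k (\<lambda>(i, j). u $$ (i, j))))"
    by (rule det_lower_triangular[of k]) (use assms in \<open>auto simp: lower_unitriangular_def\<close>)
  also have "\<dots> = 1"
    unfolding prod_list_diag_prod using assms by (auto simp: lower_unitriangular_def intro!: prod.neutral)
  finally show ?thesis by (simp add: leading_minor row_minor_def)
qed

lemma lower_unitriangular_SL: "lower_unitriangular n u \<Longrightarrow> u \<in> SL n"
  using set_minor_lower_unitriangular[of n u "n + 1"] det_eq_row_minor[of u "n + 1"]
  by (auto simp: SL_def lower_unitriangular_def leading_minor)

text \<open>The first \<open>k\<close> columns of \<open>c\<close> vanish below the leading block,
  so leading blocks multiply.\<close>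

lemma set_minor_mult_upper:
  assumes g: "g \<in> carrier_mat (n + 1) (n + 1)" and c: "c \<in> carrier_mat (n + 1) (n + 1)"
    and up: "upper_triangular c" and k: "k \<le> n + 1"
  shows "set_minor {0..<k} (g * c) = set_minor {0..<k} g * (\<Prod>r<k. c $$ (r, r))"
proof -
  let ?sub = "\<lambda>h. mat k k (\<lambda>(i, j). h $$ (i, j))"
  have "?sub (g * c) = ?sub g * ?sub c"
  proof (rule eq_matI)
    fix i j assume "i < dim_row (?sub g * ?sub c)" "j < dim_col (?sub g * ?sub c)"
    then have ij: "i < k" "j < k" by auto
    have "(g * c) $$ (i, j) = (\<Sum>m\<in>{0..<n + 1}. g $$ (i, m) * c $$ (m, j))"
      using g c ij k by (auto simp: scalar_prod_def simp del: sum.op_ivl_Suc)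
    also have "\<dots> = (\<Sum>m\<in>{0..<k}. g $$ (i, m) * c $$ (m, j))"
    proof (rule sum.mono_neutral_right)
      show "\<forall>m\<in>{0..<n + 1} - {0..<k}. g $$ (i, m) * c $$ (m, j) = 0"
      proof
        fix m assume "m \<in> {0..<n + 1} - {0..<k}"
        then have "c $$ (m, j) = 0" using upper_triangularD[OF up, of j m] ij c by auto
        then show "g $$ (i, m) * c $$ (m, j) = 0" by simp
      qed
    qed (use k in auto)
    finally show "?sub (g * c) $$ (i, j) = (?sub g * ?sub c) $$ (i, j)"
      using ij by (simp add: scalar_prod_def)
  qed auto
  then have "det (?sub (g * c)) = det (?sub g) * det (?sub c)"
    using det_mult[of "?sub g" k "?sub c"] by simp
  moreover have "det (?sub c) = (\<Prod>r<k. c $$ (r, r))"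
  proof -
    have "upper_triangular (?sub c)" using upper_triangularD[OF up] c k by (intro upper_triangularI) auto
    then have "det (?sub c) = prod_list (diag_mat (?sub c))" by (rule det_upper_triangular) auto
    then show ?thesis unfolding prod_list_diag_prod by (simp add: atLeast0LessThan)
  qed
  ultimately show ?thesis by (simp add: leading_minor row_minor_def)
qed

lemma shape_le: "c < length (shape n lam) \<Longrightarrow> shape n lam ! c \<le> n + 1"
  using shape_nth_le[of c n lam] by simp

lemma base_minor_shape:
  "base_minor (shape n lam) g = (\<Prod>k=1..n. set_minor {0..<k} g ^ lam k)"
  unfolding base_minor_def by (rule prod_shape)

lemma base_minor_mult_upper:
  assumes "g \<in> SL n" "c \<in> SL n" "upper_triangular c"
  shows "base_minor (shape n lam) (g * c) = base_minor (shape n lam) g * weight_character n lam c"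
  unfolding base_minor_shape weight_character_def fund_character_def prod.distrib[symmetric]
    power_mult_distrib[symmetric]
  using set_minor_mult_upper[OF SL_carrier[OF assms(1)] SL_carrier[OF assms(2)] assms(3)]
  by (intro prod.cong refl) auto

lemma base_minor_lower_unitriangular:
  "lower_unitriangular n u \<Longrightarrow> base_minor (shape n lam) u = 1"
  unfolding base_minor_shape using set_minor_lower_unitriangular[of n u] by auto

text \<open>Column \<open>j\<close> of \<open>c\<close> is the last column of the inverse of the
  leading block of size \<open>j + 1\<close>. This produces the zeros of \<open>g * c\<close> above
  the diagonal and the ones on it; then \<open>det c = 1\<close> follows by
  multiplicativity.\<close>

lemma big_cell_factor:
  assumes "g \<in> big_cell n"
  obtains c where "c \<in> SL n" "upper_triangular c" "lower_unitriangular n (g * c)"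
proof -
  have g: "g \<in> carrier_mat (n + 1) (n + 1)" "det g = 1" using assms by (auto simp: big_cell_def SL_def)
  let ?G = "\<lambda>j. mat (Suc j) (Suc j) (\<lambda>(i, m). g $$ (i, m))"
  have "\<exists>B\<in>carrier_mat (Suc j) (Suc j). ?G j * B = 1\<^sub>m (Suc j)" if "j \<le> n" for j
  proof -
    have "set_minor {0..<Suc j} g \<noteq> 0"
    proof (cases "j = n")
      case True
      then show ?thesis using det_eq_row_minor[OF g(1)] g(2) by (simp add: leading_minor)
    next
      case False
      then show ?thesis using assms that by (auto simp: big_cell_def)
    qed
    then have "det (?G j) \<noteq> 0" by (simp add: leading_minor row_minor_def)
    from det_non_zero_imp_unit[OF mat_carrier this, of undefined] show ?thesis
      unfolding Units_def ring_mat_def by auto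
  qed
  then obtain B where B: "\<And>j. j \<le> n \<Longrightarrow> B j \<in> carrier_mat (Suc j) (Suc j)"
    "\<And>j. j \<le> n \<Longrightarrow> ?G j * B j = 1\<^sub>m (Suc j)" by metis
  define c where "c = mat (n + 1) (n + 1) (\<lambda>(i, j). if i \<le> j then B j $$ (i, j) else 0)"
  have c: "c \<in> carrier_mat (n + 1) (n + 1)" by (simp add: c_def)
  have up: "upper_triangular c" by (auto simp: c_def)
  have entry: "(g * c) $$ (i, j) = (if i = j then 1 else 0)" if ij: "i \<le> j" "j \<le> n" for i j
  proof -
    have "(g * c) $$ (i, j) = (\<Sum>m\<in>{0..<n + 1}. g $$ (i, m) * c $$ (m, j))"
      using g c ij by (auto simp: scalar_prod_def simp del: sum.op_ivl_Suc)
    also have "\<dots> = (\<Sum>m\<in>{0..<Suc j}. g $$ (i, m) * c $$ (m, j))"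
      using ij by (intro sum.mono_neutral_right) (auto simp: c_def)
    also have "\<dots> = (\<Sum>m\<in>{0..<Suc j}. ?G j $$ (i, m) * B j $$ (m, j))"
      using ij by (intro sum.cong refl) (auto simp: c_def)
    also have "\<dots> = (?G j * B j) $$ (i, j)"
      using ij B(1)[OF ij(2)] by (auto simp: scalar_prod_def simp del: sum.op_ivl_Suc)
    finally show ?thesis using B(2)[OF ij(2)] ij by simp
  qed
  have gc: "g * c \<in> carrier_mat (n + 1) (n + 1)" using g c by (intro mult_carrier_mat)
  have low: "lower_unitriangular n (g * c)"
    unfolding lower_unitriangular_def using gc entry by auto
  then have "det (g * c) = 1" using lower_unitriangular_SL by (auto simp: SL_def)
  then have "det c = 1" using det_mult[OF g(1) c] g(2) by simp
  then have "c \<in> SL n" using c by (simp add: SL_def)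
  then show thesis using up low by (rule that)
qed

text \<open>The exponents of \<open>w\<close> increase along the diagonal, the one at 0 being fixed
  by determinant 1. Conjugation thus multiplies every entry below the diagonal by a positive power
  of \<open>w\<close>; \<open>contracted\<close> writes out the result as a polynomial in
  \<open>w\<close>, so that the limit at 0 can be taken.\<close>

definition torus :: "nat \<Rightarrow> complex \<Rightarrow> complex mat" where
  "torus n w = mat (n + 1) (n + 1) (\<lambda>(i, j). if i = j then if i = 0 then inverse (w ^ (\<Sum>r=1..n. r)) else w ^ i else 0)"

definition contracted :: "nat \<Rightarrow> complex mat \<Rightarrow> complex \<Rightarrow> complex mat" where
  "contracted n u w = mat (n + 1) (n + 1) (\<lambda>(i, j). if i < j then 0
     else if i = j then 1 else u $$ (i, j) * w ^ (if j = 0 then i + (\<Sum>r=1..n. r) else i - j))"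

lemma torus_upper: "upper_triangular (torus n w)"
  by (auto simp: torus_def)

lemma torus_SL:
  assumes "w \<noteq> 0"
  shows "torus n w \<in> SL n"
proof -
  have c: "torus n w \<in> carrier_mat (n + 1) (n + 1)" by (simp add: torus_def)
  have "det (torus n w) = (\<Prod>i=0..<n + 1. torus n w $$ (i, i))"
    using det_upper_triangular[OF torus_upper c] prod_list_diag_prod[of "torus n w"]
    by (simp add: torus_def)
  also have "\<dots> = (\<Prod>i\<in>insert 0 {1..n}. torus n w $$ (i, i))"
    by (rule prod.cong) auto
  also have "\<dots> = inverse (w ^ (\<Sum>r=1..n. r)) * (\<Prod>i=1..n. w ^ i)"
    by (subst prod.insert) (auto simp: torus_def intro!: prod.cong)
  also have "\<dots> = 1" using assms by (simp add: power_sum)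
  finally show ?thesis using c by (simp add: SL_def)
qed

lemma contracted_lower_unitriangular: "lower_unitriangular n (contracted n u w)"
  by (auto simp: lower_unitriangular_def contracted_def)

lemma torus_mult:
  assumes u: "lower_unitriangular n u" and w: "w \<noteq> 0"
  shows "torus n w * u = contracted n u w * torus n w"
proof (rule eq_matI)
  have uc: "u \<in> carrier_mat (n + 1) (n + 1)" using u by (simp add: lower_unitriangular_def)
  fix i j assume "i < dim_row (contracted n u w * torus n w)" "j < dim_col (contracted n u w * torus n w)"
  then have ij: "i < n + 1" "j < n + 1" by (auto simp: contracted_def torus_def)
  have "(torus n w * u) $$ (i, j) = (\<Sum>m\<in>{0..<n + 1}. torus n w $$ (i, m) * u $$ (m, j))"
    using ij uc by (auto simp: scalar_prod_def torus_def simp del: sum.op_ivl_Suc)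
  also have "\<dots> = (\<Sum>m\<in>{i}. torus n w $$ (i, m) * u $$ (m, j))"
    using ij by (intro sum.mono_neutral_right) (auto simp: torus_def)
  finally have 1: "(torus n w * u) $$ (i, j) = torus n w $$ (i, i) * u $$ (i, j)" by simp
  have "(contracted n u w * torus n w) $$ (i, j) = (\<Sum>m\<in>{0..<n + 1}. contracted n u w $$ (i, m) * torus n w $$ (m, j))"
    using ij by (auto simp: scalar_prod_def torus_def contracted_def simp del: sum.op_ivl_Suc)
  also have "\<dots> = (\<Sum>m\<in>{j}. contracted n u w $$ (i, m) * torus n w $$ (m, j))"
    using ij by (intro sum.mono_neutral_right) (auto simp: torus_def)
  finally have 2: "(contracted n u w * torus n w) $$ (i, j) = contracted n u w $$ (i, j) * torus n w $$ (j, j)"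
    by simp
  consider "i < j" | "i = j" | "j < i" "j = 0" | "j < i" "j \<noteq> 0" by linarith
  then show "(torus n w * u) $$ (i, j) = (contracted n u w * torus n w) $$ (i, j)"
    unfolding 1 2
  proof cases
    case 1
    then show "torus n w $$ (i, i) * u $$ (i, j) = contracted n u w $$ (i, j) * torus n w $$ (j, j)"
      using u ij by (simp add: lower_unitriangular_def contracted_def)
  next
    case 2
    then show "torus n w $$ (i, i) * u $$ (i, j) = contracted n u w $$ (i, j) * torus n w $$ (j, j)"
      using u ij by (simp add: lower_unitriangular_def contracted_def)
  next
    case 3
    then show "torus n w $$ (i, i) * u $$ (i, j) = contracted n u w $$ (i, j) * torus n w $$ (j, j)"
      using ij w by (simp add: contracted_def torus_def power_add)
  next
    case 4
    then have "w ^ (i - j) * w ^ j = w ^ i" by (simp flip: power_add)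
    with 4 show "torus n w $$ (i, i) * u $$ (i, j) = contracted n u w $$ (i, j) * torus n w $$ (j, j)"
      using ij by (simp add: contracted_def torus_def)
  qed
qed (use u in \<open>auto simp: torus_def contracted_def lower_unitriangular_def\<close>)

lemma contracted_tendsto:
  assumes "i < n + 1" "j < n + 1"
  shows "((\<lambda>w. contracted n u w $$ (i, j)) \<longlongrightarrow> 1\<^sub>m (n + 1) $$ (i, j)) (at 0)"
proof (cases "j < i")
  case True
  let ?e = "if j = 0 then i + (\<Sum>r=1..n. r) else i - j"
  have "?e > 0" using True by auto
  have "((\<lambda>w. u $$ (i, j) * w ^ ?e) \<longlongrightarrow> u $$ (i, j) * 0 ^ ?e) (at 0)"
    by (intro tendsto_intros)
  then show ?thesis using True assms \<open>?e > 0\<close> by (simp add: contracted_def zero_power)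
next
  case False
  then show ?thesis using assms by (auto simp: contracted_def)
qed

section \<open>Functionals on the module\<close>

lemma vector_space_complex_mult: "vector_space ((*) :: complex \<Rightarrow> complex \<Rightarrow> complex)"
  by unfold_locales (auto simp: algebra_simps)

lemma lower_elem_lower_unitriangular: "1 \<le> i \<Longrightarrow> lower_unitriangular n (lower_elem n i t)"
  by (auto simp: lower_unitriangular_def lower_elem_def f_mat_def matrix_unit_def)

lemma lower_elem_SL: "1 \<le> i \<Longrightarrow> lower_elem n i t \<in> SL n"
  by (rule lower_unitriangular_SL[OF lower_elem_lower_unitriangular])

lemma upper_elem_SL:
  assumes "1 \<le> i"
  shows "upper_elem n i t \<in> SL n"
proof -
  have "upper_triangular (upper_elem n i t)"
    by (rule upper_triangularI) (auto simp: upper_elem_def e_mat_def matrix_unit_def)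
  then have "det (upper_elem n i t) = 1"
    using det_upper_triangular[of "upper_elem n i t" "n + 1"] upper_elem_carrier[of n i t]
    unfolding prod_list_diag_prod
    by (auto simp: upper_elem_def e_mat_def matrix_unit_def intro!: prod.neutral)
  then show ?thesis using upper_elem_carrier by (simp add: SL_def)
qed

lemma u_lift_SL: "1 \<le> i \<Longrightarrow> u_lift n C q i \<in> SL n"
  unfolding u_lift_def s_lift_eq
  by (cases "q \<in> C") (simp_all only: if_True if_False SL_mult lower_elem_SL upper_elem_SL SL_one)

lemma lower_elem_mult:
  assumes "1 \<le> i" "i \<le> n"
  shows "lower_elem n i s * lower_elem n i t = lower_elem n i (s + t)"
proof (rule eq_matI)
  fix r c assume "r < dim_row (lower_elem n i (s + t))" "c < dim_col (lower_elem n i (s + t))"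
  then have rc: "r \<le> n" "c < n + 1" by auto
  show "(lower_elem n i s * lower_elem n i t) $$ (r, c) = lower_elem n i (s + t) $$ (r, c)"
    unfolding lower_elem_mult_index[OF lower_elem_carrier assms rc]
    using rc assms by (auto simp: lower_elem_def f_mat_def matrix_unit_def algebra_simps)
qed auto

lemma word_mat_SL: "(\<And>q i. (q, i) \<in> set ws \<Longrightarrow> 1 \<le> i) \<Longrightarrow> word_mat n C t ws \<in> SL n"
proof (induction ws)
  case (Cons w ws)
  obtain q i where w: "w = (q, i)" by fastforce
  then have "1 \<le> i" using Cons.prems by auto
  then show ?case
    unfolding w word_mat_Cons using Cons by (intro SL_mult u_lift_SL lower_elem_SL) auto
qed (simp only: word_mat_Nil SL_one)

lemma word_mat_cong:
  "(\<And>q. q \<in> fst ` set ws \<Longrightarrow> t q = t' q) \<Longrightarrow> word_mat n C t ws = word_mat n C t' ws"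
proof (induction ws)
  case (Cons w ws)
  then show ?case by (cases w) auto
qed simp

section \<open>Functionals, one-parameter groups and divided powers\<close>

context SL_module
begin

abbreviation "functional \<equiv> Vector_Spaces.linear scale ((*) :: complex \<Rightarrow> complex \<Rightarrow> complex)"
abbreviation "F i \<equiv> lie_action scale \<rho> (f_mat n i)"
abbreviation "D i k \<equiv> f_divpow scale n \<rho> i k"

lemma functional_simps:
  assumes "functional \<phi>"
  shows "\<phi> (x + y) = \<phi> x + \<phi> y" "\<phi> (scale a x) = a * \<phi> x" "\<phi> 0 = 0" "\<phi> (x - y) = \<phi> x - \<phi> y"
    and "\<phi> (\<Sum>i\<in>A. f i) = (\<Sum>i\<in>A. \<phi> (f i))"
proof -
  interpret \<phi>: Vector_Spaces.linear scale "(*)" \<phi> by (rule assms)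
  show "\<phi> (x + y) = \<phi> x + \<phi> y" "\<phi> (scale a x) = a * \<phi> x" "\<phi> 0 = 0" "\<phi> (x - y) = \<phi> x - \<phi> y"
    and "\<phi> (\<Sum>i\<in>A. f i) = (\<Sum>i\<in>A. \<phi> (f i))"
    by (simp_all add: \<phi>.add \<phi>.scale \<phi>.zero \<phi>.diff \<phi>.sum)
qed

lemma functionalI:
  "(\<And>x y. \<phi> (x + y) = \<phi> x + \<phi> y) \<Longrightarrow> (\<And>a x. \<phi> (scale a x) = a * \<phi> x) \<Longrightarrow> functional \<phi>"
  unfolding Vector_Spaces.linear_iff using vector_space_axioms vector_space_complex_mult by blast

lemma endomorphismI:
  "(\<And>x y. h (x + y) = h x + h y) \<Longrightarrow> (\<And>a x. h (scale a x) = scale a (h x)) \<Longrightarrow>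
    Vector_Spaces.linear scale scale h"
  unfolding Vector_Spaces.linear_iff using vector_space_axioms by blast

lemma functional_compose:
  assumes "functional \<phi>" "Vector_Spaces.linear scale scale h"
  shows "functional (\<lambda>x. \<phi> (h x))"
proof -
  interpret h: Vector_Spaces.linear scale scale h by (rule assms)
  show ?thesis
    by (rule functionalI) (simp_all add: h.add h.scale functional_simps[OF assms(1)])
qed

lemma functional_extend:
  assumes "independent B"
  shows "\<exists>\<phi>. functional \<phi> \<and> (\<forall>x\<in>B. \<phi> x = f x)"
proof -
  interpret vector_space_pair scale "(*) :: complex \<Rightarrow> complex \<Rightarrow> complex"
    using vector_space_axioms vector_space_complex_mult by (simp add: vector_space_pair_def)
  show ?thesis using linear_independent_extend[OF assms] .
qed

lemma separating_functional:
  assumes "x \<notin> span S"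
  obtains \<phi> where "functional \<phi>" "\<phi> x = 1" "\<And>y. y \<in> S \<Longrightarrow> \<phi> y = 0"
proof -
  obtain B where B: "B \<subseteq> S" "independent B" "S \<subseteq> span B"
    by (rule maximal_independent_subset)
  have x: "x \<notin> span B" using assms span_mono[OF B(1)] by blast
  then have "independent (insert x B)" using B(2) by (rule independent_insertI)
  from functional_extend[OF this, of "\<lambda>y. if y = x then 1 else 0"] obtain \<phi> where
    \<phi>: "functional \<phi>" "\<And>y. y \<in> insert x B \<Longrightarrow> \<phi> y = (if y = x then 1 else 0)" by blast
  have zero: "\<phi> y = 0" if "y \<in> span B" for y
    using that
  proof (induction rule: span_induct_alt)
    case (step c b y)
    then show ?case using \<phi>(2)[of b] x span_base by (auto simp: functional_simps[OF \<phi>(1)])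
  qed (simp add: functional_simps[OF \<phi>(1)])
  show thesis
  proof (rule that[OF \<phi>(1)])
    show "\<phi> x = 1" using \<phi>(2)[of x] by simp
    show "\<phi> y = 0" if y: "y \<in> S" for y by (rule zero[OF subsetD[OF B(3) y]])
  qed
qed

lemma functionals_separate:
  assumes "\<And>\<phi>. functional \<phi> \<Longrightarrow> \<phi> x = \<phi> y"
  shows "x = y"
proof (rule ccontr)
  assume "x \<noteq> y"
  then have "x - y \<notin> span {}" by simp
  then obtain \<phi> where "functional \<phi>" "\<phi> (x - y) = 1" using separating_functional by blast
  then show False using assms[of \<phi>] functional_simps(4)[of \<phi> x y] by simp
qed

text \<open>Functionals on the abstract module arise in this way: values on a spanning family extend
  as soon as they respect its linear relations. Relations are indexed by \<open>I\<close> because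
  different indices may give the same vector.\<close>

lemma functional_extension:
  assumes sp: "span (w ` I) = UNIV"
    and rel: "\<And>t c. finite t \<Longrightarrow> t \<subseteq> I \<Longrightarrow> (\<Sum>g\<in>t. scale (c g) (w g)) = 0 \<Longrightarrow> (\<Sum>g\<in>t. c g * f g) = 0"
  shows "\<exists>\<phi>. functional \<phi> \<and> (\<forall>g\<in>I. \<phi> (w g) = f g)"
proof -
  obtain B where B: "B \<subseteq> w ` I" "independent B" "w ` I \<subseteq> span B"
    by (rule maximal_independent_subset)
  define s where "s = inv_into I w"
  have s: "s b \<in> I" "w (s b) = b" if "b \<in> B" for b
    using inv_into_into[of b w I] f_inv_into_f[of b w I] that B(1) by (auto simp: s_def)
  obtain \<phi> where \<phi>: "functional \<phi>" "\<And>b. b \<in> B \<Longrightarrow> \<phi> b = f (s b)"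
    using functional_extend[OF B(2), of "\<lambda>b. f (s b)"] by blast
  have "\<phi> (w g) = f g" if g: "g \<in> I" for g
  proof -
    have "w g \<in> span B" using g B(3) by blast
    then obtain t r where t: "finite t" "t \<subseteq> B" and r: "w g = (\<Sum>b\<in>t. scale (r b) b)"
      by (auto simp: span_explicit)
    have inj: "inj_on s t" using s(2) t(2) by (metis inj_onI subsetD)
    define G where "G = insert g (s ` t)"
    \<comment> \<open>\<open>c\<close> is the relation that expresses \<open>w g\<close> through
      basis vectors; both parts are added up because \<open>g\<close> may itself be one of the
      representatives.\<close>
    define c where "c x = (if x \<in> s ` t then r (w x) else 0) - (if x = g then 1 else 0)" for x
    have G: "finite G" "G \<subseteq> I" using t s(1) g by (auto simp: G_def)
    have w_s: "w (s b) = b" if "b \<in> t" for b using s(2) t(2) that by blast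
    have "(\<Sum>x\<in>G. scale (c x) (w x)) =
        (\<Sum>x\<in>G. if x \<in> s ` t then scale (r (w x)) (w x) else 0) - (\<Sum>x\<in>G. if x = g then w x else 0)"
      unfolding sum_subtractf[symmetric] by (intro sum.cong refl) (auto simp: c_def scale_left_diff_distrib)
    also have "(\<Sum>x\<in>G. if x \<in> s ` t then scale (r (w x)) (w x) else 0) = (\<Sum>x\<in>s ` t. scale (r (w x)) (w x))"
      using G(1) by (subst sum.inter_restrict[symmetric]) (auto simp: G_def intro!: sum.cong)
    also have "\<dots> = w g" unfolding r by (simp add: sum.reindex[OF inj] w_s)
    also have "(\<Sum>x\<in>G. if x = g then w x else 0) = w g" using G(1) by (simp add: G_def)
    finally have "(\<Sum>x\<in>G. c x * f x) = 0" using rel[OF G] by simp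
    moreover have "(\<Sum>x\<in>G. c x * f x) =
        (\<Sum>x\<in>G. if x \<in> s ` t then r (w x) * f x else 0) - (\<Sum>x\<in>G. if x = g then f x else 0)"
      unfolding sum_subtractf[symmetric] by (intro sum.cong refl) (auto simp: c_def algebra_simps)
    moreover have "(\<Sum>x\<in>G. if x \<in> s ` t then r (w x) * f x else 0) = (\<Sum>x\<in>s ` t. r (w x) * f x)"
      using G(1) by (subst sum.inter_restrict[symmetric]) (auto simp: G_def intro!: sum.cong)
    moreover have "\<dots> = (\<Sum>b\<in>t. r b * f (s b))" by (simp add: sum.reindex[OF inj] w_s)
    moreover have "(\<Sum>x\<in>G. if x = g then f x else 0) = f g" using G(1) by (simp add: G_def)
    moreover have "\<phi> (w g) = (\<Sum>b\<in>t. r b * f (s b))"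
      unfolding r functional_simps[OF \<phi>(1)] using \<phi>(2) t(2) by (intro sum.cong) auto
    ultimately show ?thesis by simp
  qed
  then show ?thesis using \<phi>(1) by blast
qed

lemma regular_polynomial:
  assumes "functional \<phi>"
  obtains p where "polynomial_fn (n + 1) p" "\<And>g. g \<in> SL n \<Longrightarrow> \<phi> (\<rho> g x) = p g"
  using rational_action[OF assms, of x] by (auto simp: regular_on_SL_def)

lemma action_linear_simps:
  assumes "g \<in> SL n"
  shows "\<rho> g (x + y) = \<rho> g x + \<rho> g y" "\<rho> g (scale a x) = scale a (\<rho> g x)"
    "\<rho> g (\<Sum>i\<in>A. f i) = (\<Sum>i\<in>A. \<rho> g (f i))" "\<rho> g 0 = 0"
proof -
  interpret g: Vector_Spaces.linear scale scale "\<rho> g" by (rule linear_action[OF assms])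
  show "\<rho> g (x + y) = \<rho> g x + \<rho> g y" "\<rho> g (scale a x) = scale a (\<rho> g x)"
    "\<rho> g (\<Sum>i\<in>A. f i) = (\<Sum>i\<in>A. \<rho> g (f i))" "\<rho> g 0 = 0"
    by (simp_all add: g.add g.scale g.sum g.zero)
qed

text \<open>In a finite basis the coordinates of the orbit are regular functions of the matrix, and
  the entries of \<open>lower_elem n i t\<close> are polynomial in \<open>t\<close>.\<close>

lemma polynomial_curve:
  assumes i: "1 \<le> i"
  obtains K w where "1 \<le> K" "\<And>k. K < k \<Longrightarrow> w k = 0"
    "\<And>t. \<rho> (lower_elem n i t) x = (\<Sum>k\<le>K. scale (t ^ k) (w k))"
proof -
  obtain B0 where B0: "finite B0" "span B0 = UNIV" using finite_dim by blast
  obtain B where B: "B \<subseteq> B0" "independent B" "B0 \<subseteq> span B"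
    by (rule maximal_independent_subset)
  have fin: "finite B" using B(1) B0(1) finite_subset by blast
  have sp: "span B = UNIV" using B(3) B0(2) span_mono span_span by (metis top.extremum_uniqueI)
  have rep: "functional (\<lambda>v. representation B v b)" for b
    by (rule functionalI) (use sp representation_add[OF B(2)] representation_scale[OF B(2)] in auto)
  have "\<exists>p. \<forall>t. representation B (\<rho> (lower_elem n i t) x) b = poly p t" for b
  proof -
    obtain p where p: "polynomial_fn (n + 1) p" "\<And>g. g \<in> SL n \<Longrightarrow> representation B (\<rho> g x) b = p g"
      using regular_polynomial[OF rep] by blast
    have "polyfun (\<lambda>t. lower_elem n i t $$ (r, c))" if "r < n + 1" "c < n + 1" for r c
    proof -
      have "polyfun (\<lambda>t. 1\<^sub>m (n + 1) $$ (r, c) + t * f_mat n i $$ (r, c))"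
        by (intro polyfun_add polyfun_mult) auto
      then show ?thesis using that by (simp add: lower_elem_def)
    qed
    then have "polyfun (\<lambda>t. p (lower_elem n i t))" using polynomial_fn_polyfun[OF p(1)] by blast
    then show ?thesis using p(2)[OF lower_elem_SL[OF i]] by (auto simp: polyfun_def)
  qed
  then obtain p where p: "\<And>b t. representation B (\<rho> (lower_elem n i t) x) b = poly (p b) t" by metis
  define K where "K = Suc (\<Sum>b\<in>B. degree (p b))"
  define w where "w k = (\<Sum>b\<in>B. scale (coeff (p b) k) b)" for k
  have deg: "degree (p b) < K" if "b \<in> B" for b
    using member_le_sum[OF that, of "\<lambda>b. degree (p b)"] fin by (simp add: K_def)
  show thesis
  proof (rule that[of K w])
    show "w k = 0" if "K < k" for k
    proof -
      have "coeff (p b) k = 0" if "b \<in> B" for b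
        using deg[OF that] \<open>K < k\<close> by (intro coeff_eq_0) simp
      then show ?thesis by (simp add: w_def)
    qed
    fix t
    have poly: "poly (p b) t = (\<Sum>k\<le>K. t ^ k * coeff (p b) k)" if b: "b \<in> B" for b
    proof -
      have "poly (p b) t = (\<Sum>k\<le>degree (p b). coeff (p b) k * t ^ k)" by (rule poly_altdef)
      also have "\<dots> = (\<Sum>k\<le>K. coeff (p b) k * t ^ k)"
        using deg[OF b] by (intro sum.mono_neutral_left) (auto simp: coeff_eq_0)
      finally show ?thesis by (simp add: mult.commute)
    qed
    have "\<rho> (lower_elem n i t) x = (\<Sum>b\<in>B. scale (representation B (\<rho> (lower_elem n i t) x) b) b)"
      using sum_representation_eq[OF B(2) _ fin order_refl] sp by simp
    also have "\<dots> = (\<Sum>b\<in>B. \<Sum>k\<le>K. scale (t ^ k) (scale (coeff (p b) k) b))"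
      by (intro sum.cong refl) (simp add: p poly scale_sum_left)
    also have "\<dots> = (\<Sum>k\<le>K. scale (t ^ k) (w k))"
      by (rule trans[OF sum.swap]) (simp add: w_def scale_sum_right)
    finally show "\<rho> (lower_elem n i t) x = (\<Sum>k\<le>K. scale (t ^ k) (w k))" .
  qed (simp add: K_def)
qed

lemma lie_action_eqI:
  assumes "\<And>\<phi>. functional \<phi> \<Longrightarrow> ((\<lambda>t. \<phi> (\<rho> (lower_elem n i t) x)) has_field_derivative \<phi> w) (at 0)"
  shows "F i x = w"
  unfolding lie_action_def mat_exp_f
proof (rule the_equality)
  show "\<forall>\<phi>. functional \<phi> \<longrightarrow> ((\<lambda>t. \<phi> (\<rho> (lower_elem n i t) x)) has_field_derivative \<phi> w) (at 0)"
    using assms by blast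
next
  fix w' assume *: "\<forall>\<phi>. functional \<phi> \<longrightarrow>
    ((\<lambda>t. \<phi> (\<rho> (lower_elem n i t) x)) has_field_derivative \<phi> w') (at 0)"
  show "w' = w" by (rule functionals_separate) (use * assms DERIV_unique in blast)
qed

lemma poly_curve_derivative:
  assumes "functional \<phi>"
  shows "((\<lambda>s. \<phi> (\<Sum>k\<le>K. scale ((s + t) ^ k) (w k))) has_field_derivative
    \<phi> (\<Sum>k\<le>K. scale (of_nat k * t ^ (k - 1)) (w k))) (at 0)"
  unfolding functional_simps[OF assms]
  by (rule derivative_eq_intros | simp add: mult_ac)+

text \<open>The shift by \<open>t\<close> allows differentiation at every point of a curve, not only
  at the identity.\<close>

lemma lie_action_curve:
  assumes "\<And>s. \<rho> (lower_elem n i s) y = (\<Sum>k\<le>K. scale ((s + t) ^ k) (w k))"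
  shows "F i y = (\<Sum>k\<le>K. scale (of_nat k * t ^ (k - 1)) (w k))"
  by (rule lie_action_eqI) (simp only: assms poly_curve_derivative)

lemma lie_action_derivative:
  assumes i: "1 \<le> i" and \<phi>: "functional \<phi>"
  shows "((\<lambda>t. \<phi> (\<rho> (lower_elem n i t) x)) has_field_derivative \<phi> (F i x)) (at 0)"
proof -
  obtain K w where w: "\<And>t. \<rho> (lower_elem n i t) x = (\<Sum>k\<le>K. scale (t ^ k) (w k))"
    using polynomial_curve[OF i] by metis
  have "F i x = (\<Sum>k\<le>K. scale (of_nat k * 0 ^ (k - 1)) (w k))"
    by (rule lie_action_curve) (simp add: w)
  then show ?thesis using poly_curve_derivative[OF \<phi>, where K = K and t = 0 and w = w] by (simp add: w)
qed

lemma lie_action_linear: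
  assumes i: "1 \<le> i"
  shows "Vector_Spaces.linear scale scale (F i)"
proof -
  show ?thesis
  proof (rule endomorphismI)
    show "F i (x + y) = F i x + F i y" for x y
    proof (rule lie_action_eqI)
      fix \<phi> assume \<phi>: "functional \<phi>"
      show "((\<lambda>t. \<phi> (\<rho> (lower_elem n i t) (x + y))) has_field_derivative \<phi> (F i x + F i y)) (at 0)"
        unfolding action_linear_simps[OF lower_elem_SL[OF i]] functional_simps[OF \<phi>]
        by (intro DERIV_add lie_action_derivative i \<phi>)
    qed
    show "F i (scale a x) = scale a (F i x)" for a x
    proof (rule lie_action_eqI)
      fix \<phi> assume \<phi>: "functional \<phi>"
      show "((\<lambda>t. \<phi> (\<rho> (lower_elem n i t) (scale a x))) has_field_derivative \<phi> (scale a (F i x))) (at 0)"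
        unfolding action_linear_simps[OF lower_elem_SL[OF i]] functional_simps[OF \<phi>]
        by (intro DERIV_cmult lie_action_derivative i \<phi>)
    qed
  qed
qed

lemma f_divpow_linear:
  assumes i: "1 \<le> i"
  shows "Vector_Spaces.linear scale scale (D i k)"
proof -
  interpret L: Vector_Spaces.linear scale scale "F i" by (rule lie_action_linear[OF i])
  have "(F i ^^ k) (x + y) = (F i ^^ k) x + (F i ^^ k) y" for x y
    by (induction k) (simp_all add: L.add)
  moreover have "(F i ^^ k) (scale a x) = scale a ((F i ^^ k) x)" for a x
    by (induction k) (simp_all add: L.scale)
  ultimately show ?thesis
    by (intro endomorphismI) (simp_all add: f_divpow_def scale_right_distrib)
qed

lemma poly_sum_monom: "poly (\<Sum>k\<le>K. monom (a k) k) t = (\<Sum>k\<le>K. t ^ k * a k)" for t :: complex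
  by (simp add: poly_sum poly_monom mult.commute)

lemma coeff_sum_monom: "coeff (\<Sum>k\<le>K. monom (a k) k) j = (if j \<le> K then a j else 0)" for a :: "nat \<Rightarrow> complex"
  by (simp add: coeff_sum sum.delta)

lemma curve_coefficients_eq:
  assumes "\<And>t. (\<Sum>k\<le>K. scale (t ^ k) (a k)) = (\<Sum>k\<le>K. scale (t ^ k) (b k))" "j \<le> K"
  shows "a j = b j"
proof (rule functionals_separate)
  fix \<phi> assume \<phi>: "functional \<phi>"
  have "(\<Sum>k\<le>K. monom (\<phi> (a k)) k) = (\<Sum>k\<le>K. monom (\<phi> (b k)) k)"
  proof (rule poly_ext)
    fix t
    have "\<phi> (\<Sum>k\<le>K. scale (t ^ k) (a k)) = \<phi> (\<Sum>k\<le>K. scale (t ^ k) (b k))" by (simp only: assms(1))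
    then show "poly (\<Sum>k\<le>K. monom (\<phi> (a k)) k) t = poly (\<Sum>k\<le>K. monom (\<phi> (b k)) k) t"
      unfolding poly_sum_monom functional_simps[OF \<phi>] .
  qed
  then show "\<phi> (a j) = \<phi> (b j)" using coeff_sum_monom assms(2) by metis
qed

text \<open>The one-parameter group of \<open>f\<^sub>i\<close> is the exponential series: differentiating
  \<open>\<rho> (exp ((s + t) f\<^sub>i)) x\<close> in \<open>s\<close> gives the recursion for the coefficients.\<close>

lemma exp_expansion:
  assumes i: "1 \<le> i" "i \<le> n"
  obtains K where "\<And>k. K < k \<Longrightarrow> D i k x = 0"
    "\<And>t. \<rho> (lower_elem n i t) x = (\<Sum>k\<le>K. scale (t ^ k) (D i k x))"
proof -
  interpret L: Vector_Spaces.linear scale scale "F i" by (rule lie_action_linear[OF i(1)])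
  obtain K w where K: "1 \<le> K" and w0: "\<And>k. K < k \<Longrightarrow> w k = 0"
    and w: "\<And>t. \<rho> (lower_elem n i t) x = (\<Sum>k\<le>K. scale (t ^ k) (w k))"
    using polynomial_curve[OF i(1)] by metis
  have "lower_elem n i 0 = 1\<^sub>m (n + 1)"
    by (rule eq_matI) (auto simp: lower_elem_def f_mat_def matrix_unit_def)
  then have "x = (\<Sum>k\<le>K. scale (0 ^ k) (w k))" using w[of 0] action_one[of x] by simp
  also have "\<dots> = (\<Sum>k\<le>K. if k = 0 then w k else 0)" by (intro sum.cong) auto
  also have "\<dots> = w 0" by simp
  finally have x: "x = w 0" .
  have rec: "F i (w k) = scale (of_nat (Suc k)) (w (Suc k))" for k
  proof -
    have "F i (\<rho> (lower_elem n i t) x) = (\<Sum>k\<le>K. scale (of_nat k * t ^ (k - 1)) (w k))" for t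
    proof (rule lie_action_curve)
      fix s
      have "\<rho> (lower_elem n i s) (\<rho> (lower_elem n i t) x) = \<rho> (lower_elem n i s * lower_elem n i t) x"
        using action_mult lower_elem_SL[OF i(1)] by simp
      then show "\<rho> (lower_elem n i s) (\<rho> (lower_elem n i t) x) = (\<Sum>k\<le>K. scale ((s + t) ^ k) (w k))"
        by (simp add: lower_elem_mult[OF i] w)
    qed
    moreover have "F i (\<rho> (lower_elem n i t) x) = (\<Sum>k\<le>K. scale (t ^ k) (F i (w k)))" for t
      by (simp add: w L.sum L.scale)
    \<comment> \<open>Index shift in the derivative; the term this adds at the top vanishes, since
      \<open>w (Suc K) = 0\<close>.\<close>
    moreover have "(\<Sum>k\<le>K. scale (of_nat k * t ^ (k - 1)) (w k)) =
        (\<Sum>k\<le>K. scale (t ^ k) (scale (of_nat (Suc k)) (w (Suc k))))" for t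
    proof -
      have "(\<Sum>k\<le>Suc K. scale (of_nat k * t ^ (k - 1)) (w k)) =
          (\<Sum>k\<le>K. scale (of_nat (Suc k) * t ^ (Suc k - 1)) (w (Suc k)))"
        by (subst sum.atMost_Suc_shift) simp
      then show ?thesis using w0[of "Suc K"] by (simp add: mult.commute)
    qed
    ultimately have eq: "(\<Sum>k\<le>K. scale (t ^ k) (F i (w k))) =
        (\<Sum>k\<le>K. scale (t ^ k) (scale (of_nat (Suc k)) (w (Suc k))))" for t by metis
    show ?thesis
    proof (cases "k \<le> K")
      case True
      from curve_coefficients_eq[OF eq True] show ?thesis .
    next
      case False
      then show ?thesis using w0 L.zero by simp
    qed
  qed
  have "(F i ^^ k) x = scale (fact k) (w k)" for k
    by (induction k) (simp_all add: x L.scale rec mult.commute)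
  then have "D i k x = w k" for k by (simp add: f_divpow_def)
  then show thesis using that[of K] w0 w by simp
qed

text \<open>Extracting a coefficient in \<open>s\<close> turns the exponential of a letter into a
  divided power. This links minors along the curve with the vectors of the theorem.\<close>

lemma letter_polynomial:
  assumes i: "1 \<le> i" "i \<le> n" and g: "g \<in> SL n" and u: "u \<in> SL n" and \<psi>: "functional \<psi>"
  obtains P where "\<And>s. \<psi> (\<rho> (u * (lower_elem n i s * g)) v) = poly P s"
    "\<And>k. coeff P k = \<psi> (\<rho> u (D i k (\<rho> g v)))"
proof -
  obtain K where K: "\<And>k. K < k \<Longrightarrow> D i k (\<rho> g v) = 0"
    "\<And>t. \<rho> (lower_elem n i t) (\<rho> g v) = (\<Sum>k\<le>K. scale (t ^ k) (D i k (\<rho> g v)))"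
    using exp_expansion[OF i] by metis
  define a where "a k = \<psi> (\<rho> u (D i k (\<rho> g v)))" for k
  have a0: "a k = 0" if "K < k" for k
    using K(1)[OF that] by (simp add: a_def action_linear_simps[OF u] functional_simps[OF \<psi>])
  show thesis
  proof (rule that[of "\<Sum>k\<le>K. monom (a k) k"])
    fix s
    have "\<rho> (u * (lower_elem n i s * g)) v = \<rho> u (\<rho> (lower_elem n i s) (\<rho> g v))"
      using action_mult u g lower_elem_SL[OF i(1)] SL_mult by simp
    then show "\<psi> (\<rho> (u * (lower_elem n i s * g)) v) = poly (\<Sum>k\<le>K. monom (a k) k) s"
      unfolding poly_sum_monom
      by (simp add: K(2) action_linear_simps[OF u] functional_simps[OF \<psi>] a_def)
  next
    show "coeff (\<Sum>k\<le>K. monom (a k) k) k = \<psi> (\<rho> u (D i k (\<rho> g v)))" for k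
      unfolding coeff_sum_monom using a0[of k] by (auto simp: a_def)
  qed
qed

text \<open>\<open>basis_vector\<close> for an arbitrary list of letters, so that inductions can
  remove letters from the left.\<close>

definition word_vec :: "gt set \<Rightarrow> 'v \<Rightarrow> (gt \<Rightarrow> int) \<Rightarrow> (gt \<times> nat) list \<Rightarrow> 'v" where
  "word_vec C v b ws = foldr (\<lambda>(q, i) w. \<rho> (u_lift n C q i) (D i (nat (b q)) w)) ws v"

lemma word_vec_Nil [simp]: "word_vec C v b [] = v"
  and word_vec_Cons [simp]: "word_vec C v b ((q, i) # ws) =
    \<rho> (u_lift n C q i) (D i (nat (b q)) (word_vec C v b ws))"
  by (simp_all add: word_vec_def)

lemma functional_letter:
  assumes "functional \<psi>" "1 \<le> i"
  shows "functional (\<lambda>x. \<psi> (\<rho> (u_lift n C q i) (D i k x)))"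
  using functional_compose[OF functional_compose[OF assms(1) linear_action[OF u_lift_SL[OF assms(2)]]]
      f_divpow_linear[OF assms(2)]] .

text \<open>A polynomial in the first parameter that vanishes identically has zero coefficients.
  Distinctness ensures that this parameter does not occur in the rest of the word.\<close>

lemma functional_vanishes_on_word_vec:
  assumes "distinct (map fst ws)" "\<And>q i. (q, i) \<in> set ws \<Longrightarrow> 1 \<le> i \<and> i \<le> n" "functional \<psi>"
    and "\<And>t. \<psi> (\<rho> (word_mat n C t ws) v) = 0"
  shows "\<psi> (word_vec C v b ws) = 0"
  using assms
proof (induction ws arbitrary: \<psi>)
  case Nil
  then show ?case using action_one[of v] by simp
next
  case (Cons x ws)
  obtain q i where x: "x = (q, i)" by fastforce
  have i: "1 \<le> i" "i \<le> n" using Cons.prems(2) x by auto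
  let ?u = "u_lift n C q i"
  have q: "q \<notin> fst ` set ws" using Cons.prems(1) x by auto
  define \<psi>' where "\<psi>' = (\<lambda>y. \<psi> (\<rho> ?u (D i (nat (b q)) y)))"
  have z: "\<psi>' (\<rho> (word_mat n C t ws) v) = 0" for t
  proof -
    have W: "word_mat n C t ws \<in> SL n" using Cons.prems(2) by (intro word_mat_SL) auto
    obtain P where P: "\<And>s. \<psi> (\<rho> (?u * (lower_elem n i s * word_mat n C t ws)) v) = poly P s"
      "\<And>k. coeff P k = \<psi> (\<rho> ?u (D i k (\<rho> (word_mat n C t ws) v)))"
      using letter_polynomial[OF i W u_lift_SL[OF i(1)] Cons.prems(3)] by blast
    have "poly P s = 0" for s
    proof -
      have "word_mat n C (t(q := s)) ws = word_mat n C t ws" using q by (intro word_mat_cong) auto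
      then show ?thesis
        using Cons.prems(4)[of "t(q := s)"] P(1)[of s] unfolding x word_mat_Cons fun_upd_same by simp
    qed
    then have "P = 0" using poly_all_0_iff_0 by blast
    then show ?thesis using P(2)[of "nat (b q)"] by (simp add: \<psi>'_def)
  qed
  have f: "functional \<psi>'" unfolding \<psi>'_def by (rule functional_letter[OF Cons.prems(3) i(1)])
  have d: "distinct (map fst ws)" using Cons.prems(1) by simp
  have m: "1 \<le> j \<and> j \<le> n" if "(p, j) \<in> set ws" for p j
    using Cons.prems(2)[of p j] that by simp
  have "\<psi>' (word_vec C v b ws) = 0" by (rule Cons.IH[OF d m f z])
  then show ?case by (simp add: x \<psi>'_def)
qed

end

section \<open>Triangularity along the word\<close>

lemma word_suffix_node: "Q (Suc i) (n - l - i) = node n (Suc i) (Suc l)"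
  by (simp add: node_def)

text \<open>The last clause separates the letters of the current antidiagonal from the one in front,
  which is what distinctness needs.\<close>

lemma word_suffix_members:
  assumes "(p, j) \<in> set (word_suffix n l i)" "l \<le> n" "i \<le> n + 1 - l"
  shows "1 \<le> j \<and> (\<exists>l'. 1 \<le> l' \<and> l' \<le> l \<and> j + l' \<le> n + 1 \<and> p = node n j l' \<and> (l' = l \<longrightarrow> j \<le> i))"
  using assms
proof (induction n l i rule: word_suffix.induct)
  case (2 n l)
  then obtain l' where "1 \<le> j" "1 \<le> l'" "l' \<le> l" "j + l' \<le> n + 1" "p = node n j l'" by auto
  then show ?case by (intro conjI exI[of _ l']) auto
next
  case (3 n l i)
  show ?case
  proof (cases "(p, j) = (Q (Suc i) (n - l - i), Suc i)")
    case True
    then show ?thesis using 3(3,4) word_suffix_node by (intro conjI exI[of _ "Suc l"]) auto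
  next
    case False
    then have "(p, j) \<in> set (word_suffix n (Suc l) i)" using 3(2) by auto
    from 3(1)[OF this 3(3)] 3(4) obtain l' where "1 \<le> j" "1 \<le> l'" "l' \<le> Suc l" "j + l' \<le> n + 1"
      "p = node n j l'" "l' = Suc l \<longrightarrow> j \<le> i" by auto
    then show ?thesis by (intro conjI exI[of _ l']) auto
  qed
qed simp

lemma node_in_word_suffix:
  assumes "1 \<le> j" "1 \<le> l'" "j + l' \<le> n + 1" "l' < l \<or> (l' = l \<and> j \<le> i)"
  shows "node n j l' \<in> fst ` set (word_suffix n l i)"
  using assms
proof (induction n l i rule: word_suffix.induct)
  case (2 n l)
  have "l' < l \<or> (l' = l \<and> j \<le> n + 1 - l)" using 2(2-5) by auto
  then show ?case using 2 by simp
next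
  case (3 n l i)
  show ?case
  proof (cases "l' = Suc l \<and> j = Suc i")
    case True
    then show ?thesis using word_suffix_node[of i n l] by simp
  next
    case False
    then show ?thesis using 3 by auto
  qed
qed simp

lemma distinct_word_suffix:
  "l \<le> n \<Longrightarrow> i \<le> n + 1 - l \<Longrightarrow> distinct (map fst (word_suffix n l i))"
proof (induction n l i rule: word_suffix.induct)
  case (3 n l i)
  have "Q (Suc i) (n - l - i) \<notin> fst ` set (word_suffix n (Suc l) i)"
  proof
    assume "Q (Suc i) (n - l - i) \<in> fst ` set (word_suffix n (Suc l) i)"
    then obtain j where "(node n (Suc i) (Suc l), j) \<in> set (word_suffix n (Suc l) i)"
      using word_suffix_node by auto
    from word_suffix_members[OF this 3(2)] 3(3) obtain l' where
      l': "1 \<le> l'" "j + l' \<le> n + 1" "node n (Suc i) (Suc l) = node n j l'" "l' = Suc l \<longrightarrow> j \<le> i" by auto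
    then have "Suc i = j \<and> Suc l = l'" using node_eq_iff[of "Suc i" "Suc l" n j l'] 3(2,3) by simp
    then show False using l'(4) by simp
  qed
  then show ?case using 3 by simp
qed auto

text \<open>Exponents in the order of the word. Lists of numbers carry the lexicographic order, so
  the leftmost letter, which acts last, decides first.\<close>

definition word_key :: "(gt \<times> nat) list \<Rightarrow> (gt \<Rightarrow> int) \<Rightarrow> nat list" where
  "word_key ws b = map (\<lambda>(q, i). nat (b q)) ws"

lemma word_key_simps [simp]:
  "word_key [] b = []" "word_key ((q, i) # ws) b = nat (b q) # word_key ws b"
  by (simp_all add: word_key_def)

lemma card_le_of_subset: "R \<subseteq> {0..n} \<Longrightarrow> card R \<le> n + 1"
  using card_mono[of "{0..n}" R] by simp

lemma tuple_minor_initial: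
  "(\<And>R. R \<in> set T \<Longrightarrow> R \<subseteq> {0..n}) \<Longrightarrow>
    tuple_minor (map (\<lambda>R. {0..<card R}) T) (1\<^sub>m (n + 1)) = 1"
proof (induction T)
  case (Cons R T)
  have "set_minor {0..<card R} (1\<^sub>m (n + 1)) = 1"
    using set_minor_initial_one card_le_of_subset[of R n] Cons.prems[of R] by (metis list.set_intros(1))
  moreover have "tuple_minor (map (\<lambda>R. {0..<card R}) T) (1\<^sub>m (n + 1)) = 1"
    using Cons by (metis list.set_intros(2))
  ultimately show ?case by (simp only: list.map tuple_minor_Cons mult_1)
qed simp

text \<open>The hypothesis \<open>eq\<close> speaks of the curve only, since after a coefficient is
  taken the new functional is known only along the shorter curve. If the first exponent of
  \<open>b\<close> is below that of the tableau, the new functional vanishes on that curve; if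
  equal, the induction continues with the next row sets; if above, the keys leave nothing to show.
  \<open>\<epsilon>\<close> collects the signs.\<close>

lemma (in SL_module) word_triangular:
  assumes T: "\<And>R. R \<in> set T \<Longrightarrow> R \<subseteq> {0..n}" and l: "l \<le> n" and i: "i \<le> n + 1 - l"
    and \<psi>: "functional \<psi>" and \<epsilon>: "\<epsilon> \<noteq> 0"
    and eq: "\<And>t. \<psi> (\<rho> (word_mat n C t (word_suffix n l i)) v) =
      \<epsilon> * tuple_minor (map (\<lambda>R. path n C R l i) T) (word_mat n C t (word_suffix n l i))"
  shows "(word_key (word_suffix n l i) b < word_key (word_suffix n l i) (tuple_point n C T) \<longrightarrow>
      \<psi> (word_vec C v b (word_suffix n l i)) = 0) \<and>
    (word_key (word_suffix n l i) b = word_key (word_suffix n l i) (tuple_point n C T) \<longrightarrow>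
      \<psi> (word_vec C v b (word_suffix n l i)) \<noteq> 0)"
  using l i \<psi> \<epsilon> eq
proof (induction l arbitrary: i \<psi> \<epsilon>)
  case 0
  have "\<psi> v = \<epsilon>"
    using 0(5)[of undefined] tuple_minor_initial[OF T, of T] action_one[of v] by simp
  then show ?case using 0(4) by simp
next
  case (Suc l)
  note outer = Suc.IH
  show ?case
    using Suc.prems(2-5)
  proof (induction i arbitrary: \<psi> \<epsilon>)
    case 0
    have "(\<lambda>R. path n C R (Suc l) 0) = (\<lambda>R. path n C R l (n + 1 - l))" by (rule ext) simp
    then show ?case
      using outer[of "n + 1 - l" \<psi> \<epsilon>] Suc.prems(1) 0(2,3) 0(4) by simp
  next
    case (Suc i)
    have l: "Suc l \<le> n" by (rule \<open>Suc l \<le> n\<close>)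
    have i: "1 \<le> Suc i" "Suc i \<le> n" "Suc i \<le> n - l" using Suc.prems(1) by auto
    let ?q = "Q (Suc i) (n - l - i)" and ?ws = "word_suffix n (Suc l) i"
    let ?u = "u_lift n C ?q (Suc i)"
    let ?S = "\<lambda>i. map (\<lambda>R. path n C R (Suc l) i) T"
    define A where "A = tuple_expo n C T (Suc i) (Suc l)"
    have Aq: "nat (tuple_point n C T ?q) = A"
      unfolding word_suffix_node A_def using tuple_point_node[of "Suc i" "Suc l" n C T] i l by simp
    have mem: "1 \<le> j \<and> j \<le> n" if "(p, j) \<in> set ?ws" for p j
      using word_suffix_members[OF that l] Suc.prems(1) by auto
    have W: "word_mat n C t ?ws \<in> SL n" for t by (rule word_mat_SL) (use mem in blast)
    have dist: "distinct (map fst (word_suffix n (Suc l) (Suc i)))"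
      by (rule distinct_word_suffix[OF l Suc.prems(1)])
    then have q: "?q \<notin> fst ` set ?ws" and dist': "distinct (map fst ?ws)" by auto
    define \<psi>' where "\<psi>' k = (\<lambda>x. \<psi> (\<rho> ?u (D (Suc i) k x)))" for k
    have \<psi>': "functional (\<psi>' k)" for k
      unfolding \<psi>'_def by (rule functional_letter[OF Suc.prems(2) i(1)])
    obtain e where e: "e \<in> {1, -1}" and low: "\<And>t. low_term
        (\<lambda>s. tuple_minor (?S (Suc i)) (?u * (lower_elem n (Suc i) s * word_mat n C t ?ws)))
        A (e * tuple_minor (?S i) (word_mat n C t ?ws))"
      using tuple_letter[OF l i(3) T, of T C] unfolding A_def by blast
    have coeffs: "(k < A \<longrightarrow> \<psi>' k (\<rho> (word_mat n C t ?ws) v) = 0) \<and>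
        (k = A \<longrightarrow> \<psi>' k (\<rho> (word_mat n C t ?ws) v) = \<epsilon> * e * tuple_minor (?S i) (word_mat n C t ?ws))"
      for k t
    proof -
      obtain P where P: "\<And>s. \<psi> (\<rho> (?u * (lower_elem n (Suc i) s * word_mat n C t ?ws)) v) = poly P s"
        "\<And>k. coeff P k = \<psi> (\<rho> ?u (D (Suc i) k (\<rho> (word_mat n C t ?ws) v)))"
        using letter_polynomial[OF i(1,2) W u_lift_SL[OF i(1)] Suc.prems(2)] by blast
      obtain p where p: "poly p 0 = e * tuple_minor (?S i) (word_mat n C t ?ws)"
        "\<And>s. tuple_minor (?S (Suc i)) (?u * (lower_elem n (Suc i) s * word_mat n C t ?ws)) = s ^ A * poly p s"
        using low[of t] by (auto simp: low_term_def simp del: path.simps)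
      have "poly P s = poly (smult \<epsilon> (monom 1 A * p)) s" for s
      proof -
        have "word_mat n C (t(?q := s)) ?ws = word_mat n C t ?ws"
        proof (rule word_mat_cong)
          fix q' assume "q' \<in> fst ` set ?ws"
          then have "q' \<noteq> ?q" using q by metis
          then show "(t(?q := s)) q' = t q'" by simp
        qed
        then have wm: "word_mat n C (t(?q := s)) (word_suffix n (Suc l) (Suc i)) =
            ?u * (lower_elem n (Suc i) s * word_mat n C t ?ws)"
          unfolding word_suffix.simps word_mat_Cons fun_upd_same by simp
        show ?thesis
          using Suc.prems(4)[of "t(?q := s)", unfolded wm] P(1)[of s] p(2)[of s]
          by (simp add: poly_monom del: path.simps)
      qed
      then have "P = smult \<epsilon> (monom 1 A * p)" by (rule poly_ext)
      then have "coeff P k = \<epsilon> * (if A \<le> k then coeff p (k - A) else 0)"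
        by (simp add: coeff_monom_mult)
      then show ?thesis using P(2)[of k] p(1) by (auto simp: \<psi>'_def poly_0_coeff_0)
    qed
    have vec: "\<psi> (word_vec C v b (word_suffix n (Suc l) (Suc i))) = \<psi>' (nat (b ?q)) (word_vec C v b ?ws)"
      by (simp add: \<psi>'_def)
    have key: "word_key (word_suffix n (Suc l) (Suc i)) b = nat (b ?q) # word_key ?ws b"
      "word_key (word_suffix n (Suc l) (Suc i)) (tuple_point n C T) = A # word_key ?ws (tuple_point n C T)"
      by (simp_all only: word_suffix.simps word_key_simps Aq)
    consider "nat (b ?q) < A" | "nat (b ?q) = A" | "A < nat (b ?q)" by linarith
    then show ?case
    proof cases
      case 1
      then have "\<psi>' (nat (b ?q)) (word_vec C v b ?ws) = 0"
        using coeffs by (intro functional_vanishes_on_word_vec[OF dist' mem \<psi>']) auto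
      then show ?thesis unfolding vec key using 1 by simp
    next
      case 2
      have nz: "\<epsilon> * e \<noteq> 0" using e Suc.prems(3) by auto
      have i': "i \<le> n + 1 - Suc l" using Suc.prems(1) by simp
      have "\<psi>' A (\<rho> (word_mat n C t ?ws) v) = \<epsilon> * e * tuple_minor (?S i) (word_mat n C t ?ws)" for t
        using coeffs by blast
      from Suc.IH[OF i' \<psi>' nz this] show ?thesis
        unfolding vec key 2 by simp
    next
      case 3
      then show ?thesis unfolding key by simp
    qed
  qed
qed

lemma (in vector_space) span_image_explicit:
  assumes "x \<in> span (w ` I)"
  obtains G c where "finite G" "G \<subseteq> I" "x = (\<Sum>g\<in>G. scale (c g) (w g))"
proof -
  obtain t r where t: "finite t" "t \<subseteq> w ` I" "x = (\<Sum>b\<in>t. scale (r b) b)"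
    using assms by (auto simp: span_explicit)
  obtain G where G: "G \<subseteq> I" "inj_on w G" "t = w ` G"
    using t(2) by (auto simp: subset_image_inj)
  show thesis
    by (rule that[of G "\<lambda>g. r (w g)"]) (use t G in \<open>auto simp: sum.reindex finite_image_iff\<close>)
qed

lemma weight_character_torus_nonzero:
  "w \<noteq> 0 \<Longrightarrow> weight_character n lam (torus n w) \<noteq> 0"
  by (auto simp: weight_character_def fund_character_def torus_def)

section \<open>Matrix coefficients of the highest weight vector\<close>

locale highest_weight_module = irreducible_SL_module scale n \<rho>
  for scale :: "complex \<Rightarrow> 'v::ab_group_add \<Rightarrow> 'v" and n \<rho> +
  fixes lam :: "nat \<Rightarrow> nat" and v :: 'v
  assumes hwv: "highest_weight_vector scale n \<rho> lam v"
begin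

abbreviation "ks \<equiv> shape n lam"
abbreviation "\<chi> \<equiv> weight_character n lam"

lemma v_nonzero: "v \<noteq> 0"
  using hwv by (simp add: highest_weight_vector_def)

lemma action_upper: "b \<in> SL n \<Longrightarrow> upper_triangular b \<Longrightarrow> \<rho> b v = scale (\<chi> b) v"
  using hwv by (simp add: highest_weight_vector_def)

lemma span_orbit: "span ((\<lambda>g. \<rho> g v) ` SL n) = UNIV"
proof -
  let ?U = "span ((\<lambda>g. \<rho> g v) ` SL n)"
  have "\<rho> h x \<in> ?U" if h: "h \<in> SL n" and "x \<in> ?U" for h x
    using that(2)
  proof (induction rule: span_induct_alt)
    case base
    then show ?case by (simp add: action_linear_simps[OF h] span_zero)
  next
    case (step c y x)
    then obtain g where g: "g \<in> SL n" "y = \<rho> g v" by auto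
    then have "\<rho> h y = \<rho> (h * g) v" using action_mult[OF h g(1)] by simp
    then have "\<rho> h y \<in> ?U" using SL_mult[OF h g(1)] by (auto intro: span_base)
    then show ?case using step by (simp add: action_linear_simps[OF h] span_add span_scale)
  qed
  then have "?U = {0} \<or> ?U = UNIV" using irreducible[OF subspace_span] by blast
  moreover have "v \<in> ?U"
    using action_one[of v] SL_one[of n] by (metis (mono_tags, lifting) image_eqI span_base)
  ultimately show ?thesis using v_nonzero by auto
qed

lemma functional_zero_on_orbit:
  assumes "functional \<phi>" "\<And>g. g \<in> SL n \<Longrightarrow> \<phi> (\<rho> g v) = 0"
  shows "\<phi> x = 0"
proof -
  have "x \<in> span ((\<lambda>g. \<rho> g v) ` SL n)" using span_orbit by simp
  then show ?thesis
  proof (induction rule: span_induct_alt)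
    case base
    then show ?case by (simp add: functional_simps[OF assms(1)])
  next
    case (step c y x)
    then show ?case using assms(2) by (auto simp: functional_simps[OF assms(1)])
  qed
qed

lemma big_cell_action:
  assumes "g \<in> big_cell n"
  obtains u c where "lower_unitriangular n u" "u = g * c" "c \<in> SL n" "upper_triangular c" "\<chi> c \<noteq> 0"
    "\<rho> u v = scale (\<chi> c) (\<rho> g v)"
proof -
  have g: "g \<in> SL n" using assms by (simp add: big_cell_def)
  obtain c where c: "c \<in> SL n" "upper_triangular c" "lower_unitriangular n (g * c)"
    using big_cell_factor[OF assms] by blast
  have "base_minor ks g * \<chi> c = 1"
    using base_minor_mult_upper[OF g c(1,2), of lam] base_minor_lower_unitriangular[OF c(3), of lam] by simp
  then have "\<chi> c \<noteq> 0" by auto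
  moreover have "\<rho> (g * c) v = scale (\<chi> c) (\<rho> g v)"
    using action_mult[OF g c(1)] action_upper[OF c(1,2)] action_linear_simps(2)[OF g] by simp
  ultimately show thesis using that[OF c(3) refl c(1,2)] by blast
qed

text \<open>A functional that vanishes on this set vanishes on the big-cell orbit, since upper
  triangular matrices only rescale \<open>v\<close>, and then on the whole orbit by density.\<close>

lemma span_lower: "span ((\<lambda>u. \<rho> u v) ` {u. lower_unitriangular n u}) = UNIV"
proof (rule ccontr)
  assume "\<not> ?thesis"
  then obtain x where "x \<notin> span ((\<lambda>u. \<rho> u v) ` {u. lower_unitriangular n u})" by blast
  from separating_functional[OF this] obtain \<phi> where \<phi>: "functional \<phi>" "\<phi> x = 1"
    "\<And>y. y \<in> (\<lambda>u. \<rho> u v) ` {u. lower_unitriangular n u} \<Longrightarrow> \<phi> y = 0" by blast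
  obtain p where p: "polynomial_fn (n + 1) p" "\<And>g. g \<in> SL n \<Longrightarrow> \<phi> (\<rho> g v) = p g"
    using regular_polynomial[OF \<phi>(1)] by blast
  have z: "p g = 0" if g: "g \<in> big_cell n" for g
  proof -
    obtain u c where u: "lower_unitriangular n u" "\<chi> c \<noteq> 0" "\<rho> u v = scale (\<chi> c) (\<rho> g v)"
      using big_cell_action[OF g] by metis
    have "\<phi> (\<rho> u v) = 0" using u(1) by (intro \<phi>(3) imageI CollectI)
    then have "\<phi> (scale (\<chi> c) (\<rho> g v)) = 0" using u(3) by simp
    then have "\<phi> (\<rho> g v) = 0" using u(2) by (simp add: functional_simps[OF \<phi>(1)])
    then show ?thesis using p(2) g by (simp add: big_cell_def)
  qed
  have "\<phi> (\<rho> g v) = 0" if g: "g \<in> SL n" for g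
    unfolding p(2)[OF g] by (rule polynomial_fn_eq_on_SL[OF p(1) polynomial_fn.const z g])
  then have "\<phi> x = 0" by (rule functional_zero_on_orbit[OF \<phi>(1)])
  then show False using \<phi>(2) by simp
qed

text \<open>The torus contracts the lower unipotent group to the identity, which isolates the
  \<open>lam\<close>-weight component of \<open>\<rho> u v\<close>.\<close>

lemma lower_relation_sum:
  assumes fin: "finite G" and G: "G \<subseteq> {u. lower_unitriangular n u}"
    and rel: "(\<Sum>u\<in>G. scale (c u) (\<rho> u v)) = 0"
  shows "(\<Sum>u\<in>G. c u) = 0"
proof -
  have "v \<notin> span {}" using v_nonzero by simp
  then obtain \<psi> where \<psi>: "functional \<psi>" "\<psi> v = 1" using separating_functional by blast
  obtain p where p: "polynomial_fn (n + 1) p" "\<And>g. g \<in> SL n \<Longrightarrow> \<psi> (\<rho> g v) = p g"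
    using regular_polynomial[OF \<psi>(1)] by blast
  have zero: "(\<Sum>u\<in>G. c u * p (contracted n u w)) = 0" if w: "w \<noteq> 0" for w
  proof -
    note \<tau> = torus_SL[OF w, of n]
    have "\<psi> (\<rho> (torus n w) (\<rho> u v)) = \<chi> (torus n w) * p (contracted n u w)" if "u \<in> G" for u
    proof -
      have u: "lower_unitriangular n u" using G that by blast
      have c: "contracted n u w \<in> SL n"
        by (rule lower_unitriangular_SL[OF contracted_lower_unitriangular])
      have "\<rho> (torus n w) (\<rho> u v) = \<rho> (contracted n u w) (\<rho> (torus n w) v)"
        using action_mult[OF \<tau> lower_unitriangular_SL[OF u]] action_mult[OF c \<tau>]
          torus_mult[OF u w] by metis
      then show ?thesis
        using p(2)[OF c] action_upper[OF \<tau> torus_upper]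
        by (simp add: action_linear_simps[OF c] functional_simps[OF \<psi>(1)])
    qed
    then have "\<chi> (torus n w) * (\<Sum>u\<in>G. c u * p (contracted n u w)) =
        (\<Sum>u\<in>G. c u * \<psi> (\<rho> (torus n w) (\<rho> u v)))"
      by (simp add: sum_distrib_left mult_ac)
    also have "\<dots> = \<psi> (\<rho> (torus n w) (\<Sum>u\<in>G. scale (c u) (\<rho> u v)))"
      by (simp add: action_linear_simps[OF \<tau>] functional_simps[OF \<psi>(1)])
    also have "\<dots> = 0" by (simp add: rel action_linear_simps[OF \<tau>] functional_simps[OF \<psi>(1)])
    finally show ?thesis using weight_character_torus_nonzero[OF w] by simp
  qed
  have "((\<lambda>w. p (contracted n u w)) \<longlongrightarrow> p (1\<^sub>m (n + 1))) (at 0)" for u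
    by (rule polynomial_fn_tendsto[OF p(1) contracted_tendsto])
  moreover have "p (1\<^sub>m (n + 1)) = 1" using p(2)[OF SL_one] action_one[of v] \<psi>(2) by simp
  ultimately have "((\<lambda>w. \<Sum>u\<in>G. c u * p (contracted n u w)) \<longlongrightarrow> (\<Sum>u\<in>G. c u * 1)) (at 0)"
    by (intro tendsto_sum tendsto_mult tendsto_const) simp
  moreover have "eventually (\<lambda>w. (\<Sum>u\<in>G. c u * p (contracted n u w)) = 0) (at 0)"
    using eventually_neq_at_within[of 0 0 UNIV] by eventually_elim (rule zero)
  then have "((\<lambda>w. \<Sum>u\<in>G. c u * p (contracted n u w)) \<longlongrightarrow> 0) (at 0)"
    by (rule tendsto_eventually)
  ultimately show ?thesis using tendsto_unique[of "at (0::complex)"] by fastforce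
qed

text \<open>By \<open>lower_relation_sum\<close> the constant 1 on the lower unipotent orbit extends
  to a functional. Its coefficient and \<open>base_minor\<close> both transform by
  \<open>\<chi>\<close> under upper triangular matrices on the right, so they agree on the big cell
  and, by density, on \<open>SL n\<close>.\<close>

lemma ex_base_functional:
  "\<exists>\<phi>. functional \<phi> \<and> (\<forall>g\<in>SL n. \<phi> (\<rho> g v) = base_minor ks g)"
proof -
  have "\<exists>\<phi>. functional \<phi> \<and> (\<forall>u\<in>{u. lower_unitriangular n u}. \<phi> (\<rho> u v) = 1)"
    by (rule functional_extension[OF span_lower]) (use lower_relation_sum in simp)
  then obtain \<phi> where \<phi>: "functional \<phi>" "\<And>u. lower_unitriangular n u \<Longrightarrow> \<phi> (\<rho> u v) = 1" by auto
  obtain p where p: "polynomial_fn (n + 1) p" "\<And>g. g \<in> SL n \<Longrightarrow> \<phi> (\<rho> g v) = p g"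
    using regular_polynomial[OF \<phi>(1)] by blast
  have z: "p g = base_minor ks g" if g: "g \<in> big_cell n" for g
  proof -
    have gS: "g \<in> SL n" using g by (simp add: big_cell_def)
    obtain u c where u: "lower_unitriangular n u" "u = g * c" "c \<in> SL n" "upper_triangular c" "\<chi> c \<noteq> 0"
      "\<rho> u v = scale (\<chi> c) (\<rho> g v)"
      using big_cell_action[OF g] by blast
    have "\<chi> c * p g = 1"
      using \<phi>(2)[OF u(1)] p(2)[OF gS] by (simp add: u(6) functional_simps[OF \<phi>(1)])
    moreover have "\<chi> c * base_minor ks g = 1"
      using base_minor_mult_upper[OF gS u(3,4), of lam] base_minor_lower_unitriangular[OF u(1), of lam] u(2)
      by (simp add: mult.commute)
    ultimately have "\<chi> c * p g = \<chi> c * base_minor ks g" by (rule trans[OF _ sym])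
    then show ?thesis using u(5) by simp
  qed
  have "p g = base_minor ks g" if g: "g \<in> SL n" for g
    by (rule polynomial_fn_eq_on_SL[OF p(1) polynomial_fn_base_minor[OF shape_le] z g])
  then show ?thesis using \<phi>(1) p(2) by auto
qed

text \<open>A relation among orbit vectors survives the action of every \<open>h\<close>, so the
  base functional yields a relation for each translate of \<open>base_minor\<close>. The reproducing
  kernel turns these into the relation for a single product of minors.\<close>

lemma ex_tuple_functional:
  assumes T: "T \<in> col_tuples n ks"
  shows "\<exists>\<phi>. functional \<phi> \<and> (\<forall>g\<in>SL n. \<phi> (\<rho> g v) = tuple_minor T g)"
proof (rule functional_extension[OF span_orbit])
  fix G c assume G: "finite G" "G \<subseteq> SL n" and rel: "(\<Sum>g\<in>G. scale (c g) (\<rho> g v)) = 0"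
  obtain \<phi> where \<phi>: "functional \<phi>" "\<And>g. g \<in> SL n \<Longrightarrow> \<phi> (\<rho> g v) = base_minor ks g"
    using ex_base_functional by blast
  have zero: "(\<Sum>g\<in>G. c g * base_minor ks (h * g)) = 0" if h: "h \<in> SL n" for h
  proof -
    have "c g * base_minor ks (h * g) = \<phi> (scale (c g) (\<rho> h (\<rho> g v)))" if "g \<in> G" for g
    proof -
      have g: "g \<in> SL n" using that G(2) by blast
      show ?thesis
        using \<phi>(2)[OF SL_mult[OF h g]] action_mult[OF h g] by (simp add: functional_simps[OF \<phi>(1)])
    qed
    then have "(\<Sum>g\<in>G. c g * base_minor ks (h * g)) = \<phi> (\<rho> h (\<Sum>g\<in>G. scale (c g) (\<rho> g v)))"
      by (simp add: action_linear_simps[OF h] functional_simps(5)[OF \<phi>(1)])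
    then show ?thesis by (simp add: rel action_linear_simps[OF h] functional_simps[OF \<phi>(1)])
  qed
  obtain \<tau> where \<tau>: "\<tau> \<in> tuple_choices n ks" "\<And>g. choice_minor ks \<tau> g = tuple_minor T g"
    using choice_minor_of_tuple[OF T] by blast
  show "(\<Sum>g\<in>G. c g * tuple_minor T g) = 0"
    using base_minor_kernel[OF G shape_le zero \<tau>(1)] \<tau>(2) by simp
qed

definition tuple_functional :: "nat set list \<Rightarrow> 'v \<Rightarrow> complex" where
  "tuple_functional T = (SOME \<phi>. functional \<phi> \<and> (\<forall>g\<in>SL n. \<phi> (\<rho> g v) = tuple_minor T g))"

lemma tuple_functional:
  assumes "T \<in> col_tuples n ks"
  shows "functional (tuple_functional T)" "g \<in> SL n \<Longrightarrow> tuple_functional T (\<rho> g v) = tuple_minor T g"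
  using someI_ex[OF ex_tuple_functional[OF assms]] by (auto simp: tuple_functional_def)

text \<open>Straightening passes from tableaux to all column tuples, and Cauchy-Binet from there to
  all translates of the base functional. The vectors killed by these translates form an invariant
  subspace that misses \<open>v\<close>, hence 0.\<close>

lemma tableau_functionals_separate:
  assumes x: "\<And>T. T \<in> tableaux n lam \<Longrightarrow> tuple_functional T x = 0"
  shows "x = 0"
proof -
  obtain \<phi> where \<phi>: "functional \<phi>" "\<And>g. g \<in> SL n \<Longrightarrow> \<phi> (\<rho> g v) = base_minor ks g"
    using ex_base_functional by blast
  define U where "U = {y. \<forall>h\<in>SL n. \<phi> (\<rho> h y) = 0}"
  have "subspace U"
    unfolding U_def subspace_def by (auto simp: action_linear_simps functional_simps[OF \<phi>(1)])
  moreover have "\<rho> g y \<in> U" if g: "g \<in> SL n" and y: "y \<in> U" for g y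
    unfolding U_def
  proof (intro CollectI ballI)
    fix h assume h: "h \<in> SL n"
    have "\<rho> h (\<rho> g y) = \<rho> (h * g) y" using action_mult[OF h g] by simp
    then show "\<phi> (\<rho> h (\<rho> g y)) = 0" using y SL_mult[OF h g] by (simp add: U_def)
  qed
  ultimately have "U = {0} \<or> U = UNIV" by (rule irreducible)
  moreover have "v \<notin> U"
  proof -
    have "lower_unitriangular n (1\<^sub>m (n + 1))" by (auto simp: lower_unitriangular_def)
    then have "\<phi> (\<rho> (1\<^sub>m (n + 1)) v) = 1"
      using \<phi>(2)[OF SL_one] base_minor_lower_unitriangular[of n "1\<^sub>m (n + 1)" lam] by simp
    then show ?thesis using SL_one[of n] unfolding U_def by force
  qed
  ultimately have U: "U = {0}" by auto
  have "x \<in> span ((\<lambda>g. \<rho> g v) ` SL n)" using span_orbit by simp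
  then obtain G c where G: "finite G" "G \<subseteq> SL n" and xG: "x = (\<Sum>g\<in>G. scale (c g) (\<rho> g v))"
    by (rule span_image_explicit)
  have val: "(\<Sum>g\<in>G. c g * tuple_minor T g) = tuple_functional T x" if T: "T \<in> col_tuples n ks" for T
  proof -
    have "tuple_functional T (\<rho> g v) = tuple_minor T g" if "g \<in> G" for g
      using tuple_functional(2)[OF T] that G(2) by blast
    then show ?thesis by (simp add: xG functional_simps[OF tuple_functional(1)[OF T]])
  qed
  have all: "(\<Sum>g\<in>G. c g * tuple_minor T g) = 0" if "T \<in> col_tuples n ks" for T
    using shape_decreasing _ that
  proof (rule straightening)
    fix T assume "T \<in> col_tuples n ks" "nested T"
    then show "(\<Sum>g\<in>G. c g * tuple_minor T g) = 0" using val[of T] x[of T] by (simp add: tableaux_def)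
  qed
  have choice: "(\<Sum>g\<in>G. c g * choice_minor ks \<tau> g) = 0" if "\<tau> \<in> tuple_choices n ks" for \<tau>
    using tuple_of_choice_minor[OF that]
  proof
    assume "\<exists>T\<in>col_tuples n ks. \<exists>\<epsilon>. \<forall>g. choice_minor ks \<tau> g = \<epsilon> * tuple_minor T g"
    then obtain T \<epsilon> where T: "T \<in> col_tuples n ks" "\<And>g. choice_minor ks \<tau> g = \<epsilon> * tuple_minor T g" by blast
    have "(\<Sum>g\<in>G. c g * choice_minor ks \<tau> g) = \<epsilon> * (\<Sum>g\<in>G. c g * tuple_minor T g)"
      by (simp add: T(2) sum_distrib_left mult_ac)
    then show ?thesis using all[OF T(1)] by simp
  qed simp
  have "\<phi> (\<rho> h x) = 0" if h: "h \<in> SL n" for h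
  proof -
    let ?F = "\<Prod>c<length ks. fact (ks ! c) :: complex"
    have "?F * base_minor ks (h * g) =
        (\<Sum>\<tau>\<in>tuple_choices n ks. choice_minor ks \<tau> (transpose_mat h) * choice_minor ks \<tau> g)" if "g \<in> G" for g
      using base_minor_mult[OF SL_carrier[OF h] SL_carrier shape_le, of g lam] that G(2) by blast
    then have "?F * (\<Sum>g\<in>G. c g * base_minor ks (h * g)) = (\<Sum>g\<in>G. \<Sum>\<tau>\<in>tuple_choices n ks.
        choice_minor ks \<tau> (transpose_mat h) * (c g * choice_minor ks \<tau> g))"
      by (simp add: sum_distrib_left mult.left_commute[of ?F] mult.left_commute)
    also have "\<dots> = (\<Sum>\<tau>\<in>tuple_choices n ks.
        choice_minor ks \<tau> (transpose_mat h) * (\<Sum>g\<in>G. c g * choice_minor ks \<tau> g))"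
      unfolding sum_distrib_left by (rule sum.swap)
    also have "\<dots> = 0" using choice by simp
    finally have "(\<Sum>g\<in>G. c g * base_minor ks (h * g)) = 0" by simp
    moreover have "\<phi> (\<rho> h (\<rho> g v)) = base_minor ks (h * g)" if "g \<in> G" for g
      using \<phi>(2)[OF SL_mult[OF h]] action_mult[OF h] that G(2) by (metis subsetD)
    ultimately show ?thesis
      by (simp add: xG action_linear_simps[OF h] functional_simps[OF \<phi>(1)])
  qed
  then have "x \<in> U" by (simp add: U_def)
  then show ?thesis using U by simp
qed

end

section \<open>The basis\<close>

lemma finite_tableaux: "finite (tableaux n lam)"
proof (rule finite_subset)
  show "tableaux n lam \<subseteq> {T. set T \<subseteq> Pow {0..n} \<and> length T = length (shape n lam)}"
    by (force simp: tableaux_def col_tuples_def in_set_conv_nth)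
  show "finite {T. set T \<subseteq> Pow {0..n} \<and> length T = length (shape n lam)}"
    by (rule finite_lists_length_eq) simp
qed

definition tableau_key :: "nat \<Rightarrow> gt set \<Rightarrow> nat set list \<Rightarrow> nat list" where
  "tableau_key n C T = word_key (word_suffix n n 1) (tuple_point n C T)"

lemma tuple_point_nonneg: "0 \<le> tuple_point n C T p"
  by (simp add: tuple_point_def split: gt.split)

lemma tableau_key_inj:
  assumes "C \<subseteq> gt_unmarked n"
  shows "inj_on (tableau_key n C) (tableaux n lam)"
proof (rule inj_onI)
  fix T T' assume T: "T \<in> tableaux n lam" "T' \<in> tableaux n lam"
    and key: "tableau_key n C T = tableau_key n C T'"
  have eq: "nat (tuple_point n C T q) = nat (tuple_point n C T' q)"
    if "q \<in> fst ` set (word_suffix n n 1)" for q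
    using key that by (auto simp: tableau_key_def word_key_def)
  have "tuple_point n C T p = tuple_point n C T' p" for p
  proof (cases "p \<in> gt_unmarked n")
    case False
    then show ?thesis by (simp add: tuple_point_def)
  next
    case True
    then obtain i l where il: "1 \<le> i" "1 \<le> l" "i + l \<le> n + 1" "p = node n i l"
      by (rule gt_unmarkedE)
    have "l < n \<or> (l = n \<and> i \<le> 1)" using il by auto
    from node_in_word_suffix[OF il(1-3) this] have "p \<in> fst ` set (word_suffix n n 1)"
      using il(4) by simp
    from eq[OF this] show ?thesis
      using tuple_point_nonneg[of n C T p] tuple_point_nonneg[of n C T' p] by simp
  qed
  then have "tuple_point n C T = tuple_point n C T'" by blast
  then show "T = T'" using tuple_point_inj[OF assms] T by (auto simp: inj_on_def)
qed

text \<open>A codimension bound for a common kernel, phrased with a spanning set \<open>E\<close>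
  instead of a quotient. A further functional costs one vector exactly when it is nonzero on the
  kernel so far.\<close>

lemma (in SL_module) spanning_modulo_common_kernel:
  assumes "finite I" "\<And>T. T \<in> I \<Longrightarrow> functional (\<theta> T)"
  shows "\<exists>E. finite E \<and> card E \<le> card I \<and> (\<forall>x. \<exists>y\<in>span E. \<forall>T\<in>I. \<theta> T (x - y) = 0)"
  using assms
proof (induction I rule: finite_induct)
  case empty
  show ?case by (intro exI[of _ "{}"]) auto
next
  case (insert T I)
  then obtain E where E: "finite E" "card E \<le> card I" "\<And>x. \<exists>y\<in>span E. \<forall>T\<in>I. \<theta> T (x - y) = 0" by auto
  note lin = functional_simps[OF insert.prems]
  show ?case
  proof (cases "\<forall>x. (\<forall>S\<in>I. \<theta> S x = 0) \<longrightarrow> \<theta> T x = 0")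
    case True
    then have "\<forall>x. \<exists>y\<in>span E. \<forall>S\<in>insert T I. \<theta> S (x - y) = 0" using E(3) by (metis insert_iff)
    then show ?thesis using E(1,2) insert.hyps by (intro exI[of _ E]) auto
  next
    case False
    then obtain e where e: "\<And>S. S \<in> I \<Longrightarrow> \<theta> S e = 0" "\<theta> T e \<noteq> 0" by blast
    have "\<exists>y\<in>span (insert e E). \<forall>S\<in>insert T I. \<theta> S (x - y) = 0" for x
    proof -
      obtain y where y: "y \<in> span E" "\<And>S. S \<in> I \<Longrightarrow> \<theta> S (x - y) = 0" using E(3) by blast
      define z where "z = y + scale (\<theta> T (x - y) / \<theta> T e) e"
      have "z \<in> span (insert e E)"
        unfolding z_def
      proof (intro span_add span_scale)
        show "y \<in> span (insert e E)" using y(1) span_mono[of E "insert e E"] by blast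
        show "e \<in> span (insert e E)" by (rule span_base) simp
      qed
      moreover have "\<theta> S (x - z) = 0" if "S \<in> insert T I" for S
      proof -
        have "x - z = (x - y) - scale (\<theta> T (x - y) / \<theta> T e) e" by (simp add: z_def)
        then have "\<theta> S (x - z) = \<theta> S (x - y) - \<theta> T (x - y) / \<theta> T e * \<theta> S e"
          by (simp only: lin(2,4)[OF that])
        then show ?thesis using that y(2) e by auto
      qed
      ultimately show ?thesis by blast
    qed
    moreover have "card (insert e E) \<le> card (insert T I)"
      using E(1,2) insert.hyps by (simp add: card_insert_if)
    ultimately show ?thesis using E(1) by (intro exI[of _ "insert e E"]) auto
  qed
qed

text \<open>Independence and spanning come from different functionals: \<open>\<phi>\<close> is
  triangular with respect to \<open>key\<close>, while \<open>\<theta>\<close> has joint kernel 0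
  and so bounds the dimension by \<open>card I\<close>.\<close>

lemma (in SL_module) triangular_basis:
  fixes key :: "'i \<Rightarrow> 'k::linorder" and w :: "'i \<Rightarrow> 'v"
  assumes fin: "finite I" and key: "inj_on key I"
    and \<phi>: "\<And>T. T \<in> I \<Longrightarrow> functional (\<phi> T)"
    and low: "\<And>S T. S \<in> I \<Longrightarrow> T \<in> I \<Longrightarrow> key S < key T \<Longrightarrow> \<phi> T (w S) = 0"
    and diag: "\<And>T. T \<in> I \<Longrightarrow> \<phi> T (w T) \<noteq> 0"
    and \<theta>: "\<And>T. T \<in> I \<Longrightarrow> functional (\<theta> T)"
    and sep: "\<And>x. (\<And>T. T \<in> I \<Longrightarrow> \<theta> T x = 0) \<Longrightarrow> x = 0"
  shows "inj_on w I" "independent (w ` I)" "span (w ` I) = UNIV"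
proof -
  show inj: "inj_on w I"
  proof (rule inj_onI, rule ccontr)
    fix S T assume ST: "S \<in> I" "T \<in> I" "w S = w T" "S \<noteq> T"
    then have "key S \<noteq> key T" using key by (auto simp: inj_on_def)
    then have "key S < key T \<or> key T < key S" by auto
    then show False using low[of S T] low[of T S] diag[of S] diag[of T] ST by auto
  qed
  have zero: "\<forall>T\<in>I. c T = 0" if rel: "(\<Sum>T\<in>I. scale (c T) (w T)) = 0" for c
  proof (rule ccontr)
    assume "\<not> ?thesis"
    then have ne: "{T \<in> I. c T \<noteq> 0} \<noteq> {}" by auto
    \<comment> \<open>At the largest key with nonzero coefficient, the corresponding functional
      kills all other terms of the relation.\<close>
    define m where "m = Max (key ` {T \<in> I. c T \<noteq> 0})"
    have "m \<in> key ` {T \<in> I. c T \<noteq> 0}" unfolding m_def using fin ne by (intro Max_in) auto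
    then obtain T where T: "T \<in> I" "c T \<noteq> 0" "m = key T" by auto
    have off: "c S * \<phi> T (w S) = 0" if S: "S \<in> I - {T}" for S
    proof (cases "c S = 0")
      case False
      then have "key S \<le> key T" unfolding T(3)[symmetric] m_def using fin S by (intro Max_ge) auto
      moreover have "key S \<noteq> key T" using key S T(1) by (auto simp: inj_on_def)
      ultimately show ?thesis using low[of S T] S T(1) by auto
    qed simp
    have "(\<Sum>S\<in>I. c S * \<phi> T (w S)) = c T * \<phi> T (w T) + (\<Sum>S\<in>I - {T}. c S * \<phi> T (w S))"
      by (rule sum.remove[OF fin T(1)])
    also have "(\<Sum>S\<in>I - {T}. c S * \<phi> T (w S)) = 0" using off by (intro sum.neutral) blast
    finally have "(\<Sum>S\<in>I. c S * \<phi> T (w S)) = c T * \<phi> T (w T)" by simp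
    moreover have "(\<Sum>S\<in>I. c S * \<phi> T (w S)) = \<phi> T (\<Sum>S\<in>I. scale (c S) (w S))"
      by (simp add: functional_simps[OF \<phi>[OF T(1)]])
    ultimately show False using rel T diag[OF T(1)] functional_simps(3)[OF \<phi>[OF T(1)]] by simp
  qed
  show ind: "independent (w ` I)"
  proof
    assume "dependent (w ` I)"
    then obtain u where u: "\<exists>x\<in>w ` I. u x \<noteq> 0" "(\<Sum>x\<in>w ` I. scale (u x) x) = 0"
      using dependent_finite[of "w ` I"] fin by auto
    then have "(\<Sum>T\<in>I. scale (u (w T)) (w T)) = 0" using inj by (simp add: sum.reindex)
    then show False using zero[of "\<lambda>T. u (w T)"] u(1) by auto
  qed
  have "\<exists>E. finite E \<and> card E \<le> card I \<and> (\<forall>x. \<exists>y\<in>span E. \<forall>T\<in>I. \<theta> T (x - y) = 0)"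
    by (rule spanning_modulo_common_kernel[OF fin \<theta>])
  then obtain E where E: "finite E" "card E \<le> card I"
    and E3: "\<forall>x. \<exists>y\<in>span E. \<forall>T\<in>I. \<theta> T (x - y) = 0" by (elim exE conjE)
  have spE: "x \<in> span E" for x
  proof -
    obtain y where y: "y \<in> span E" "\<forall>T\<in>I. \<theta> T (x - y) = 0" using E3[rule_format, of x] by (elim bexE)
    have "x - y = 0" by (rule sep) (use y(2) in simp)
    then show ?thesis using y(1) by simp
  qed
  have "x \<in> span (w ` I)" for x
  proof (rule ccontr)
    assume x: "x \<notin> span (w ` I)"
    then have "independent (insert x (w ` I))" using ind by (rule independent_insertI)
    then have "card (insert x (w ` I)) \<le> card E"
      using independent_span_bound[OF E(1)] spE by blast
    moreover have "x \<notin> w ` I" using x span_base by blast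
    ultimately show False using fin inj E(2) by (simp add: card_image)
  qed
  then show "span (w ` I) = UNIV" by blast
qed

text \<open>The row sets at the left end of the word, where the minors of the full curve are read.
  They keep the column lengths of \<open>T\<close> but need not be nested.\<close>

definition path_tuple :: "nat \<Rightarrow> gt set \<Rightarrow> nat set list \<Rightarrow> nat set list" where
  "path_tuple n C T = map (\<lambda>R. path n C R n 1) T"

lemma col_tuples_subset: "T \<in> col_tuples n ks \<Longrightarrow> R \<in> set T \<Longrightarrow> R \<subseteq> {0..n}"
  by (auto simp: col_tuples_def in_set_conv_nth)

lemma path_tuple_col_tuples:
  assumes "T \<in> col_tuples n ks"
  shows "path_tuple n C T \<in> col_tuples n ks"
  unfolding col_tuples_def
proof (intro CollectI conjI allI impI)
  show len: "length (path_tuple n C T) = length ks" using assms by (simp add: path_tuple_def col_tuples_def)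
  fix c assume c: "c < length ks"
  then have T: "T ! c \<subseteq> {0..n}" "card (T ! c) = ks ! c" using assms by (auto simp: col_tuples_def)
  have "path_inv n C (T ! c) n 1 (path n C (T ! c) n 1)" by (rule path_inv_path[OF T(1)]) auto
  then show "path_tuple n C T ! c \<subseteq> {0..n}" "card (path_tuple n C T ! c) = ks ! c"
    using T c assms by (auto simp: path_tuple_def path_inv_def col_tuples_def)
qed

theorem theorem6p8:
  fixes n :: nat and lam :: "nat \<Rightarrow> nat" and C Or :: "gt set"
    and scale :: "complex \<Rightarrow> 'v::ab_group_add \<Rightarrow> 'v"
    and \<rho> :: "complex mat \<Rightarrow> 'v \<Rightarrow> 'v" and vlam :: 'v
  assumes "n \<ge> 1"
    and "C \<union> Or = gt_unmarked n" and "C \<inter> Or = {}"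
    and "irreducible_SL_module scale n \<rho>"
    and "highest_weight_vector scale n \<rho> lam vlam"
  shows "inj_on (basis_vector scale n \<rho> C vlam) (lattice_points n lam C Or) \<and>
    \<not> module.dependent scale (basis_vector scale n \<rho> C vlam ` lattice_points n lam C Or) \<and>
    module.span scale (basis_vector scale n \<rho> C vlam ` lattice_points n lam C Or) = UNIV"
proof -
  interpret highest_weight_module scale n \<rho> lam vlam
    using assms(4,5) by (simp add: highest_weight_module_def highest_weight_module_axioms_def)
  have C: "C \<subseteq> gt_unmarked n" using assms(2) by blast
  let ?I = "tableaux n lam" and ?pt = "tuple_point n C"
  let ?ws = "word_suffix n n 1"
  let ?\<phi> = "\<lambda>T. tuple_functional (path_tuple n C T)"
  have bv: "basis_vector scale n \<rho> C vlam a = word_vec C vlam a ?ws" for a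
    by (simp add: basis_vector_def word_vec_def zip_gt_list_i_list)
  have cols: "T \<in> col_tuples n ks" "path_tuple n C T \<in> col_tuples n ks" if "T \<in> ?I" for T
    using that path_tuple_col_tuples by (auto simp: tableaux_def)
  have tri: "(tableau_key n C S < tableau_key n C T \<longrightarrow> ?\<phi> T (word_vec C vlam (?pt S) ?ws) = 0) \<and>
      (tableau_key n C S = tableau_key n C T \<longrightarrow> ?\<phi> T (word_vec C vlam (?pt S) ?ws) \<noteq> 0)"
    if T: "T \<in> ?I" for S T
    unfolding tableau_key_def
  proof (rule word_triangular[where \<epsilon> = 1])
    show "R \<subseteq> {0..n}" if "R \<in> set T" for R using col_tuples_subset[OF cols(1)[OF T] that] .
    show "functional (?\<phi> T)" by (rule tuple_functional(1)[OF cols(2)[OF T]])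
    fix t
    have "word_mat n C t ?ws \<in> SL n"
    proof (rule word_mat_SL)
      show "1 \<le> i" if "(q, i) \<in> set ?ws" for q i using word_suffix_members[OF that] by simp
    qed
    from tuple_functional(2)[OF cols(2)[OF T] this]
    show "?\<phi> T (\<rho> (word_mat n C t ?ws) vlam) =
        1 * tuple_minor (map (\<lambda>R. path n C R n 1) T) (word_mat n C t ?ws)"
      by (simp add: path_tuple_def)
  qed auto
  have basis: "inj_on (\<lambda>T. word_vec C vlam (?pt T) ?ws) ?I"
    "independent ((\<lambda>T. word_vec C vlam (?pt T) ?ws) ` ?I)"
    "span ((\<lambda>T. word_vec C vlam (?pt T) ?ws) ` ?I) = UNIV"
  proof -
    \<comment> \<open>\<open>\<phi>\<close> is taken at the path tuples, where it is triangular, and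
      \<open>\<theta>\<close> at the tableaux themselves, where it separates vectors.\<close>
    note tb = triangular_basis[OF finite_tableaux tableau_key_inj[OF C], of lam ?\<phi>
        "\<lambda>T. word_vec C vlam (?pt T) ?ws" tuple_functional]
    show "inj_on (\<lambda>T. word_vec C vlam (?pt T) ?ws) ?I"
      "independent ((\<lambda>T. word_vec C vlam (?pt T) ?ws) ` ?I)"
      "span ((\<lambda>T. word_vec C vlam (?pt T) ?ws) ` ?I) = UNIV"
      by (rule tb; use tri cols tuple_functional(1) tableau_functionals_separate in blast)+
  qed
  have lp: "lattice_points n lam C Or = ?pt ` ?I"
    by (rule lattice_points_eq[OF assms(2,3)])
  have img: "basis_vector scale n \<rho> C vlam ` lattice_points n lam C Or =
      (\<lambda>T. word_vec C vlam (?pt T) ?ws) ` ?I"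
    unfolding lp image_image bv ..
  have "inj_on (basis_vector scale n \<rho> C vlam) (lattice_points n lam C Or)"
    unfolding lp
  proof (rule inj_onI)
    fix a b assume "a \<in> ?pt ` ?I" "b \<in> ?pt ` ?I"
      and eq: "basis_vector scale n \<rho> C vlam a = basis_vector scale n \<rho> C vlam b"
    then obtain S T where "S \<in> ?I" "T \<in> ?I" "a = ?pt S" "b = ?pt T" by blast
    moreover from this have "S = T" using basis(1) eq by (auto simp: inj_on_def bv)
    ultimately show "a = b" by simp
  qed
  then show ?thesis unfolding img using basis(2,3) by blast
qed

end
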